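(* Let $p+q=n$ and fix a sign $\pm$. Suppose that $(M,\partial M)$ is a compact submanifold (with boundary) of type $\mathrm{LAG}^{\pm}_{p,q}$ in $\mathbb{D}^n$ which is of constant phase $\theta$. If $(N,\partial N)$ is any other compact submanifold of the same type $\mathrm{LAG}^{\pm}_{p,q}$ with $\partial N=\partial M$, then $$\mathrm{vol}(M)\ \ge\ \mathrm{vol}(N),$$ with equality if and only if $N$ is also of constant phase $\theta$.
   Context: $\mathbb{D}$ denotes the double numbers: the real algebra generated by $1,\tau$ with $\tau^2=1$; $e^{\tau\theta}=\cosh\theta+\tau\sinh\theta$ for $\theta\in\mathbb{R}$. $\mathbb{D}^n=\mathbb{R}^n\oplus\tau\mathbb{R}^n$ has coordinates $z_j=x_j+\tau y_j$, the inner product of signature $(n,n)$ with quadratic form $\langle z,z\rangle=\sum_j(x_j^2-y_j^2)$, the symplectic form $\omega=\sum_jdx_j\wedge dy_j$, and the $\mathbb{D}$-valued $n$-form $dz=dz_1\wedge\cdots\wedge dz_n$, $dz_j=dx_j+\tau dy_j$. For an oriented Lagrangian $n$-plane $P$ ($\omega|_P=0$) on which $\langle\cdot,\cdot\rangle$ is non-degenerate of signature $(p,q)$, let $d\mathrm{vol}_P$ be the positive unit volume form (value $1$ on oriented orthonormal bases). For exactly one choice of sign there is $\theta_P\in\mathbb{R}$ with $\pm\tau^q\,dz|_P=e^{\tau\theta_P}\,d\mathrm{vol}_P$. $\mathrm{LAG}^{+}_{p,q}$ (resp. $\mathrm{LAG}^{-}_{p,q}$) is the set of such $P$ for which the sign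 is $+$ (resp. $-$). An oriented $n$-dimensional submanifold $M$ is of type $\mathrm{LAG}^{\pm}_{p,q}$ if all its oriented tangent planes lie in $\mathrm{LAG}^{\pm}_{p,q}$; then $\pm\tau^q\,dz|_M=e^{\tau\theta}d\mathrm{vol}_M$ for a function $\theta:M\to\mathbb{R}$, the phase function, and $M$ is of constant phase $\theta$ if this function is the constant $\theta$. $\mathrm{vol}(M)=\int_M d\mathrm{vol}_M$. Boundaries carry the induced orientation. *)

theory Defs
  imports "HOL-Analysis.Analysis"
begin

section \<open>Double numbers\<close>

datatype double = Double (xpart: real) (ypart: real)

lemma double_eq_iff: "z = w \<longleftrightarrow> xpart z = xpart w \<and> ypart z = ypart w"
  by (cases z; cases w) simp

instantiation double :: comm_ring_1
begin

definition "0 = Double 0 0"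
definition "1 = Double 1 0"
definition "z + w = Double (xpart z + xpart w) (ypart z + ypart w)"
definition "- z = Double (- xpart z) (- ypart z)"
definition "z - w = Double (xpart z - xpart w) (ypart z - ypart w)"
definition "z * w = Double (xpart z * xpart w + ypart z * ypart w)
                           (xpart z * ypart w + ypart z * xpart w)"

lemma double_ring_sel [simp]:
  "xpart 0 = 0" "ypart 0 = 0" "xpart 1 = 1" "ypart 1 = 0"
  "xpart (z + w) = xpart z + xpart w" "ypart (z + w) = ypart z + ypart w"
  "xpart (- z) = - xpart z" "ypart (- z) = - ypart z"
  "xpart (z - w) = xpart z - xpart w" "ypart (z - w) = ypart z - ypart w"
  "xpart (z * w) = xpart z * xpart w + ypart z * ypart w"
  "ypart (z * w) = xpart z * ypart w + ypart z * xpart w"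
  by (simp_all add: zero_double_def one_double_def plus_double_def uminus_double_def
      minus_double_def times_double_def)

instance
  by standard (simp_all add: double_eq_iff algebra_simps)

end

instantiation double :: real_algebra_1
begin

definition "r *\<^sub>R z = Double (r * xpart z) (r * ypart z)"

lemma double_scaleR_sel [simp]:
  "xpart (r *\<^sub>R z) = r * xpart z" "ypart (r *\<^sub>R z) = r * ypart z"
  by (simp_all add: scaleR_double_def)

instance
  by standard (simp_all add: double_eq_iff distrib_left distrib_right mult.assoc mult.left_commute)

end

text \<open>
  The positive definite inner product on \<^typ>\<open>double\<close> is auxiliary: it only serves to equip
  the double numbers, and hence \<^typ>\<open>double ^ 'n\<close>, with the usual topology and
  differentiable structure of \<open>\<real>\<^sup>2\<close> resp. of \<open>\<real>\<^sup>2\<^sup>n\<close>.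
\<close>

instantiation double :: real_inner
begin

definition inner_double_def: "inner z w = xpart z * xpart w + ypart z * ypart w"
definition norm_double_def: "norm z = sqrt ((xpart z)\<^sup>2 + (ypart z)\<^sup>2)"
definition sgn_double_def: "sgn (z :: double) = z /\<^sub>R norm z"
definition dist_double_def: "dist (z :: double) w = norm (z - w)"
definition uniformity_double_def:
  "(uniformity :: (double \<times> double) filter) = (INF e\<in>{0 <..}. principal {(z, w). dist z w < e})"
definition open_double_def:
  "open (U :: double set) \<longleftrightarrow> (\<forall>z\<in>U. eventually (\<lambda>(z', w). z' = z \<longrightarrow> w \<in> U) uniformity)"

instance
proof
  fix z w u :: double and r :: real and U :: "double set"
  show "inner z w = inner w z"
    by (simp add: inner_double_def mult.commute)
  show "inner (z + w) u = inner z u + inner w u"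
    by (simp add: inner_double_def distrib_right)
  show "inner (r *\<^sub>R z) w = r * inner z w"
    by (simp add: inner_double_def distrib_left mult.assoc)
  show "0 \<le> inner z z"
    by (simp add: inner_double_def)
  show "inner z z = 0 \<longleftrightarrow> z = 0"
    by (simp add: inner_double_def double_eq_iff add_nonneg_eq_0_iff)
  show "norm z = sqrt (inner z z)"
    by (simp add: inner_double_def norm_double_def power2_eq_square)
  show "sgn z = z /\<^sub>R norm z"
    by (rule sgn_double_def)
  show "dist z w = norm (z - w)"
    by (rule dist_double_def)
  show "(uniformity :: (double \<times> double) filter) = (INF e\<in>{0 <..}. principal {(z, w). dist z w < e})"
    by (rule uniformity_double_def)
  show "open U \<longleftrightarrow> (\<forall>z\<in>U. eventually (\<lambda>(z', w). z' = z \<longrightarrow> w \<in> U) uniformity)"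
    by (rule open_double_def)
qed

end

definition tau :: double  (\<open>\<tau>\<close>)
  where "\<tau> = Double 0 1"

lemma tau_sel [simp]: "xpart \<tau> = 0" "ypart \<tau> = 1"
  by (simp_all add: tau_def)

lemma tau_square: "\<tau> * \<tau> = 1"
  by (simp add: double_eq_iff)

lemma Double_conv: "Double x y = of_real x + \<tau> * of_real y"
  by (simp add: of_real_def double_eq_iff)

instantiation double :: euclidean_space
begin

definition Basis_double_def: "Basis = {1, \<tau>}"

instance
proof
  show "(Basis :: double set) \<noteq> {}" and "finite (Basis :: double set)"
    by (simp_all add: Basis_double_def)
  fix u v :: double
  assume "u \<in> Basis" "v \<in> Basis"
  then show "inner u v = (if u = v then 1 else 0)"
    by (auto simp: Basis_double_def inner_double_def double_eq_iff)
next
  fix z :: double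
  show "(\<forall>u\<in>Basis. inner z u = 0) \<longleftrightarrow> z = 0"
    by (simp add: Basis_double_def inner_double_def double_eq_iff [of z])
qed

end

definition exp_tau :: "real \<Rightarrow> double"
  where "exp_tau t = of_real (cosh t) + \<tau> * of_real (sinh t)"


section \<open>Linear algebra in \<open>\<D>\<^sup>n\<close>\<close>

definition dinner :: "double ^ 'n \<Rightarrow> double ^ 'n \<Rightarrow> real"
  where "dinner v w = (\<Sum>j\<in>UNIV. xpart (v $ j) * xpart (w $ j) - ypart (v $ j) * ypart (w $ j))"

definition omega :: "double ^ 'n \<Rightarrow> double ^ 'n \<Rightarrow> real"
  where "omega v w = (\<Sum>j\<in>UNIV. xpart (v $ j) * ypart (w $ j) - ypart (v $ j) * xpart (w $ j))"

text \<open>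
  An \<open>n\<close>-tuple of vectors is a function on the index type \<open>'n\<close>.  The following is
  \<open>dz\<^sub>1 \<and> \<dots> \<and> dz\<^sub>n\<close> evaluated on such a tuple, with the convention
  \<open>(\<alpha>\<^sub>1 \<and> \<dots> \<and> \<alpha>\<^sub>n) (v\<^sub>1, \<dots>, v\<^sub>n) = det (\<alpha>\<^sub>i (v\<^sub>j))\<close>.
\<close>

definition dz :: "('n \<Rightarrow> double ^ 'n) \<Rightarrow> double"
  where "dz v = det (\<chi> i j. v j $ i)"

definition frame :: "('n::finite \<Rightarrow> 'a::real_vector) \<Rightarrow> bool"
  where "frame b \<longleftrightarrow> inj b \<and> independent (range b)"

text \<open>
  An oriented \<open>n\<close>-plane is represented by the set of all its positively oriented ordered bases,
  that is, by the class \<open>oriented_by b\<close> of any one of them.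
\<close>

definition oriented_by :: "('n::finite \<Rightarrow> 'a::real_vector) \<Rightarrow> ('n \<Rightarrow> 'a) set"
  where "oriented_by b = {c. \<exists>A :: real ^ 'n ^ 'n. det A > 0 \<and> (\<forall>j. c j = (\<Sum>i\<in>UNIV. A $ i $ j *\<^sub>R b i))}"

definition oriented_plane :: "('n::finite \<Rightarrow> 'a::real_vector) set \<Rightarrow> bool"
  where "oriented_plane P \<longleftrightarrow> (\<exists>b. frame b \<and> P = oriented_by b)"

definition plane :: "('n::finite \<Rightarrow> 'a::real_vector) set \<Rightarrow> 'a set"
  where "plane P = (\<Union>b\<in>P. span (range b))"

definition orthonormal :: "('n \<Rightarrow> double ^ 'n) \<Rightarrow> bool"
  where "orthonormal e \<longleftrightarrow>
    (\<forall>i. dinner (e i) (e i) \<in> {1, - 1}) \<and> (\<forall>i j. i \<noteq> j \<longrightarrow> dinner (e i) (e j) = 0)"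

definition nondegenerate :: "(double ^ 'n) set \<Rightarrow> bool"
  where "nondegenerate S \<longleftrightarrow> (\<forall>v\<in>S. (\<forall>w\<in>S. dinner v w = 0) \<longrightarrow> v = 0)"

definition has_signature :: "(double ^ 'n::finite) set \<Rightarrow> nat \<Rightarrow> nat \<Rightarrow> bool"
  where "has_signature S p q \<longleftrightarrow>
    (\<exists>e :: 'n \<Rightarrow> double ^ 'n. frame e \<and> span (range e) = S \<and> orthonormal e \<and>
       card {i. dinner (e i) (e i) = 1} = p \<and> card {i. dinner (e i) (e i) = - 1} = q)"

definition alternating_form :: "'a::real_vector set \<Rightarrow> (('n \<Rightarrow> 'a) \<Rightarrow> real) \<Rightarrow> bool"
  where "alternating_form S \<eta> \<longleftrightarrow>
    (\<forall>v i. range v \<subseteq> S \<longrightarrow>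
       (\<forall>x\<in>S. \<forall>y\<in>S. \<eta> (v(i := x + y)) = \<eta> (v(i := x)) + \<eta> (v(i := y))) \<and>
       (\<forall>r. \<forall>x\<in>S. \<eta> (v(i := r *\<^sub>R x)) = r * \<eta> (v(i := x)))) \<and>
    (\<forall>v i j. range v \<subseteq> S \<longrightarrow> i \<noteq> j \<longrightarrow> v i = v j \<longrightarrow> \<eta> v = 0)"

text \<open>
  The last conjunct only makes the description unique as a function on all tuples of \<open>\<D>\<^sup>n\<close>.
\<close>

definition dvol :: "('n::finite \<Rightarrow> double ^ 'n) set \<Rightarrow> ('n \<Rightarrow> double ^ 'n) \<Rightarrow> real"
  where "dvol P = (THE \<eta>. alternating_form (plane P) \<eta> \<and>
    (\<forall>e\<in>P. orthonormal e \<longrightarrow> \<eta> e = 1) \<and> (\<forall>v. \<not> range v \<subseteq> plane P \<longrightarrow> \<eta> v = 0))"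

text \<open>In the following \<open>s\<close> is the sign, \<open>1\<close> or \<open>- 1\<close>.\<close>

definition has_phase :: "real \<Rightarrow> nat \<Rightarrow> ('n::finite \<Rightarrow> double ^ 'n) set \<Rightarrow> real \<Rightarrow> bool"
  where "has_phase s q P t \<longleftrightarrow>
    (\<forall>v. range v \<subseteq> plane P \<longrightarrow> of_real s * \<tau> ^ q * dz v = exp_tau t * of_real (dvol P v))"

definition LAG :: "real \<Rightarrow> nat \<Rightarrow> nat \<Rightarrow> ('n::finite \<Rightarrow> double ^ 'n) set set"
  where "LAG s p q = {P. oriented_plane P \<and> (\<forall>v\<in>plane P. \<forall>w\<in>plane P. omega v w = 0) \<and>
    nondegenerate (plane P) \<and> has_signature (plane P) p q \<and> (\<exists>t. has_phase s q P t)}"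

definition phase :: "real \<Rightarrow> nat \<Rightarrow> ('n::finite \<Rightarrow> double ^ 'n) set \<Rightarrow> real"
  where "phase s q P = (THE t. has_phase s q P t)"


section \<open>Oriented submanifolds with boundary\<close>

primrec Ck_on :: "nat \<Rightarrow> 'a::real_normed_vector set \<Rightarrow> ('a \<Rightarrow> 'b::real_normed_vector) \<Rightarrow> bool"
  where
    "Ck_on 0 S f \<longleftrightarrow> continuous_on S f"
  | "Ck_on (Suc k) S f \<longleftrightarrow> (\<forall>x\<in>S. f differentiable (at x)) \<and>
       (\<forall>v. Ck_on k S (\<lambda>x. frechet_derivative f (at x) v))"

definition smooth_on :: "'a::real_normed_vector set \<Rightarrow> ('a \<Rightarrow> 'b::real_normed_vector) \<Rightarrow> bool"
  where "smooth_on S f \<longleftrightarrow> (\<forall>k. Ck_on k S f)"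

definition first :: "'n::{finite,wellorder}"
  where "first = (LEAST i. True)"

definition half_space :: "(real ^ 'n::{finite,wellorder}) set"
  where "half_space = {x. x $ first \<le> 0}"

text \<open>
  A local parametrization of \<open>M\<close> near an interior or a boundary point: its domain is the relatively
  open subset \<open>V \<inter> half_space\<close> of the half space, on which it is smooth in the sense that it is
  given together with a smooth extension to \<open>V\<close>.
\<close>

definition parametrization ::
    "(double ^ 'n::{finite,wellorder}) set \<Rightarrow> (real ^ 'n::_ \<Rightarrow> double ^ 'n::_) \<Rightarrow> (real ^ 'n::_) set \<Rightarrow> bool"
  where "parametrization M \<phi> V \<longleftrightarrow>
    open V \<and> smooth_on V \<phi> \<and>
    (\<forall>x\<in>V \<inter> half_space. inj (frechet_derivative \<phi> (at x))) \<and>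
    openin (top_of_set M) (\<phi> ` (V \<inter> half_space)) \<and>
    (\<exists>\<psi>. homeomorphism (V \<inter> half_space) (\<phi> ` (V \<inter> half_space)) \<phi> \<psi>)"

definition submanifold :: "(double ^ 'n::{finite,wellorder}) set \<Rightarrow> bool"
  where "submanifold M \<longleftrightarrow>
    (\<forall>x\<in>M. \<exists>\<phi> V. parametrization M \<phi> V \<and> x \<in> \<phi> ` (V \<inter> half_space))"

definition boundary :: "(double ^ 'n::{finite,wellorder}) set \<Rightarrow> (double ^ 'n::_) set"
  where "boundary M = {\<phi> y |\<phi> V y. parametrization M \<phi> V \<and> y \<in> V \<and> y $ first = 0}"

text \<open>An orientation assigns to each point of \<open>M\<close> the set of positively oriented bases of the
  tangent space.  The constant basis \<open>b\<close> of \<open>\<real>\<^sup>n\<close> expresses that this choice is locally constant;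
  requiring \<open>\<phi>\<close> itself to preserve the orientation would be too restrictive for \<open>n = 1\<close>.\<close>

definition orientation ::
    "(double ^ 'n::{finite,wellorder}) set \<Rightarrow> (double ^ 'n::_ \<Rightarrow> ('n \<Rightarrow> double ^ 'n::_) set) \<Rightarrow> bool"
  where "orientation M ori \<longleftrightarrow>
    (\<forall>x\<in>M. \<exists>\<phi> V (b :: 'n \<Rightarrow> real ^ 'n::_).
       parametrization M \<phi> V \<and> x \<in> \<phi> ` (V \<inter> half_space) \<and> frame b \<and>
       (\<forall>y\<in>V \<inter> half_space. ori (\<phi> y) = oriented_by (\<lambda>i. frechet_derivative \<phi> (at y) (b i))))"

definition boundary_tangent :: "(double ^ 'n::{finite,wellorder}) set \<Rightarrow> double ^ 'n::_ \<Rightarrow> (double ^ 'n::_) set"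
  where "boundary_tangent M x = {frechet_derivative \<phi> (at y) u |\<phi> V y u.
    parametrization M \<phi> V \<and> y \<in> V \<and> y $ first = 0 \<and> \<phi> y = x \<and> u $ first = 0}"

definition outward :: "(double ^ 'n::{finite,wellorder}) set \<Rightarrow> double ^ 'n::_ \<Rightarrow> (double ^ 'n::_) set"
  where "outward M x = {frechet_derivative \<phi> (at y) u |\<phi> V y u.
    parametrization M \<phi> V \<and> y \<in> V \<and> y $ first = 0 \<and> \<phi> y = x \<and> u $ first > 0}"

text \<open>
  The oriented boundary consists of the set \<open>boundary M\<close> and the induced orientation (outward
  vector first).  Ordered bases of the \<open>(n - 1)\<close>-dimensional tangent spaces of the boundary are
  families indexed by \<open>- {first}\<close>.  For \<open>n = 1\<close> the only such family is the empty one, and the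
  orientation of a boundary point consists of it or is empty according to the sign of the point.
\<close>

definition oriented_boundary ::
    "(double ^ 'n::{finite,wellorder}) set \<Rightarrow> (double ^ 'n::_ \<Rightarrow> ('n \<Rightarrow> double ^ 'n::_) set) \<Rightarrow>
     (double ^ 'n::_) set \<times> (double ^ 'n::_ \<Rightarrow> ('n \<Rightarrow> double ^ 'n::_) set)"
  where "oriented_boundary M ori =
    (boundary M,
     \<lambda>x\<in>boundary M. {w \<in> (- {first}) \<rightarrow>\<^sub>E boundary_tangent M x.
        \<exists>\<nu>\<in>outward M x. w(first := \<nu>) \<in> ori x})"

definition coordinate_frame :: "(real ^ 'n \<Rightarrow> double ^ 'n) \<Rightarrow> real ^ 'n \<Rightarrow> 'n::finite \<Rightarrow> double ^ 'n"
  where "coordinate_frame \<phi> y = (\<lambda>i. frechet_derivative \<phi> (at y) (axis i 1))"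

text \<open>
  The integral of an \<open>n\<close>-form over a compact oriented submanifold, by means of a partition of unity
  subordinate to finitely many parametrizations.  The sign accounts for parametrizations that
  reverse the orientation.
\<close>

definition has_form_integral ::
    "(double ^ 'n::{finite,wellorder}) set \<Rightarrow> (double ^ 'n::_ \<Rightarrow> ('n \<Rightarrow> double ^ 'n::_) set) \<Rightarrow>
     (double ^ 'n::_ \<Rightarrow> ('n \<Rightarrow> double ^ 'n::_) \<Rightarrow> real) \<Rightarrow> real \<Rightarrow> bool"
  where "has_form_integral M ori \<eta> I \<longleftrightarrow>
    (\<exists>(K :: nat) \<phi> V \<rho>.
       (\<forall>k<K. parametrization M (\<phi> k) (V k) \<and> continuous_on M (\<rho> k) \<and> (\<forall>x\<in>M. 0 \<le> \<rho> k x) \<and>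
          closure {x \<in> M. \<rho> k x \<noteq> 0} \<subseteq> \<phi> k ` (V k \<inter> half_space)) \<and>
       (\<forall>x\<in>M. (\<Sum>k<K. \<rho> k x) = 1) \<and>
       I = (\<Sum>k<K. integral (V k \<inter> half_space) (\<lambda>y.
              \<rho> k (\<phi> k y) * (if coordinate_frame (\<phi> k) y \<in> ori (\<phi> k y) then 1 else - 1) *
              \<eta> (\<phi> k y) (coordinate_frame (\<phi> k) y))))"

definition form_integral ::
    "(double ^ 'n::{finite,wellorder}) set \<Rightarrow> (double ^ 'n::_ \<Rightarrow> ('n \<Rightarrow> double ^ 'n::_) set) \<Rightarrow>
     (double ^ 'n::_ \<Rightarrow> ('n \<Rightarrow> double ^ 'n::_) \<Rightarrow> real) \<Rightarrow> real"
  where "form_integral M ori \<eta> = (THE I. has_form_integral M ori \<eta> I)"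

definition vol ::
    "(double ^ 'n::{finite,wellorder}) set \<Rightarrow> (double ^ 'n::_ \<Rightarrow> ('n \<Rightarrow> double ^ 'n::_) set) \<Rightarrow> real"
  where "vol M ori = form_integral M ori (\<lambda>x. dvol (ori x))"

definition of_type_LAG ::
    "real \<Rightarrow> nat \<Rightarrow> nat \<Rightarrow> (double ^ 'n::{finite,wellorder}) set \<Rightarrow>
     (double ^ 'n::_ \<Rightarrow> ('n \<Rightarrow> double ^ 'n::_) set) \<Rightarrow> bool"
  where "of_type_LAG s p q M ori \<longleftrightarrow>
    submanifold M \<and> orientation M ori \<and> (\<forall>x\<in>M. ori x \<in> LAG s p q)"

definition constant_phase ::
    "real \<Rightarrow> nat \<Rightarrow> (double ^ 'n::{finite,wellorder}) set \<Rightarrow>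
     (double ^ 'n::_ \<Rightarrow> ('n \<Rightarrow> double ^ 'n::_) set) \<Rightarrow> real \<Rightarrow> bool"
  where "constant_phase s q M ori \<theta> \<longleftrightarrow> (\<forall>x\<in>M. phase s q (ori x) = \<theta>)"

end

theory Submission
  imports Defs
begin

text \<open>
  In the null coordinates \<open>u = x + y\<close>, \<open>v = x - y\<close> the form \<open>dz\<close> splits into the real forms
  \<open>du\<^sub>1 \<and> \<dots> \<and> du\<^sub>n\<close> and \<open>dv\<^sub>1 \<and> \<dots> \<and> dv\<^sub>n\<close>, and on a plane of phase \<open>t\<close> these are \<open>\<plusminus> e\<^sup>t dvol\<close> and
  \<open>\<plusminus> e\<^sup>-\<^sup>t dvol\<close> with signs that depend only on the type.  Since
  \<open>(e\<^sup>-\<^sup>\<theta> e\<^sup>t + e\<^sup>\<theta> e\<^sup>-\<^sup>t) / 2 = cosh (t - \<theta>) \<ge> 1\<close>, the volume is bounded by a combination of the areas of the two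
  projections, counted with multiplicity, and the bound is attained exactly for constant phase \<open>\<theta>\<close>.

  Stokes' theorem is not needed to see that these areas depend on the oriented boundary only: both
  projections restrict to local diffeomorphisms of fixed sign, so the difference of the numbers of
  preimages in \<open>M\<close> and in \<open>N\<close> is locally constant; near the image of a boundary point, \<open>M\<close> and
  \<open>N\<close> fill the same side of the same hypersurface.  It vanishes far away, hence everywhere, and
  the area formula applies.
\<close>

section \<open>Null coordinates\<close>

text \<open>Both projections are treated at once: the geometric argument is carried out for an
  abstract linear map \<open>L\<close> and a sign, and is instantiated twice at the end.

  The volume is defined by a description ranging over all parametrizations and partitions of unity,
  so its independence of these choices has to be proved. No changes of variables between
  parametrizations are made for this: by the area formula for the first projection, every choice
  computes the integral over the target space of the sum of \<open>exp (- phase)\<close> over the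
  fibres.

  The delicate point is the boundary. \<open>M\<close> and \<open>N\<close> may share nothing but
  their boundary, so there is no transition map between their parametrizations. They are compared
  through \<open>L\<close>: a parametrization of \<open>M\<close>, followed by \<open>L\<close>,
  followed by a local inverse belonging to \<open>N\<close>. On the boundary hyperplane this map is
  controlled by the common boundary set; transversally only the sign of one number matters, and this
  is exactly the information in the induced orientation. A negative sign would place
  \<open>M\<close> and \<open>N\<close> on opposite sides.\<close>

definition null_coord :: "real \<Rightarrow> double ^ 'n \<Rightarrow> real ^ 'n"
  where "null_coord \<sigma> z = (\<chi> i. xpart (z $ i) + \<sigma> * ypart (z $ i))"

text \<open>The pullback of the standard volume form by \<open>L\<close>, with the vectors as rows.
  For \<open>null_coord 1\<close> and \<open>null_coord (- 1)\<close> these are the real n-forms du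
  and dv. The domain of \<open>L\<close> is left arbitrary so that a composite with a derivative is
  covered too, which gives Jacobians.\<close>

definition coord_det :: "('a \<Rightarrow> real ^ 'n) \<Rightarrow> ('n \<Rightarrow> 'a) \<Rightarrow> real"
  where "coord_det L v = det (\<chi> j. L (v j))"

lemma linear_null_coord: "linear (null_coord \<sigma>)"
  by (rule linearI) (simp_all add: null_coord_def vec_eq_iff algebra_simps)

text \<open>For both signs, x + \<tau> y \<mapsto> x + \<sigma> y is the ring homomorphism to the
  reals that sends \<tau> to \<sigma>; the defect of multiplicativity is a multiple of
  \<open>1 - \<sigma> * \<sigma>\<close>.\<close>

lemma null_coord_prod:
  assumes "finite A" and "\<sigma> * \<sigma> = 1"
  shows "xpart (prod f A) + \<sigma> * ypart (prod f A) = (\<Prod>i\<in>A. xpart (f i) + \<sigma> * ypart (f i))"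
  using assms(1)
proof induction
  case (insert i A)
  have "xpart (f i * prod f A) + \<sigma> * ypart (f i * prod f A)
      = (xpart (f i) + \<sigma> * ypart (f i)) * (xpart (prod f A) + \<sigma> * ypart (prod f A))
        + (1 - \<sigma> * \<sigma>) * ypart (f i) * ypart (prod f A)"
    by (simp add: algebra_simps)
  then show ?case
    using insert assms(2) by simp
qed simp

lemma xypart_sum: "xpart (sum f A) = (\<Sum>i\<in>A. xpart (f i))" "ypart (sum f A) = (\<Sum>i\<in>A. ypart (f i))"
  by (induction A rule: infinite_finite_induct) auto

lemma double_of_real_sel [simp]: "xpart (of_real r) = r" "ypart (of_real r) = 0"
  by (simp_all add: of_real_def)

text \<open>A ring homomorphism commutes with the Leibniz expansion of a determinant.\<close>

lemma null_coord_dz: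
  assumes "\<sigma> * \<sigma> = 1"
  shows "xpart (dz v) + \<sigma> * ypart (dz v) = coord_det (null_coord \<sigma>) v"
proof -
  have *: "of_int (sign p) = (of_real (of_int (sign p)) :: double)" for p :: "'n \<Rightarrow> 'n"
    by simp
  have "coord_det (null_coord \<sigma>) v = det (transpose (\<chi> j. null_coord \<sigma> (v j)))"
    by (simp add: coord_det_def det_transpose)
  also have "\<dots> = (\<Sum>p | p permutes UNIV. of_int (sign p) *
      (\<Prod>i\<in>UNIV. xpart (v (p i) $ i) + \<sigma> * ypart (v (p i) $ i)))"
    by (simp add: det_def transpose_def null_coord_def)
  also have "\<dots> = (\<Sum>p | p permutes UNIV. of_int (sign p) *
      (xpart (\<Prod>i\<in>UNIV. v (p i) $ i) + \<sigma> * ypart (\<Prod>i\<in>UNIV. v (p i) $ i)))"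
    by (simp add: null_coord_prod [OF _ assms])
  also have "\<dots> = xpart (dz v) + \<sigma> * ypart (dz v)"
    unfolding dz_def det_def *
    by (simp add: xypart_sum sum_distrib_left algebra_simps sum.distrib del: of_real_of_int_eq)
  finally show ?thesis ..
qed

section \<open>Determinants as alternating forms\<close>

lemma coord_det_matrix:
  fixes b :: "'n::finite \<Rightarrow> 'a::real_vector"
  assumes "linear L"
  shows "coord_det L (\<lambda>j. \<Sum>i\<in>UNIV. A $ i $ j *\<^sub>R b i) = det A * coord_det L b"
proof -
  have "(\<chi> j. L (\<Sum>i\<in>UNIV. A $ i $ j *\<^sub>R b i)) = transpose A ** (\<chi> i. L (b i))"
    by (simp add: vec_eq_iff matrix_matrix_mult_def transpose_def
        linear_sum [OF assms] linear_scale [OF assms])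
  then show ?thesis
    by (simp add: coord_det_def det_mul det_transpose)
qed

lemma chi_fun_upd: "(\<chi> j. L ((v(i := x)) j)) = (\<chi> j. if j = i then L x else L (v j))"
  by (simp add: vec_eq_iff)

lemma coord_det_alternating:
  assumes "linear L"
  shows "alternating_form S (coord_det L)"
  unfolding alternating_form_def coord_det_def chi_fun_upd
    linear_add [OF assms] linear_scale [OF assms]
proof (intro conjI allI impI ballI)
  fix v i x y r
  show "det (\<chi> j. if j = i then L x + L y else L (v j))
      = det (\<chi> j. if j = i then L x else L (v j)) + det (\<chi> j. if j = i then L y else L (v j))"
    by (rule det_row_add)
  show "det (\<chi> j. if j = i then r *\<^sub>R L x else L (v j)) = r * det (\<chi> j. if j = i then L x else L (v j))"
    using det_row_mul [of i r "\<lambda>_. L x" "\<lambda>j. L (v j)"] unfolding scalar_mult_eq_scaleR .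
next
  fix v :: "'b \<Rightarrow> 'a" and i j
  assume "i \<noteq> j" "v i = v j"
  then show "det (\<chi> j. L (v j)) = 0"
    by (intro det_identical_rows [of i j]) (auto simp: row_def vec_eq_iff)
qed

lemma alternating_formD:
  assumes "alternating_form S \<eta>" "range v \<subseteq> S"
  shows "x \<in> S \<Longrightarrow> y \<in> S \<Longrightarrow> \<eta> (v(i := x + y)) = \<eta> (v(i := x)) + \<eta> (v(i := y))"
    and "x \<in> S \<Longrightarrow> \<eta> (v(i := r *\<^sub>R x)) = r * \<eta> (v(i := x))"
    and "i \<noteq> j \<Longrightarrow> v i = v j \<Longrightarrow> \<eta> v = 0"
  using assms unfolding alternating_form_def by blast+

text \<open>This makes alternating forms of top degree unique. Elementary matrices suffice because
  both sides are multiplicative in \<open>A\<close>; \<open>v\<close> stays arbitrary since in a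
  product the rule for the left factor is applied to the tuple already transformed by the right
  one.\<close>

lemma alternating_form_matrix:
  fixes A :: "real ^ 'n ^ 'n"
  assumes alt: "alternating_form S \<eta>" and S: "subspace S" and v: "range v \<subseteq> S"
  shows "\<eta> (\<lambda>i. \<Sum>j\<in>UNIV. A $ i $ j *\<^sub>R v j) = det A * \<eta> v"
proof -
  note add = alternating_formD(1) [OF alt] and scal = alternating_formD(2) [OF alt]
    and null = alternating_formD(3) [OF alt]
  show ?thesis
    using v
  proof (induction A arbitrary: v rule: induct_matrix_elementary [case_names mult zero_row diagonal swap1 idplus])
    case (mult A B)
    have "(\<lambda>i. \<Sum>j\<in>UNIV. (A ** B) $ i $ j *\<^sub>R v j)
        = (\<lambda>i. \<Sum>k\<in>UNIV. A $ i $ k *\<^sub>R (\<Sum>j\<in>UNIV. B $ k $ j *\<^sub>R v j))"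
      by (auto simp: matrix_matrix_mult_def scaleR_sum_left scaleR_sum_right fun_eq_iff
          intro: sum.swap)
    moreover have "range (\<lambda>k. \<Sum>j\<in>UNIV. B $ k $ j *\<^sub>R v j) \<subseteq> S"
      using S mult.prems by (auto intro!: subspace_sum subspace_scale)
    ultimately show ?case
      using mult by (simp add: det_mul)
  next
    case (zero_row A i)
    let ?w = "\<lambda>i. \<Sum>j\<in>UNIV. A $ i $ j *\<^sub>R v j"
    have w: "range ?w \<subseteq> S"
      using S zero_row.prems by (auto intro!: subspace_sum subspace_scale)
    have "A $ i $ j = 0" for j
      using zero_row(1) by (simp add: row_def vec_eq_iff)
    \<comment> \<open>The zero entry is written as a multiple of 0, so that homogeneity produces the
      factor 0.\<close>
    then have "?w = ?w(i := 0 *\<^sub>R 0)"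
      by (auto simp: fun_eq_iff)
    then have "\<eta> ?w = \<eta> (?w(i := 0 *\<^sub>R 0))"
      by (rule arg_cong)
    also have "\<dots> = 0 * \<eta> (?w(i := 0))"
      using subspace_0 [OF S] by (rule scal [OF w])
    finally show ?case
      by (simp add: det_zero_row(2) [OF zero_row(1)])
  next
    case (diagonal A)
    \<comment> \<open>The entries are scaled one at a time; \<open>T\<close> holds the indices
      already treated.\<close>
    have "\<eta> (\<lambda>i. if i \<in> T then A $ i $ i *\<^sub>R v i else v i) = (\<Prod>i\<in>T. A $ i $ i) * \<eta> v" for T :: "'n set"
      using finite [of T]
    proof induction
      case (insert k T)
      let ?u = "\<lambda>i. if i \<in> T then A $ i $ i *\<^sub>R v i else v i"
      have u: "range ?u \<subseteq> S"
        using S diagonal.prems by (auto intro!: subspace_scale)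
      have "\<eta> (?u(k := A $ k $ k *\<^sub>R v k)) = A $ k $ k * \<eta> (?u(k := v k))"
        using diagonal.prems by (intro scal u) auto
      moreover have "?u(k := v k) = ?u"
        using insert by auto
      moreover have "(\<lambda>i. if i \<in> insert k T then A $ i $ i *\<^sub>R v i else v i) = ?u(k := A $ k $ k *\<^sub>R v k)"
        using insert by auto
      ultimately show ?case
        using insert by simp
    qed simp
    from this [of UNIV] have "\<eta> (\<lambda>i. A $ i $ i *\<^sub>R v i) = det A * \<eta> v"
      using det_diagonal [of A] diagonal(1) by simp
    moreover have "(\<Sum>j\<in>UNIV. A $ i $ j *\<^sub>R v j) = A $ i $ i *\<^sub>R v i" for i
      using diagonal(1) [of i] by (subst sum.remove [of _ i]) (auto intro!: sum.neutral)
    ultimately show ?case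
      by simp
  next
    case (swap1 m n)
    let ?w = "\<lambda>x y. v(m := x, n := y)"
    let ?x = "v m" and ?y = "v n"
    have x: "?x \<in> S" and y: "?y \<in> S" and xy: "?x + ?y \<in> S"
      using swap1.prems S by (auto intro: subspace_add)
    have w: "range (?w a b) \<subseteq> S" if "a \<in> S" "b \<in> S" for a b
      using swap1.prems that by auto
    have zero: "\<eta> (?w a a) = 0" if "a \<in> S" for a
    proof -
      have "?w a a m = ?w a a n"
        using swap1(1) by simp
      with w [OF that that] swap1(1) show ?thesis
        by (rule null)
    qed
    have add2: "\<eta> (?w a (b + c)) = \<eta> (?w a b) + \<eta> (?w a c)" if "a \<in> S" "b \<in> S" "c \<in> S" for a b c
      using add [of "v(m := a)" b c n] that swap1.prems by auto
    have add1: "\<eta> (?w (b + c) a) = \<eta> (?w b a) + \<eta> (?w c a)" if "a \<in> S" "b \<in> S" "c \<in> S" for a b c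
    proof -
      have *: "?w d a = (v(n := a))(m := d)" for d
        using swap1(1) by (simp add: fun_upd_twist)
      show ?thesis
        unfolding * using that swap1.prems by (intro add) auto
    qed
    \<comment> \<open>Polarization: vanishing on repeated entries implies a change of sign under a
      swap.\<close>
    have "0 = \<eta> (?w (?x + ?y) (?x + ?y))"
      using zero [OF xy] by simp
    also have "\<dots> = \<eta> (?w ?x ?y) + \<eta> (?w ?y ?x)"
      by (simp only: add1 [OF xy x y] add2 [OF x x y] add2 [OF y x y] zero [OF x] zero [OF y])
    finally have "\<eta> (?w ?y ?x) = - \<eta> v"
      by simp
    moreover have "(\<lambda>i. \<Sum>j\<in>UNIV. (\<chi> i j. mat 1 $ i $ Transposition.transpose m n j) $ i $ j *\<^sub>R v j) = ?w ?y ?x"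
    proof
      fix i
      have "(\<Sum>j\<in>UNIV. (\<chi> i j. (mat 1 :: real ^ 'n ^ 'n) $ i $ Transposition.transpose m n j) $ i $ j *\<^sub>R v j)
          = (\<Sum>j\<in>UNIV. if j = Transposition.transpose m n i then v j else 0)"
        by (rule sum.cong) (auto simp: mat_def Transposition.transpose_def)
      then show "(\<Sum>j\<in>UNIV. (\<chi> i j. (mat 1 :: real ^ 'n ^ 'n) $ i $ Transposition.transpose m n j) $ i $ j *\<^sub>R v j) = (?w ?y ?x) i"
        by (auto simp: Transposition.transpose_def)
    qed
    moreover have "det (\<chi> i j. (mat 1 :: real ^ 'n ^ 'n) $ i $ Transposition.transpose m n j) = - 1"
    proof -
      have "det (\<chi> i j. (mat 1 :: real ^ 'n ^ 'n) $ i $ Transposition.transpose m n j)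
          = of_int (sign (Transposition.transpose m n)) * det (mat 1 :: real ^ 'n ^ 'n)"
        by (rule det_permute_columns) (simp add: permutes_swap_id)
      then show ?thesis
        using swap1(1) by (simp add: sign_swap_id)
    qed
    ultimately show ?case
      by simp
  next
    case (idplus m n c)
    let ?E = "(\<chi> i j. if i = m \<and> j = n then c else of_bool (i = j)) :: real ^ 'n ^ 'n"
    have x: "v m \<in> S" and y: "v n \<in> S" and cy: "c *\<^sub>R v n \<in> S"
      using idplus.prems S by (auto intro: subspace_scale)
    have "\<eta> (v(m := v m + c *\<^sub>R v n)) = \<eta> (v(m := v m)) + c * \<eta> (v(m := v n))"
      by (simp only: add [OF idplus.prems x cy] scal [OF idplus.prems y])
    moreover have "\<eta> (v(m := v n)) = 0"
    proof -
      have "range (v(m := v n)) \<subseteq> S" "(v(m := v n)) m = (v(m := v n)) n"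
        using idplus.prems by auto
      with idplus(1) show ?thesis
        by (metis null)
    qed
    ultimately have "\<eta> (v(m := v m + c *\<^sub>R v n)) = \<eta> v"
      by simp
    moreover have "(\<lambda>i. \<Sum>j\<in>UNIV. ?E $ i $ j *\<^sub>R v j) = v(m := v m + c *\<^sub>R v n)"
    proof
      fix i
      have "(\<Sum>j\<in>UNIV. ?E $ i $ j *\<^sub>R v j)
          = (\<Sum>j\<in>UNIV. (if j = i then v j else 0) + (if j = n then if i = m then c *\<^sub>R v j else 0 else 0))"
        using idplus(1) by (intro sum.cong) auto
      then show "(\<Sum>j\<in>UNIV. ?E $ i $ j *\<^sub>R v j) = (v(m := v m + c *\<^sub>R v n)) i"
        by (auto simp: sum.distrib)
    qed
    moreover have "det ?E = 1"
    proof -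
      have "?E = (\<chi> k. if k = m then row m (mat 1) + c *s row n (mat 1) else row k (mat 1 :: real ^ 'n ^ 'n))"
        using idplus(1) by (auto simp: vec_eq_iff row_def mat_def)
      then show ?thesis
        using det_row_operation [OF idplus(1), where A = "mat 1 :: real ^ 'n ^ 'n" and c = c] by simp
    qed
    ultimately show ?case
      by simp
  qed
qed

section \<open>Oriented planes\<close>

lemma plane_oriented_by:
  fixes b :: "'n::finite \<Rightarrow> 'a::real_vector"
  shows "plane (oriented_by b) = span (range b)" "b \<in> oriented_by b"
proof -
  show b: "b \<in> oriented_by b"
  proof -
    have "b j = (\<Sum>i\<in>UNIV. mat 1 $ i $ j *\<^sub>R b i)" for j
    proof -
      have "(\<Sum>i\<in>UNIV. mat 1 $ i $ j *\<^sub>R b i) = (\<Sum>i\<in>UNIV. if i = j then b i else 0)"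
        by (rule sum.cong) (auto simp: mat_def)
      then show ?thesis
        by simp
    qed
    then show ?thesis
      unfolding oriented_by_def
      by (intro CollectI exI [of _ "mat 1 :: real ^ 'n ^ 'n"] conjI allI) (simp, assumption)
  qed
  have "span (range c) \<subseteq> span (range b)" if "c \<in> oriented_by b" for c
  proof (rule span_minimal)
    have "c j \<in> span (range b)" for j
      using that unfolding oriented_by_def by (auto intro!: span_sum span_scale [OF span_base])
    then show "range c \<subseteq> span (range b)"
      by (intro image_subsetI)
  qed simp
  then show "plane (oriented_by b) = span (range b)"
    unfolding plane_def using b by blast
qed

lemma range_subset_plane: "b \<in> P \<Longrightarrow> range b \<subseteq> plane P"
  unfolding plane_def by (auto intro: span_base)

lemma oriented_byE:
  fixes b :: "'n::finite \<Rightarrow> 'a::real_vector"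
  assumes "c \<in> oriented_by b"
  obtains A :: "real ^ 'n ^ 'n" where "det A > 0" "c = (\<lambda>j. \<Sum>i\<in>UNIV. A $ i $ j *\<^sub>R b i)"
  using assms unfolding oriented_by_def by (auto simp: fun_eq_iff)

lemma span_range_expansion:
  fixes b :: "'n::finite \<Rightarrow> 'a::real_vector" and c :: "'m::finite \<Rightarrow> 'a"
  assumes "range c \<subseteq> span (range b)"
  obtains A :: "real ^ 'm ^ 'n" where "c = (\<lambda>j. \<Sum>i\<in>UNIV. A $ i $ j *\<^sub>R b i)"
proof -
  have "\<exists>u. c j = (\<Sum>i\<in>UNIV. u i *\<^sub>R b i)" for j
  proof -
    have "c j \<in> range (\<lambda>u. \<Sum>v\<in>range b. u v *\<^sub>R v)"
      using assms span_finite [of "range b"] by auto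
    then obtain u where u: "c j = (\<Sum>v\<in>range b. u v *\<^sub>R v)"
      by auto
    \<comment> \<open>\<open>b\<close> may take a value several times; the whole coefficient of that
      value goes to one chosen index and the others get 0.\<close>
    define w where "w i = (if i = (SOME k. b k = b i) then u (b i) else 0)" for i
    have "(\<Sum>i\<in>UNIV. w i *\<^sub>R b i) = (\<Sum>v\<in>range b. \<Sum>i\<in>{i\<in>UNIV. b i = v}. w i *\<^sub>R b i)"
      by (rule sum.image_gen) simp
    also have "\<dots> = (\<Sum>v\<in>range b. u v *\<^sub>R v)"
    proof (rule sum.cong [OF refl])
      fix v assume "v \<in> range b"
      then have s: "b (SOME k. b k = v) = v"
        by (metis (mono_tags) imageE someI_ex)
      have "(\<Sum>i\<in>{i\<in>UNIV. b i = v}. w i *\<^sub>R b i)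
          = (\<Sum>i\<in>{i\<in>UNIV. b i = v}. if i = (SOME k. b k = v) then u v *\<^sub>R v else 0)"
        by (rule sum.cong) (auto simp: w_def)
      then show "(\<Sum>i\<in>{i\<in>UNIV. b i = v}. w i *\<^sub>R b i) = u v *\<^sub>R v"
        using s by simp
    qed
    finally have "c j = (\<Sum>i\<in>UNIV. w i *\<^sub>R b i)"
      using u by simp
    then show ?thesis
      by blast
  qed
  then obtain u where "c j = (\<Sum>i\<in>UNIV. u j i *\<^sub>R b i)" for j
    by metis
  then show ?thesis
    by (intro that [of "\<chi> i j. u j i"]) auto
qed

text \<open>The products (x - y)(x' + y') of null coordinates add up to
  \<open>dinner + omega\<close>. On a Lagrangian plane only the Gram matrix remains, which is
  diagonal with entries 1 and -1 on an orthonormal tuple. So du dv is, up to sign, the square of the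
  volume form.\<close>

lemma coord_det_product:
  fixes e :: "'n::finite \<Rightarrow> double ^ 'n"
  assumes "orthonormal e" and "\<And>i j. omega (e i) (e j) = 0"
  shows "\<bar>coord_det (null_coord 1) e * coord_det (null_coord (- 1)) e\<bar> = 1"
proof -
  let ?A = "(\<chi> j. null_coord (- 1) (e j)) ** transpose (\<chi> j. null_coord 1 (e j))"
  have A: "?A $ j $ k = dinner (e j) (e k) + omega (e j) (e k)" for j k
    by (simp add: matrix_matrix_mult_def transpose_def null_coord_def dinner_def omega_def
        sum.distrib [symmetric] algebra_simps)
  have "det ?A = (\<Prod>i\<in>UNIV. ?A $ i $ i)"
    using assms by (intro det_diagonal) (simp add: A orthonormal_def)
  moreover have "\<bar>\<Prod>i\<in>UNIV. ?A $ i $ i\<bar> = (\<Prod>i\<in>UNIV. \<bar>?A $ i $ i\<bar>)"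
    by (rule abs_prod)
  moreover have "\<bar>?A $ i $ i\<bar> = 1" for i
    using assms unfolding A orthonormal_def by (metis abs_1 abs_minus_cancel add_0_right insertE singletonD)
  ultimately have "\<bar>det ?A\<bar> = 1"
    by simp
  then show ?thesis
    by (simp add: det_mul coord_det_def det_transpose mult.commute)
qed

section \<open>Orientation classes of bases\<close>

lemma oriented_by_trans:
  fixes b :: "'n::finite \<Rightarrow> 'a::real_vector"
  assumes "c \<in> oriented_by b" "d \<in> oriented_by c"
  shows "d \<in> oriented_by b"
proof -
  obtain A :: "real ^ 'n ^ 'n" where A: "det A > 0" "\<And>j. c j = (\<Sum>i\<in>UNIV. A $ i $ j *\<^sub>R b i)"
    using assms(1) by (auto simp: oriented_by_def)
  obtain B :: "real ^ 'n ^ 'n" where B: "det B > 0" "\<And>j. d j = (\<Sum>i\<in>UNIV. B $ i $ j *\<^sub>R c i)"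
    using assms(2) by (auto simp: oriented_by_def)
  have "d j = (\<Sum>k\<in>UNIV. \<Sum>i\<in>UNIV. (A $ k $ i * B $ i $ j) *\<^sub>R b k)" for j
  proof -
    have "d j = (\<Sum>i\<in>UNIV. \<Sum>k\<in>UNIV. (B $ i $ j * A $ k $ i) *\<^sub>R b k)"
      by (simp only: A(2) B(2) scaleR_sum_right scaleR_scaleR)
    also have "\<dots> = (\<Sum>k\<in>UNIV. \<Sum>i\<in>UNIV. (B $ i $ j * A $ k $ i) *\<^sub>R b k)"
      by (rule sum.swap)
    finally show ?thesis
      by (simp only: mult.commute)
  qed
  then have "d j = (\<Sum>k\<in>UNIV. (A ** B) $ k $ j *\<^sub>R b k)" for j
    by (simp add: matrix_matrix_mult_def scaleR_sum_left)
  then show ?thesis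
    using A(1) B(1) unfolding oriented_by_def
    by (intro CollectI exI [of _ "A ** B"] conjI allI) (simp_all add: det_mul)
qed

lemma oriented_by_sym:
  fixes b :: "'n::finite \<Rightarrow> 'a::real_vector"
  assumes "c \<in> oriented_by b"
  shows "b \<in> oriented_by c"
proof -
  obtain A :: "real ^ 'n ^ 'n" where A: "det A > 0" "\<And>j. c j = (\<Sum>i\<in>UNIV. A $ i $ j *\<^sub>R b i)"
    using assms by (auto simp: oriented_by_def)
  then obtain B where B: "A ** B = mat 1"
    using invertible_det_nz [of A] by (auto simp: invertible_def)
  have "(\<Sum>i\<in>UNIV. B $ i $ j *\<^sub>R c i) = (\<Sum>k\<in>UNIV. \<Sum>i\<in>UNIV. (A $ k $ i * B $ i $ j) *\<^sub>R b k)" for j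
    unfolding A(2) scaleR_sum_right
    by (subst sum.swap) (simp add: mult.commute)
  then have "(\<Sum>i\<in>UNIV. B $ i $ j *\<^sub>R c i) = (\<Sum>k\<in>UNIV. (A ** B) $ k $ j *\<^sub>R b k)" for j
    by (simp add: matrix_matrix_mult_def scaleR_sum_left)
  also have "(\<Sum>k\<in>UNIV. (A ** B) $ k $ j *\<^sub>R b k) = (\<Sum>k\<in>UNIV. if k = j then b k else 0)" for j
    unfolding B by (rule sum.cong) (auto simp: mat_def)
  finally have "b j = (\<Sum>i\<in>UNIV. B $ i $ j *\<^sub>R c i)" for j
    by simp
  moreover have "det A * det B = 1"
    using B by (metis det_I det_mul)
  then have "det B > 0"
    using A(1) by (metis zero_less_mult_pos zero_less_one)
  ultimately show ?thesis
    unfolding oriented_by_def by blast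
qed

lemma oriented_by_eq:
  assumes "c \<in> oriented_by b"
  shows "oriented_by c = oriented_by b"
  using assms oriented_by_sym oriented_by_trans by blast

section \<open>Lagrangian planes, their volume form and their phase\<close>

lemma LAG_omega: "P \<in> LAG s p q \<Longrightarrow> v \<in> plane P \<Longrightarrow> w \<in> plane P \<Longrightarrow> omega v w = 0"
  by (simp add: LAG_def)

text \<open>The signature supplies an orthonormal basis of the underlying plane, possibly with the
  wrong orientation; then one vector is replaced by its negative. The change of basis from
  \<open>b\<close> is invertible because du does not vanish on \<open>e\<close>.\<close>

lemma LAG_orthonormal_basis:
  fixes P :: "('n::finite \<Rightarrow> double ^ 'n) set"
  assumes "P \<in> LAG s p q"
  obtains e where "orthonormal e" "P = oriented_by e"
proof -
  obtain b where b: "frame b" "P = oriented_by b"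
    using assms by (auto simp: LAG_def oriented_plane_def)
  obtain e where e: "frame e" "span (range e) = plane P" "orthonormal e"
    using assms by (auto simp: LAG_def has_signature_def)
  have "omega (e i) (e j) = 0" for i j
    by (rule LAG_omega [OF assms]) (simp_all add: e(2) [symmetric] span_base)
  then have "\<bar>coord_det (null_coord 1) e * coord_det (null_coord (- 1)) e\<bar> = 1"
    by (rule coord_det_product [OF e(3)])
  then have nz: "coord_det (null_coord 1) e \<noteq> 0"
    by auto
  have "range e \<subseteq> span (range b)"
    using span_superset [of "range e"] e(2) plane_oriented_by(1) [of b] b(2) by simp
  then obtain A :: "real ^ 'n ^ 'n" where A: "e = (\<lambda>j. \<Sum>i\<in>UNIV. A $ i $ j *\<^sub>R b i)"
    by (rule span_range_expansion)
  have "det A \<noteq> 0"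
    using nz unfolding A by (subst (asm) coord_det_matrix) (auto simp: linear_null_coord)
  show thesis
  proof (cases "det A > 0")
    case True
    then have "e \<in> P"
      unfolding b(2) oriented_by_def A by blast
    then show thesis
      using that e(3) oriented_by_eq b(2) by metis
  next
    case False
    obtain k :: 'n where "True" by simp
    define e' where "e' = e(k := - e k)"
    \<comment> \<open>Column \<open>k\<close> changes sign along with the vector \<open>e k\<close>;
      the transposes turn this into a row operation.\<close>
    define A' :: "real ^ 'n ^ 'n" where "A' = transpose (\<chi> i. if i = k then (- 1) *s column i A else column i A)"
    have "det A' = - 1 * det (\<chi> i. if i = k then column i A else column i A)"
      unfolding A'_def det_transpose by (rule det_row_mul)
    also have "(\<chi> i. if i = k then column i A else column i A) = transpose A"
      by (simp add: vec_eq_iff transpose_def column_def)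
    finally have "det A' > 0"
      using False \<open>det A \<noteq> 0\<close> by (simp add: det_transpose)
    moreover have "e' j = (\<Sum>i\<in>UNIV. A' $ i $ j *\<^sub>R b i)" for j
      by (simp add: e'_def A'_def fun_cong [OF A] transpose_def column_def sum_negf)
    ultimately have "e' \<in> P"
      unfolding b(2) oriented_by_def by blast
    moreover have "orthonormal e'"
    proof -
      have "dinner (- v) w = - dinner v w" "dinner v (- w) = - dinner v w" for v w :: "double ^ 'n"
        by (simp_all add: dinner_def flip: sum_negf)
      then show ?thesis
        using e(3) by (auto simp: orthonormal_def e'_def)
    qed
    ultimately show thesis
      using that oriented_by_eq b(2) by metis
  qed
qed

text \<open>Existence and uniqueness behind the description \<open>dvol\<close>. The hypothesis on
  \<open>f\<close> says that the normalized form is 1 on every positive orthonormal basis, so it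
  qualifies after extension by 0 off the plane; any other candidate agrees with it by its value on
  \<open>e\<close>.\<close>

lemma dvol_unique:
  fixes e :: "'n::finite \<Rightarrow> double ^ 'n"
  assumes "orthonormal e" and L: "linear L" and "coord_det L e \<noteq> 0"
    and eq: "\<And>f. f \<in> oriented_by e \<Longrightarrow> orthonormal f \<Longrightarrow> coord_det L f = coord_det L e"
    and "range v \<subseteq> plane (oriented_by e)"
  shows "dvol (oriented_by e) v = coord_det L v / coord_det L e"
proof -
  let ?P = "oriented_by e" and ?S = "plane (oriented_by e)"
  have S: "?S = span (range e)" and e: "e \<in> ?P"
    by (rule plane_oriented_by)+
  have subS: "subspace ?S"
    by (simp add: S)
  let ?\<eta> = "\<lambda>v. if range v \<subseteq> ?S then coord_det L v / coord_det L e else 0"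
  have alt: "alternating_form ?S ?\<eta>"
  proof -
    have r: "range (v(i := x)) \<subseteq> ?S" if "range v \<subseteq> ?S" "x \<in> ?S" for v :: "'n \<Rightarrow> double ^ 'n" and i x
      using that by auto
    have c: "alternating_form ?S (coord_det L)"
      by (rule coord_det_alternating [OF L])
    show ?thesis
      unfolding alternating_form_def
    proof (intro conjI allI impI ballI)
      fix v :: "'n \<Rightarrow> double ^ 'n" and i x y and a :: real
      assume v: "range v \<subseteq> ?S" and x: "x \<in> ?S"
      have "coord_det L (v(i := a *\<^sub>R x)) = a * coord_det L (v(i := x))"
        by (rule alternating_formD(2) [OF c v x])
      then show "?\<eta> (v(i := a *\<^sub>R x)) = a * ?\<eta> (v(i := x))"
        using r [OF v x] r [OF v subspace_scale [OF subS x]] by auto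
      assume y: "y \<in> ?S"
      have "coord_det L (v(i := x + y)) = coord_det L (v(i := x)) + coord_det L (v(i := y))"
        by (rule alternating_formD(1) [OF c v x y])
      then show "?\<eta> (v(i := x + y)) = ?\<eta> (v(i := x)) + ?\<eta> (v(i := y))"
        using r [OF v x] r [OF v y] r [OF v subspace_add [OF subS x y]]
        by (auto simp: add_divide_distrib)
    next
      fix v :: "'n \<Rightarrow> double ^ 'n" and i j
      assume "range v \<subseteq> ?S" "i \<noteq> j" "v i = v j"
      then have "coord_det L v = 0"
        by (rule alternating_formD(3) [OF c])
      then show "?\<eta> v = 0"
        by simp
    qed
  qed
  have "dvol ?P = ?\<eta>"
    unfolding dvol_def
  proof (rule the_equality)
    from alt assms(3) eq range_subset_plane [of _ ?P] show "alternating_form ?S ?\<eta> \<and> (\<forall>e\<in>?P. orthonormal e \<longrightarrow> ?\<eta> e = 1)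
        \<and> (\<forall>v. \<not> range v \<subseteq> ?S \<longrightarrow> ?\<eta> v = 0)"
      by auto
  next
    fix \<eta>
    assume \<eta>: "alternating_form ?S \<eta> \<and> (\<forall>e\<in>?P. orthonormal e \<longrightarrow> \<eta> e = 1)
        \<and> (\<forall>v. \<not> range v \<subseteq> ?S \<longrightarrow> \<eta> v = 0)"
    show "\<eta> = ?\<eta>"
    proof
      fix v
      show "\<eta> v = ?\<eta> v"
      proof (cases "range v \<subseteq> ?S")
        case True
        then have "range v \<subseteq> span (range e)"
          using S by simp
        then obtain A :: "real ^ 'n ^ 'n" where A: "v = (\<lambda>j. \<Sum>i\<in>UNIV. A $ i $ j *\<^sub>R e i)"
          by (rule span_range_expansion)
        then have A': "v = (\<lambda>j. \<Sum>i\<in>UNIV. transpose A $ j $ i *\<^sub>R e i)"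
          by (simp add: transpose_def)
        have "range e \<subseteq> ?S"
          unfolding S by (rule span_superset)
        then have "\<eta> v = det (transpose A) * \<eta> e"
          unfolding A' using \<eta> by (intro alternating_form_matrix [OF _ subS]) auto
        moreover have "\<eta> e = 1"
          using \<eta> e assms(1) by blast
        ultimately have "\<eta> v = det A"
          by (simp add: det_transpose)
        moreover have "coord_det L v = det A * coord_det L e"
          unfolding A by (rule coord_det_matrix [OF L])
        ultimately show ?thesis
          using True assms(3) by simp
      qed (use \<eta> in auto)
    qed
  qed
  then show ?thesis
    using assms(5) by simp
qed

lemma exp_tau_null: "\<sigma> \<in> {1, - 1} \<Longrightarrow> xpart (exp_tau t) + \<sigma> * ypart (exp_tau t) = exp (\<sigma> * t)"
  by (auto simp: exp_tau_def cosh_def sinh_def field_simps)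

text \<open>The two homomorphisms \<tau> \<mapsto> 1 and \<tau> \<mapsto> -1 are applied to the
  equation that defines the phase: \<tau> to the power \<open>q\<close> becomes 1 or
  \<open>(- 1) ^ q\<close>, and the exponential becomes \<open>exp t\<close> or
  \<open>exp (- t)\<close>.\<close>

lemma LAG_phase:
  fixes P :: "('n::finite \<Rightarrow> double ^ 'n) set"
  assumes P: "P \<in> LAG s p q"
  shows "range v \<subseteq> plane P \<Longrightarrow> s * coord_det (null_coord 1) v = exp (phase s q P) * dvol P v"
    and "range v \<subseteq> plane P \<Longrightarrow> s * (- 1) ^ q * coord_det (null_coord (- 1)) v = exp (- phase s q P) * dvol P v"
    and "b \<in> P \<Longrightarrow> dvol P b > 0"
proof -
  obtain e where e: "orthonormal e" and Pe: "P = oriented_by e"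
    using LAG_orthonormal_basis [OF P] by blast
  have S: "plane P = span (range e)" and eP: "e \<in> P"
    unfolding Pe by (rule plane_oriented_by)+
  have om: "omega (e i) (e j) = 0" for i j
    by (rule LAG_omega [OF P]) (simp_all add: S span_base)
  let ?u = "coord_det (null_coord 1) :: ('n \<Rightarrow> double ^ 'n) \<Rightarrow> real"
  let ?v = "coord_det (null_coord (- 1)) :: ('n \<Rightarrow> double ^ 'n) \<Rightarrow> real"
  have 1: "\<bar>?u e * ?v e\<bar> = 1"
    by (rule coord_det_product [OF e om])
  then have nz: "?u e \<noteq> 0" "?v e \<noteq> 0"
    by auto
  \<comment> \<open>Under a change of basis \<open>?u * ?v\<close> is multiplied by the square of
    the determinant, but it has absolute value 1 on both orthonormal bases; a positive determinant
    is therefore 1.\<close>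
  have eq: "?u f = ?u e" if f: "f \<in> P" "orthonormal f" for f
  proof -
    obtain A :: "real ^ 'n ^ 'n" where A: "det A > 0" "f = (\<lambda>j. \<Sum>i\<in>UNIV. A $ i $ j *\<^sub>R e i)"
      using f(1) unfolding Pe by (rule oriented_byE)
    have "range f \<subseteq> plane P"
      by (rule range_subset_plane [OF f(1)])
    then have "omega (f i) (f j) = 0" for i j
      by (intro LAG_omega [OF P]) auto
    then have "\<bar>?u f * ?v f\<bar> = 1"
      by (rule coord_det_product [OF f(2)])
    moreover have uf: "?u f = det A * ?u e" and "?v f = det A * ?v e"
      unfolding A(2) by (rule coord_det_matrix [OF linear_null_coord])+
    ultimately have "\<bar>(det A)\<^sup>2\<bar> * \<bar>?u e * ?v e\<bar> = 1"
      by (simp add: abs_mult power2_eq_square ac_simps)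
    then have "(det A)\<^sup>2 = 1\<^sup>2"
      unfolding 1 by simp
    then have "det A = 1"
      using A(1) by (metis less_le one_power2 power2_eq_iff_nonneg zero_le_one)
    then show ?thesis
      using uf by simp
  qed
  have dvol: "dvol P v = ?u v / ?u e" if "range v \<subseteq> plane P" for v
    using that eq unfolding Pe by (intro dvol_unique e linear_null_coord nz(1)) auto
  note rng = range_subset_plane [of _ P]
  show "dvol P b > 0" if b: "b \<in> P" for b
  proof -
    obtain A :: "real ^ 'n ^ 'n" where A: "det A > 0" "b = (\<lambda>j. \<Sum>i\<in>UNIV. A $ i $ j *\<^sub>R e i)"
      using b unfolding Pe by (rule oriented_byE)
    have "?u b = det A * ?u e"
      unfolding A(2) by (rule coord_det_matrix [OF linear_null_coord])
    then show ?thesis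
      using dvol [OF rng [OF b]] A(1) nz(1) by simp
  qed
  have phase: "s * \<sigma> ^ q * coord_det (null_coord \<sigma>) v = exp (\<sigma> * t) * dvol P v"
    if "has_phase s q P t" "range v \<subseteq> plane P" "\<sigma> \<in> {1, - 1}" for t v \<sigma>
  proof -
    let ?h = "\<lambda>z. xpart z + \<sigma> * ypart z"
    have \<sigma>: "\<sigma> * \<sigma> = 1"
      using that(3) by auto
    \<comment> \<open>A product over a two-element index set is a binary product; a constant family
      gives the power below.\<close>
    then have mult: "?h (z * w) = ?h z * ?h w" for z w
      using null_coord_prod [of "{False, True}" \<sigma> "\<lambda>b. if b then z else w"] by (simp add: mult.commute)
    have pow: "?h (\<tau> ^ q) = \<sigma> ^ q"
      using null_coord_prod [of "{..<q}" \<sigma> "\<lambda>_. \<tau>"] \<sigma> by simp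
    have "of_real s * \<tau> ^ q * dz v = exp_tau t * of_real (dvol P v)"
      using that(1,2) unfolding has_phase_def by blast
    then have "?h (of_real s * \<tau> ^ q * dz v) = ?h (exp_tau t * of_real (dvol P v))"
      by simp
    then show ?thesis
      unfolding mult pow null_coord_dz [OF \<sigma>] exp_tau_null [OF that(3)] by simp
  qed
  obtain t where t: "has_phase s q P t"
    using P by (auto simp: LAG_def)
  \<comment> \<open>The volume form is 1 on \<open>e\<close>, so the first null coordinate recovers
    \<open>exp t\<close>, and hence \<open>t\<close>.\<close>
  have "t' = t" if "has_phase s q P t'" for t'
    using phase [OF that rng [OF eP], of 1] phase [OF t rng [OF eP], of 1]
      dvol [OF rng [OF eP]] nz(1) by simp
  with t have "phase s q P = t"
    unfolding phase_def by (intro the_equality)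
  with phase [OF t, of _ 1] phase [OF t, of _ "- 1"]
  show "range v \<subseteq> plane P \<Longrightarrow> s * ?u v = exp (phase s q P) * dvol P v"
    and "range v \<subseteq> plane P \<Longrightarrow> s * (- 1) ^ q * ?v v = exp (- phase s q P) * dvol P v"
    by simp_all
qed

section \<open>Parametrizations\<close>

abbreviation derivative (\<open>\<partial>\<close>)
  where "\<partial> f a \<equiv> frechet_derivative f (at a)"

lemma smooth_onD:
  assumes "smooth_on V f"
  shows "x \<in> V \<Longrightarrow> (f has_derivative \<partial> f x) (at x)"
    and "continuous_on V (\<lambda>x. \<partial> f x v)"
proof -
  have "Ck_on (Suc 0) V f"
    using assms unfolding smooth_on_def by blast
  then show "x \<in> V \<Longrightarrow> (f has_derivative \<partial> f x) (at x)" and "continuous_on V (\<lambda>x. \<partial> f x v)"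
    by (auto simp: frechet_derivative_works)
qed

text \<open>In finite dimension, continuity of all directional derivatives is continuity of the
  derivative as a bounded operator, which is what the inverse function theorem asks for.\<close>

lemma local_inverse:
  fixes f :: "'a::euclidean_space \<Rightarrow> 'a"
  assumes V: "open V" "a \<in> V"
    and der: "\<And>x. x \<in> V \<Longrightarrow> (f has_derivative f' x) (at x)"
    and cont: "\<And>v. continuous_on V (\<lambda>x. f' x v)"
    and inj: "inj (f' a)"
  obtains U W g where "open U" "a \<in> U" "U \<subseteq> V" "open W" "homeomorphism U W f g"
    "(g has_derivative inv (f' a)) (at (f a))"
proof -
  have bl: "bounded_linear (f' x)" if "x \<in> V" for x
    using der [OF that] by (rule has_derivative_bounded_linear)
  have lin: "linear (f' a)"
    using bl [OF V(2)] by (rule bounded_linear.linear)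
  have bij: "bij (f' a)"
    using inj linear_inj_imp_surj [OF lin inj] by (auto simp: bij_def)
  have "linear (inv (f' a))"
    using inj_linear_imp_inv_linear [OF lin inj] .
  then have bli: "bounded_linear (inv (f' a))"
    by (rule linear_conv_bounded_linear [THEN iffD1])
  define F where "F x = Blinfun (f' x)" for x
  have F: "blinfun_apply (F x) = f' x" if "x \<in> V" for x
    unfolding F_def by (rule bounded_linear_Blinfun_apply [OF bl [OF that]])
  have 1: "(f has_derivative blinfun_apply (F x)) (at x)" if "x \<in> V" for x
    using der F that by simp
  have 2: "continuous_on V F"
  proof (rule continuous_on_blinfun_componentwise)
    show "continuous_on V (\<lambda>x. blinfun_apply (F x) i)" for i
      using cont [of i] by (rule continuous_on_eq) (simp add: F)
  qed
  have 3: "Blinfun (inv (f' a)) o\<^sub>L F a = id_blinfun"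
    using bij by (intro blinfun_eqI) (simp add: F V bounded_linear_Blinfun_apply [OF bli] bij_def inv_f_f)
  obtain U W g g' where *: "open U" "U \<subseteq> V" "a \<in> U" "open W" "f a \<in> W" "homeomorphism U W f g"
      "\<And>y. y \<in> W \<Longrightarrow> (g has_derivative (g' y)) (at y)"
      "\<And>y. y \<in> W \<Longrightarrow> g' y = inv (blinfun_apply (F (g y)))"
    using inverse_function_theorem [OF V(1) 1 2 V(2) 3] by metis
  have "g (f a) = a"
    using *(3,6) by (simp add: homeomorphism_def)
  then have "(g has_derivative inv (f' a)) (at (f a))"
    using *(7,8) [OF *(5)] F [OF V(2)] by simp
  with * show thesis
    by (intro that)
qed

lemma half_space_iff [simp]: "y \<in> half_space \<longleftrightarrow> y $ first \<le> 0"
  by (simp add: half_space_def)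

text \<open>Even at a boundary point the half space contains short segments in n independent
  directions, and these determine a derivative.\<close>

lemma has_derivative_half_space_unique:
  fixes f :: "real ^ 'n::{finite,wellorder} \<Rightarrow> 'b::real_normed_vector"
  assumes "open V" "a \<in> V" "a \<in> half_space"
    and "(f has_derivative f') (at a within V \<inter> half_space)"
    and "(f has_derivative f'') (at a within V \<inter> half_space)"
  shows "f' = f''"
  using assms(4,5)
proof (rule frechet_derivative_unique_within)
  fix i :: "real ^ 'n::{finite,wellorder}" and e :: real
  assume i: "i \<in> Basis" and e: "0 < e"
  obtain r where r: "r > 0" "ball a r \<subseteq> V"
    using assms(1,2) open_contains_ball by blast
  \<comment> \<open>A negative step: no basis vector has a negative first coordinate, so moving
    against it never leaves the half space.\<close>
  define d where "d = - min (e / 2) (r / 2)"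
  have d: "d < 0" "\<bar>d\<bar> < e" "\<bar>d\<bar> < r"
    using e r(1) by (auto simp: d_def min_def)
  have "0 \<le> i $ first"
    using i by (auto simp: Basis_vec_def axis_def)
  then have "d * i $ first \<le> 0"
    using d(1) by (simp add: mult_le_0_iff)
  then have "a + d *\<^sub>R i \<in> half_space"
    using assms(3) by simp
  moreover have "a + d *\<^sub>R i \<in> ball a r"
    using d i by (simp add: dist_norm)
  ultimately show "\<exists>d. 0 < \<bar>d\<bar> \<and> \<bar>d\<bar> < e \<and> a + d *\<^sub>R i \<in> V \<inter> half_space"
    using d r(2) by (intro exI [of _ d]) auto
qed

lemma parametrizationD:
  assumes "parametrization M \<phi> V"
  shows "open V" "y \<in> V \<Longrightarrow> (\<phi> has_derivative \<partial> \<phi> y) (at y)"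
    "continuous_on V (\<lambda>x. \<partial> \<phi> x v)" "y \<in> V \<Longrightarrow> y $ first \<le> 0 \<Longrightarrow> inj (\<partial> \<phi> y)"
    "y \<in> V \<Longrightarrow> y $ first \<le> 0 \<Longrightarrow> \<phi> y \<in> M" "continuous_on V \<phi>" "inj_on \<phi> (V \<inter> half_space)"
proof -
  show "open V" and der: "\<And>y. y \<in> V \<Longrightarrow> (\<phi> has_derivative \<partial> \<phi> y) (at y)"
    and "continuous_on V (\<lambda>x. \<partial> \<phi> x v)"
    using assms smooth_onD unfolding parametrization_def by blast+
  show "y \<in> V \<Longrightarrow> y $ first \<le> 0 \<Longrightarrow> inj (\<partial> \<phi> y)"
    using assms unfolding parametrization_def by simp
  show "y \<in> V \<Longrightarrow> y $ first \<le> 0 \<Longrightarrow> \<phi> y \<in> M"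
    using assms openin_imp_subset unfolding parametrization_def by fastforce
  show "continuous_on V \<phi>"
    using der by (intro continuous_at_imp_continuous_on ballI has_derivative_continuous)
  show "inj_on \<phi> (V \<inter> half_space)"
    using assms unfolding parametrization_def homeomorphism_def by (metis inj_on_inverseI)
qed

text \<open>This is where embeddedness enters: no other sheet of \<open>M\<close> comes close to
  \<open>\<phi> a\<close>, since relatively open pieces of the domain have images that are open in
  \<open>M\<close>.\<close>

lemma parametrization_ball:
  assumes "parametrization M \<phi> V" "open U" "U \<subseteq> V" "a \<in> U" "a $ first \<le> 0"
  obtains r where "r > 0" "M \<inter> ball (\<phi> a) r \<subseteq> \<phi> ` (U \<inter> half_space)"
proof -
  obtain \<psi> where "homeomorphism (V \<inter> half_space) (\<phi> ` (V \<inter> half_space)) \<phi> \<psi>"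
    using assms(1) unfolding parametrization_def by blast
  moreover have "openin (top_of_set (V \<inter> half_space)) (U \<inter> half_space)"
    using assms(2,3) by (auto simp: openin_open)
  ultimately have "openin (top_of_set (\<phi> ` (V \<inter> half_space))) (\<phi> ` (U \<inter> half_space))"
    by (rule homeomorphism_imp_open_map)
  then have "openin (top_of_set M) (\<phi> ` (U \<inter> half_space))"
    using assms(1) openin_trans unfolding parametrization_def by blast
  moreover have "\<phi> a \<in> \<phi> ` (U \<inter> half_space)"
    using assms by simp
  ultimately obtain r where "r > 0" "ball (\<phi> a) r \<inter> M \<subseteq> \<phi> ` (U \<inter> half_space)"
    unfolding openin_contains_ball by blast
  then show thesis
    by (intro that [of r]) (auto simp: Int_commute)
qed

lemma coord_det_frame_nonzero:
  fixes b :: "'n::finite \<Rightarrow> real ^ 'n"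
  assumes F: "linear F" and b: "span (range b) = UNIV"
  shows "coord_det F b \<noteq> 0 \<longleftrightarrow> inj F"
proof -
  obtain A :: "real ^ 'n ^ 'n" where A: "(\<lambda>j. axis j 1) = (\<lambda>j. \<Sum>i\<in>UNIV. A $ i $ j *\<^sub>R b i)"
    using span_range_expansion [of "\<lambda>j. axis j 1" b] b by blast
  have "(\<chi> j. axis j 1) = (mat 1 :: real ^ 'n ^ 'n)"
    by (simp add: vec_eq_iff axis_def mat_def eq_commute)
  then have "coord_det id (\<lambda>j. axis j 1 :: real ^ 'n) = 1"
    by (simp add: coord_det_def)
  moreover have "coord_det id (\<lambda>j. axis j 1 :: real ^ 'n) = det A * coord_det id b"
    unfolding A by (rule coord_det_matrix) (simp add: linear_id)
  ultimately have "det A \<noteq> 0"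
    by auto
  moreover have "coord_det F (\<lambda>j. axis j 1) = det A * coord_det F b"
    unfolding A by (rule coord_det_matrix [OF F])
  moreover have "coord_det F (\<lambda>j. axis j 1) = det (matrix F)"
    unfolding coord_det_def matrix_def
    by (subst det_transpose [symmetric]) (simp add: transpose_def)
  ultimately show ?thesis
    using det_nz_iff_inj [OF F] by auto
qed

lemma span_frame:
  fixes b :: "'n::finite \<Rightarrow> real ^ 'n"
  assumes "frame b"
  shows "span (range b) = UNIV"
proof -
  have "dim (range b) = card (range b)"
    using assms by (simp add: frame_def dim_eq_card_independent)
  also have "\<dots> = DIM(real ^ 'n)"
    using assms by (simp add: frame_def card_image)
  finally show ?thesis
    by (simp only: dim_eq_full)
qed

text \<open>The common features of the two projections: the determinant in the \<open>L\<close>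
  coordinates has the fixed sign \<open>s\<close> on all positive tangent bases. So \<open>L\<close>
  restricts to a local diffeomorphism, up to the boundary.\<close>

locale oriented_immersion =
  fixes L :: "double ^ 'n::{finite,wellorder} \<Rightarrow> real ^ 'n::_" and s :: real
    and M :: "(double ^ 'n::_) set" and ori :: "double ^ 'n::_ \<Rightarrow> ('n \<Rightarrow> double ^ 'n::_) set"
  assumes L: "linear L" and orientation: "orientation M ori"
    and pos: "x \<in> M \<Longrightarrow> b \<in> ori x \<Longrightarrow> 0 < s * coord_det L b"
begin

lemma bl: "bounded_linear L"
  using L by (rule linear_conv_bounded_linear [THEN iffD1])

lemma has_derivative_L [derivative_intros]:
  "(f has_derivative f') F \<Longrightarrow> ((\<lambda>x. L (f x)) has_derivative (\<lambda>x. L (f' x))) F"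
  by (rule bounded_linear.has_derivative [OF bl])

lemma continuous_on_L [continuous_intros]:
  "continuous_on S f \<Longrightarrow> continuous_on S (\<lambda>x. L (f x))"
  by (rule bounded_linear.continuous_on [OF bl])

lemma tendsto_L: "(f \<longlongrightarrow> x) F \<Longrightarrow> ((\<lambda>x. L (f x)) \<longlongrightarrow> L x) F"
  by (rule bounded_linear.tendsto [OF bl])

text \<open>Injectivity on the tangent space is assumed here, as this lemma is first applied to the
  parametrization named by the orientation, where it is known; \<open>inj_tangent\<close> then
  transfers it to all others.\<close>

lemma chart_if_inj:
  assumes \<phi>: "parametrization M \<phi> V" and a: "a \<in> V" "a $ first \<le> 0"
    and inj: "inj (\<lambda>v. L (\<partial> \<phi> a v))"
  obtains U W g r where "open U" "a \<in> U" "U \<subseteq> V" "open W" "homeomorphism U W (\<lambda>y. L (\<phi> y)) g"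
    "(g has_derivative inv (\<lambda>v. L (\<partial> \<phi> a v))) (at (L (\<phi> a)))" "r > 0"
    "\<And>x. x \<in> M \<Longrightarrow> x \<in> ball (\<phi> a) r \<Longrightarrow> L x \<in> W \<and> g (L x) $ first \<le> 0 \<and> \<phi> (g (L x)) = x"
proof -
  note \<phi>D = parametrizationD [OF \<phi>]
  obtain U W g where U: "open U" "a \<in> U" "U \<subseteq> V" "open W" "homeomorphism U W (\<lambda>y. L (\<phi> y)) g"
    "(g has_derivative inv (\<lambda>v. L (\<partial> \<phi> a v))) (at (L (\<phi> a)))"
  proof (rule local_inverse [of V a "\<lambda>y. L (\<phi> y)" "\<lambda>y v. L (\<partial> \<phi> y v)"])
    show "((\<lambda>y. L (\<phi> y)) has_derivative (\<lambda>v. L (\<partial> \<phi> x v))) (at x)" if "x \<in> V" for x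
      by (intro has_derivative_L \<phi>D that)
    show "continuous_on V (\<lambda>x. L (\<partial> \<phi> x v))" for v
      by (intro continuous_on_L \<phi>D)
  qed (use \<phi>D(1) a inj in auto)
  obtain r where r: "r > 0" "M \<inter> ball (\<phi> a) r \<subseteq> \<phi> ` (U \<inter> half_space)"
    using parametrization_ball [OF \<phi> U(1,3,2) a(2)] .
  have "L x \<in> W \<and> g (L x) $ first \<le> 0 \<and> \<phi> (g (L x)) = x" if "x \<in> M" "x \<in> ball (\<phi> a) r" for x
  proof -
    obtain y where y: "y \<in> U" "y $ first \<le> 0" "x = \<phi> y"
      using r(2) \<open>x \<in> M\<close> \<open>x \<in> ball (\<phi> a) r\<close> by auto
    then have "g (L x) = y" "L x \<in> W"
      using U(5) by (auto simp: homeomorphism_def)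
    then show ?thesis
      using y by simp
  qed
  with U r(1) show thesis
    by (intro that) auto
qed

text \<open>
  The orientation refers to one parametrization at each point only.  On the half space any other
  one factors through it by the local inverse of \<open>L \<circ> \<phi>\<^sub>2\<close>, and derivatives on the half space are
  unique.
\<close>

lemma tangent_space:
  assumes \<phi>: "parametrization M \<phi> V" and a: "a \<in> V" "a $ first \<le> 0"
  shows inj_tangent: "inj (\<lambda>v. L (\<partial> \<phi> a v))" and range_tangent: "range (\<partial> \<phi> a) = plane (ori (\<phi> a))"
proof -
  note \<phi>D = parametrizationD [OF \<phi>]
  have xM: "\<phi> a \<in> M"
    using \<phi>D(5) a by simp
  obtain \<phi>2 V2 and b :: "'n \<Rightarrow> real ^ 'n::_" where
    \<phi>2: "parametrization M \<phi>2 V2" and x2: "\<phi> a \<in> \<phi>2 ` (V2 \<inter> half_space)" and b: "frame b"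
    and ori2: "\<And>y. y \<in> V2 \<inter> half_space \<Longrightarrow> ori (\<phi>2 y) = oriented_by (\<lambda>i. \<partial> \<phi>2 y (b i))"
    using orientation xM unfolding orientation_def by meson
  note \<phi>2D = parametrizationD [OF \<phi>2]
  obtain a2 where a2: "a2 \<in> V2" "a2 $ first \<le> 0" "\<phi>2 a2 = \<phi> a"
    using x2 by auto
  have lin2: "linear (\<partial> \<phi>2 a2)"
    using \<phi>2D(2) [OF a2(1)] by (rule has_derivative_linear)
  have ori: "ori (\<phi> a) = oriented_by (\<lambda>i. \<partial> \<phi>2 a2 (b i))"
    using ori2 [of a2] a2 by simp
  have "plane (ori (\<phi> a)) = span (range (\<lambda>i. \<partial> \<phi>2 a2 (b i)))"
    unfolding ori by (rule plane_oriented_by)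
  also have "\<dots> = \<partial> \<phi>2 a2 ` span (range b)"
    by (simp add: linear_span_image [OF lin2, symmetric] image_image)
  finally have plane: "plane (ori (\<phi> a)) = range (\<partial> \<phi>2 a2)"
    using span_frame [OF b] by simp
  have linF: "linear (\<lambda>v. L (\<partial> \<phi>2 a2 v))"
    using linear_compose [OF lin2 L] by (simp add: o_def)
  have "(\<lambda>i. \<partial> \<phi>2 a2 (b i)) \<in> ori (\<phi> a)"
    unfolding ori by (rule plane_oriented_by)
  then have "coord_det L (\<lambda>i. \<partial> \<phi>2 a2 (b i)) \<noteq> 0"
    using pos [OF xM] by force
  then have "coord_det (\<lambda>v. L (\<partial> \<phi>2 a2 v)) b \<noteq> 0"
    by (simp add: coord_det_def)
  then have inj2: "inj (\<lambda>v. L (\<partial> \<phi>2 a2 v))"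
    by (simp add: coord_det_frame_nonzero [OF linF span_frame [OF b]])
  obtain U W g r where U: "open U" "a2 \<in> U" "U \<subseteq> V2" "open W" "homeomorphism U W (\<lambda>y. L (\<phi>2 y)) g"
    "(g has_derivative inv (\<lambda>v. L (\<partial> \<phi>2 a2 v))) (at (L (\<phi>2 a2)))" "r > 0"
    "\<And>x. x \<in> M \<Longrightarrow> x \<in> ball (\<phi>2 a2) r \<Longrightarrow> L x \<in> W \<and> g (L x) $ first \<le> 0 \<and> \<phi>2 (g (L x)) = x"
    using chart_if_inj [OF \<phi>2 a2(1,2) inj2] by blast
  have ga: "g (L (\<phi> a)) = a2"
    using U(2,5) a2(3) by (auto simp: homeomorphism_def)
  define h where "h v = inv (\<lambda>v. L (\<partial> \<phi>2 a2 v)) (L (\<partial> \<phi> a v))" for v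
  have k: "((\<lambda>y. g (L (\<phi> y))) has_derivative h) (at a)"
    unfolding h_def
    by (rule has_derivative_compose [OF has_derivative_L [OF \<phi>D(2) [OF a(1)]]]) (use U(6) a2(3) in simp)
  have "((\<lambda>y. \<phi>2 (g (L (\<phi> y)))) has_derivative (\<lambda>v. \<partial> \<phi>2 a2 (h v))) (at a)"
    by (rule has_derivative_compose [OF k]) (use \<phi>2D(2) [OF a2(1)] ga in simp)
  then have "((\<lambda>y. \<phi>2 (g (L (\<phi> y)))) has_derivative (\<lambda>v. \<partial> \<phi>2 a2 (h v))) (at a within V \<inter> half_space)"
    by (rule has_derivative_at_withinI)
  moreover have "eventually (\<lambda>y. \<phi>2 (g (L (\<phi> y))) = \<phi> y) (at a within V \<inter> half_space)"
  proof -
    have "(\<phi> \<longlongrightarrow> \<phi> a) (at a within V \<inter> half_space)"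
      using has_derivative_continuous [OF \<phi>D(2) [OF a(1)]]
      by (meson continuous_at_imp_continuous_at_within continuous_within)
    then have "eventually (\<lambda>y. \<phi> y \<in> ball (\<phi> a) r) (at a within V \<inter> half_space)"
      by (rule topological_tendstoD) (use U(7) in auto)
    moreover have "eventually (\<lambda>y. y \<in> V \<inter> half_space) (at a within V \<inter> half_space)"
      by (simp add: eventually_at_filter)
    ultimately show ?thesis
    proof eventually_elim
      case (elim y)
      then show ?case
        using U(8) [of "\<phi> y"] \<phi>D(5) [of y] a2(3) by simp
    qed
  qed
  ultimately have "(\<phi> has_derivative (\<lambda>v. \<partial> \<phi>2 a2 (h v))) (at a within V \<inter> half_space)"
    by (rule has_derivative_transform_eventually) (use U(8) [of "\<phi> a"] U(7) xM a2(3) a in auto)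
  moreover have "(\<phi> has_derivative \<partial> \<phi> a) (at a within V \<inter> half_space)"
    using \<phi>D(2) [OF a(1)] by (rule has_derivative_at_withinI)
  ultimately have eq: "\<partial> \<phi> a = (\<lambda>v. \<partial> \<phi>2 a2 (h v))"
    using a by (intro has_derivative_half_space_unique [OF \<phi>D(1) a(1)]) auto
  have "inj (\<partial> \<phi> a)"
    using \<phi>D(4) a by simp
  then have injh: "inj h"
    unfolding eq by (auto simp: inj_on_def)
  then show "inj (\<lambda>v. L (\<partial> \<phi> a v))"
    unfolding eq using inj_compose [OF inj2 injh] by (simp only: o_def)
  have "surj h"
    using linear_inj_imp_surj [OF has_derivative_linear [OF k] injh] .
  then show "range (\<partial> \<phi> a) = plane (ori (\<phi> a))"
    unfolding eq plane by (metis image_image)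
qed

end

section \<open>Local inverses of the projection\<close>

context oriented_immersion
begin

lemma bij_tangent:
  assumes "parametrization M \<phi> V" "a \<in> V" "a $ first \<le> 0"
  shows "linear (\<lambda>v. L (\<partial> \<phi> a v))" "bij (\<lambda>v. L (\<partial> \<phi> a v))"
proof -
  show lin: "linear (\<lambda>v. L (\<partial> \<phi> a v))"
    using has_derivative_L [OF parametrizationD(2) [OF assms(1,2)]] by (rule has_derivative_linear)
  show "bij (\<lambda>v. L (\<partial> \<phi> a v))"
    using inj_tangent [OF assms] linear_inj_imp_surj [OF lin inj_tangent [OF assms]] by (simp add: bij_def)
qed

text \<open>Only the germ of a local inverse \<open>g\<close> of \<open>L \<circ> \<phi>\<close> matters, so its domain is left open.\<close>

definition local_chart ::
    "(real ^ 'n::_ \<Rightarrow> double ^ 'n::_) \<Rightarrow> (real ^ 'n::_) set \<Rightarrow> real ^ 'n::_ \<Rightarrow> (real ^ 'n::_ \<Rightarrow> real ^ 'n::_) \<Rightarrow> bool"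
  where "local_chart \<phi> V a g \<longleftrightarrow> g (L (\<phi> a)) = a \<and>
    (g has_derivative inv (\<lambda>v. L (\<partial> \<phi> a v))) (at (L (\<phi> a))) \<and>
    (\<exists>W. open W \<and> L (\<phi> a) \<in> W \<and> continuous_on W g) \<and>
    (\<forall>\<^sub>F z in nhds (L (\<phi> a)). g z \<in> V \<and> L (\<phi> (g z)) = z) \<and>
    (\<forall>\<^sub>F y in nhds a. g (L (\<phi> y)) = y) \<and>
    (\<forall>\<^sub>F x in nhds (\<phi> a). x \<in> M \<longrightarrow> g (L x) $ first \<le> 0 \<and> \<phi> (g (L x)) = x)"

lemma local_chart_exists:
  assumes \<phi>: "parametrization M \<phi> V" and a: "a \<in> V" "a $ first \<le> 0"
  obtains g where "local_chart \<phi> V a g"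
proof -
  obtain U W g r where U: "open U" "a \<in> U" "U \<subseteq> V" "open W" "homeomorphism U W (\<lambda>y. L (\<phi> y)) g"
    "(g has_derivative inv (\<lambda>v. L (\<partial> \<phi> a v))) (at (L (\<phi> a)))" "r > 0"
    "\<And>x. x \<in> M \<Longrightarrow> x \<in> ball (\<phi> a) r \<Longrightarrow> L x \<in> W \<and> g (L x) $ first \<le> 0 \<and> \<phi> (g (L x)) = x"
    using chart_if_inj [OF \<phi> a inj_tangent [OF \<phi> a]] by blast
  have W: "L (\<phi> a) \<in> W"
    using U(2,5) by (auto simp: homeomorphism_def)
  have "\<forall>\<^sub>F z in nhds (L (\<phi> a)). z \<in> W"
    using U(4) W by (rule eventually_nhds_in_open)
  then have 3: "\<forall>\<^sub>F z in nhds (L (\<phi> a)). g z \<in> V \<and> L (\<phi> (g z)) = z"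
    by eventually_elim (use U(3,5) in \<open>auto simp: homeomorphism_def\<close>)
  have "\<forall>\<^sub>F y in nhds a. y \<in> U"
    using U(1,2) by (rule eventually_nhds_in_open)
  then have 4: "\<forall>\<^sub>F y in nhds a. g (L (\<phi> y)) = y"
    by eventually_elim (use U(5) in \<open>auto simp: homeomorphism_def\<close>)
  have "\<forall>\<^sub>F x in nhds (\<phi> a). x \<in> ball (\<phi> a) r"
    using U(7) by (intro eventually_nhds_in_open) auto
  then have 5: "\<forall>\<^sub>F x in nhds (\<phi> a). x \<in> M \<longrightarrow> g (L x) $ first \<le> 0 \<and> \<phi> (g (L x)) = x"
    by eventually_elim (use U(8) in blast)
  have "continuous_on W g"
    using U(5) by (simp add: homeomorphism_def)
  with U(4,6) W 3 4 5 eventually_nhds_x_imp_x [OF 4] show thesis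
    by (intro that [of g]) (auto simp: local_chart_def)
qed

lemma local_chartD:
  assumes "local_chart \<phi> V a g"
  shows "g (L (\<phi> a)) = a"
    "(g has_derivative inv (\<lambda>v. L (\<partial> \<phi> a v))) (at (L (\<phi> a)))"
    "\<forall>\<^sub>F z in nhds (L (\<phi> a)). g z \<in> V \<and> L (\<phi> (g z)) = z"
    "\<forall>\<^sub>F y in nhds a. g (L (\<phi> y)) = y"
    "\<forall>\<^sub>F x in nhds (\<phi> a). x \<in> M \<longrightarrow> g (L x) $ first \<le> 0 \<and> \<phi> (g (L x)) = x"
    "(g \<longlongrightarrow> a) (nhds (L (\<phi> a)))"
proof -
  show *: "g (L (\<phi> a)) = a" "(g has_derivative inv (\<lambda>v. L (\<partial> \<phi> a v))) (at (L (\<phi> a)))"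
    "\<forall>\<^sub>F z in nhds (L (\<phi> a)). g z \<in> V \<and> L (\<phi> (g z)) = z"
    "\<forall>\<^sub>F y in nhds a. g (L (\<phi> y)) = y"
    "\<forall>\<^sub>F x in nhds (\<phi> a). x \<in> M \<longrightarrow> g (L x) $ first \<le> 0 \<and> \<phi> (g (L x)) = x"
    using assms by (simp_all add: local_chart_def)
  show "(g \<longlongrightarrow> a) (nhds (L (\<phi> a)))"
    using has_derivative_continuous [OF *(2)] by (simp add: continuous_at *(1) tendsto_nhds_iff)
qed

lemma parametrization_tendsto:
  assumes "parametrization M \<phi> V" and "a \<in> V"
  shows "(\<phi> \<longlongrightarrow> \<phi> a) (nhds a)" "((\<lambda>y. L (\<phi> y)) \<longlongrightarrow> L (\<phi> a)) (nhds a)"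
proof -
  show 1: "(\<phi> \<longlongrightarrow> \<phi> a) (nhds a)"
    using has_derivative_continuous [OF parametrizationD(2) [OF assms]]
    by (simp add: continuous_at tendsto_nhds_iff)
  then show "((\<lambda>y. L (\<phi> y)) \<longlongrightarrow> L (\<phi> a)) (nhds a)"
    by (rule tendsto_L)
qed

lemma parametrization_chart_tendsto:
  assumes "parametrization M \<phi> V" "a \<in> V" "local_chart \<phi> V a g"
  shows "((\<lambda>z. \<phi> (g z)) \<longlongrightarrow> \<phi> a) (nhds (L (\<phi> a)))"
  by (rule filterlim_compose [OF parametrization_tendsto(1) [OF assms(1,2)] local_chartD(6) [OF assms(3)]])

text \<open>Near \<open>L (\<phi> a)\<close> the image of \<open>M\<close> is a curved half space.
  Only the neighbourhood of \<open>z\<close> depends on \<open>r\<close>, while \<open>r0\<close>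
  works for all smaller radii, which later permits a common radius for a whole fibre.\<close>

lemma chart_image:
  assumes \<phi>: "parametrization M \<phi> V" "a \<in> V" "local_chart \<phi> V a g"
  obtains r0 where "r0 > 0" "inj_on L (M \<inter> ball (\<phi> a) r0)"
    "\<And>r. 0 < r \<Longrightarrow> r \<le> r0 \<Longrightarrow>
      \<forall>\<^sub>F z in nhds (L (\<phi> a)). (\<exists>x\<in>M \<inter> ball (\<phi> a) r. L x = z) \<longleftrightarrow> g z $ first \<le> 0"
proof -
  obtain r0 where r0: "r0 > 0" "\<And>x. dist x (\<phi> a) < r0 \<Longrightarrow> x \<in> M \<Longrightarrow> g (L x) $ first \<le> 0 \<and> \<phi> (g (L x)) = x"
    using local_chartD(5) [OF \<phi>(3)] unfolding eventually_nhds_metric by blast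
  have "inj_on L (M \<inter> ball (\<phi> a) r0)"
    using r0(2) by (intro inj_on_inverseI [of _ "\<lambda>z. \<phi> (g z)"]) (auto simp: dist_commute)
  moreover have "\<forall>\<^sub>F z in nhds (L (\<phi> a)). (\<exists>x\<in>M \<inter> ball (\<phi> a) r. L x = z) \<longleftrightarrow> g z $ first \<le> 0"
    if r: "0 < r" "r \<le> r0" for r
  proof -
    have "\<forall>\<^sub>F z in nhds (L (\<phi> a)). \<phi> (g z) \<in> ball (\<phi> a) r"
      using parametrization_chart_tendsto [OF \<phi>] r(1) by (intro topological_tendstoD) auto
    with local_chartD(3) [OF \<phi>(3)] show ?thesis
    proof eventually_elim
      case (elim z)
      show ?case
      proof
        assume "\<exists>x\<in>M \<inter> ball (\<phi> a) r. L x = z"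
        then show "g z $ first \<le> 0"
          using r0(2) r(2) by (auto simp: dist_commute)
      next
        assume "g z $ first \<le> 0"
        then have "\<phi> (g z) \<in> M"
          using parametrizationD(5) [OF \<phi>(1)] elim by blast
        then show "\<exists>x\<in>M \<inter> ball (\<phi> a) r. L x = z"
          using elim by blast
      qed
    qed
  qed
  ultimately show thesis
    using that r0(1) by blast
qed

lemma first_direction:
  "((\<lambda>t. a + t *\<^sub>R axis first 1) \<longlongrightarrow> a) (at (0::real))" for a :: "real ^ 'n::_"
  by (rule tendsto_eq_intros refl | simp)+

text \<open>
  Were \<open>a\<close> interior, the image of \<open>M\<close> under \<open>L\<close> would be a neighbourhood of \<open>L (\<phi> a)\<close>, whereas a
  parametrization at a boundary point only fills a half space.
\<close>

lemma boundary_first_eq_0: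
  assumes \<phi>: "parametrization M \<phi> V" "a \<in> V" "a $ first \<le> 0" "\<phi> a \<in> boundary M"
  shows "a $ first = 0"
proof (rule ccontr)
  assume "a $ first \<noteq> 0"
  with \<phi>(3) have neg: "a $ first < 0"
    by simp
  obtain \<phi>2 V2 a2 where \<phi>2: "parametrization M \<phi>2 V2" "a2 \<in> V2" "a2 $ first = 0" "\<phi>2 a2 = \<phi> a"
    using \<phi>(4) unfolding boundary_def by auto
  obtain g where g: "local_chart \<phi> V a g"
    using local_chart_exists [OF \<phi>(1-3)] .
  obtain g2 where g2: "local_chart \<phi>2 V2 a2 g2"
    using local_chart_exists [OF \<phi>2(1,2)] \<phi>2(3) by auto
  have "((\<lambda>z. g z $ first) \<longlongrightarrow> a $ first) (nhds (L (\<phi> a)))"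
    by (intro tendsto_intros local_chartD(6) [OF g])
  then have 1: "\<forall>\<^sub>F z in nhds (L (\<phi> a)). g z $ first < 0"
    using neg by (rule order_tendstoD)
  have 2: "\<forall>\<^sub>F z in nhds (L (\<phi> a)). \<phi> (g z) \<in> M \<longrightarrow> g2 (L (\<phi> (g z))) $ first \<le> 0"
    using eventually_compose_filterlim [OF local_chartD(5) [OF g2, unfolded \<phi>2(4)]
        parametrization_chart_tendsto [OF \<phi>(1,2) g]]
    by eventually_elim blast
  have "\<forall>\<^sub>F z in nhds (L (\<phi> a)). g2 z $ first \<le> 0"
    using 1 2 local_chartD(3) [OF g]
    by eventually_elim (use parametrizationD(5) [OF \<phi>(1)] in fastforce)
  then have "\<forall>\<^sub>F y in nhds a2. g2 (L (\<phi>2 y)) $ first \<le> 0"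
    using parametrization_tendsto(2) [OF \<phi>2(1,2)] unfolding \<phi>2(4)
    by (rule eventually_compose_filterlim)
  with local_chartD(4) [OF g2] have "\<forall>\<^sub>F y in nhds a2. y $ first \<le> 0"
    by eventually_elim simp
  then have "\<forall>\<^sub>F t in at (0::real). (a2 + t *\<^sub>R axis first 1) $ first \<le> 0"
    using first_direction by (rule eventually_compose_filterlim)
  then have "\<forall>\<^sub>F t in at_right (0::real). t \<le> 0"
    by (simp add: \<phi>2(3) eventually_at_split)
  moreover have "\<forall>\<^sub>F t in at_right (0::real). t > 0"
    by (rule eventually_at_right_less)
  ultimately have "\<forall>\<^sub>F t in at_right (0::real). False"
    by eventually_elim simp
  then show False
    by simp
qed

text \<open>Among tangent tuples, being a positive basis becomes the sign of a single
  determinant.\<close>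

lemma pos_iff_mem_orientation:
  assumes x: "x \<in> M" and c: "range c \<subseteq> plane (ori x)"
  shows "c \<in> ori x \<longleftrightarrow> 0 < s * coord_det L c"
proof
  assume "0 < s * coord_det L c"
  obtain \<phi> V and b :: "'n \<Rightarrow> real ^ 'n::_" where
    \<phi>: "x \<in> \<phi> ` (V \<inter> half_space)"
    "\<And>y. y \<in> V \<inter> half_space \<Longrightarrow> ori (\<phi> y) = oriented_by (\<lambda>i. \<partial> \<phi> y (b i))"
    using orientation x unfolding orientation_def by meson
  then obtain b where b: "ori x = oriented_by b"
    by auto
  obtain A :: "(real ^ 'n::_) ^ 'n::_" where A: "c = (\<lambda>j. \<Sum>i\<in>UNIV. A $ i $ j *\<^sub>R b i)"
    using span_range_expansion [of c b] c unfolding b plane_oriented_by by blast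
  have "0 < s * coord_det L b"
    using pos [OF x] b plane_oriented_by(2) by blast
  moreover have "s * coord_det L c = det A * (s * coord_det L b)"
    unfolding A coord_det_matrix [OF L] by simp
  ultimately have "det A > 0"
    using \<open>0 < s * coord_det L c\<close> zero_less_mult_pos2 by metis
  then show "c \<in> ori x"
    unfolding b oriented_by_def A by blast
qed (rule pos [OF x])

text \<open>In the coordinates of \<open>\<phi>\<close> all vectors but one lie in the boundary
  hyperplane, so only the first coordinate of the remaining one contributes. Only the images under
  \<open>L\<close> are prescribed, since \<open>v\<close> may be tangent to a different
  submanifold.\<close>

lemma coord_det_update_first:
  assumes \<phi>: "parametrization M \<phi> V" "a \<in> V"
    and w: "\<And>i. i \<noteq> first \<Longrightarrow> L (w i) = L (\<partial> \<phi> a (c i)) \<and> c i $ first = 0"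
    and v: "L v = L (\<partial> \<phi> a u)"
  shows "coord_det L (w(first := v)) = u $ first * coord_det L (w(first := \<partial> \<phi> a (axis first 1)))"
proof -
  let ?F = "\<lambda>v. L (\<partial> \<phi> a v)"
  have lin: "linear ?F"
    using has_derivative_L [OF parametrizationD(2) [OF assms(1,2)]] by (rule has_derivative_linear)
  have F: "coord_det L (w(first := v')) = det (\<chi> j. if j = first then u' else c j) * det (matrix ?F)"
    if "L v' = ?F u'" for u' v'
  proof -
    have "(\<chi> j. L ((w(first := v')) j)) = (\<chi> j. if j = first then u' else c j) ** transpose (matrix ?F)"
    proof -
      have "matrix ?F *v y = ?F y" for y
        using matrix_vector_mul(2) [OF lin] by metis
      then have *: "?F y $ i = (\<Sum>k\<in>UNIV. y $ k * matrix ?F $ i $ k)" for y i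
      proof -
        have "?F y $ i = (matrix ?F *v y) $ i"
          by (simp only: \<open>\<And>y. matrix ?F *v y = ?F y\<close>)
        also have "\<dots> = (\<Sum>k\<in>UNIV. y $ k * matrix ?F $ i $ k)"
          by (simp only: matrix_vector_mult_def vec_lambda_beta mult.commute)
        finally show ?thesis .
      qed
      show ?thesis
        using w that by (auto simp: vec_eq_iff matrix_matrix_mult_def transpose_def *)
    qed
    then show ?thesis
      by (simp add: coord_det_def det_mul det_transpose)
  qed
  have "u $ first *s axis first 1 + (u - u $ first *s axis first 1) = u"
    by (simp add: algebra_simps)
  then have "det (\<chi> j. if j = first then u else c j)
      = u $ first * det (\<chi> j. if j = first then axis first 1 else c j)
      + det (\<chi> j. if j = first then u - u $ first *s axis first 1 else c j)"
    using det_row_add [of first "\<lambda>_. u $ first *s axis first 1" "\<lambda>_. u - u $ first *s axis first 1" c]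
      det_row_mul [of first "u $ first" "\<lambda>_. axis first 1" c] by (simp only:)
  \<comment> \<open>After removal of the normal part of \<open>u\<close>, every row has first
    coordinate 0.\<close>
  moreover have "det (\<chi> j. if j = first then u - u $ first *s axis first 1 else c j) = 0"
    by (rule det_zero_column(2) [of first]) (use w in \<open>auto simp: column_def vec_eq_iff\<close>)
  ultimately show ?thesis
    using F [OF v] F [OF refl, of "axis first 1"] by simp
qed

end

section \<open>Two submanifolds with the same boundary\<close>

text \<open>Made for functions that are known to agree on a hyperplane only: agreement along one
  line already determines the derivative in that direction.\<close>

lemma has_derivative_directional_unique:
  fixes F :: "'a::real_normed_vector \<Rightarrow> 'b::real_normed_vector"
  assumes F: "(F has_derivative F') (at a)" and G: "(G has_derivative G') (at a)"
    and eq: "\<forall>\<^sub>F t in nhds (0::real). F (a + t *\<^sub>R v) = G (a + t *\<^sub>R v)"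
  shows "F' v = G' v"
proof -
  have line: "((\<lambda>t. a + t *\<^sub>R v) has_derivative (\<lambda>t. t *\<^sub>R v)) (at (0::real))"
    by (auto intro!: derivative_eq_intros)
  have 1: "((\<lambda>t. F (a + t *\<^sub>R v)) has_derivative (\<lambda>t. F' (t *\<^sub>R v))) (at 0)"
    by (rule has_derivative_compose [OF line]) (use F in simp)
  have "((\<lambda>t. G (a + t *\<^sub>R v)) has_derivative (\<lambda>t. G' (t *\<^sub>R v))) (at 0)"
    by (rule has_derivative_compose [OF line]) (use G in simp)
  then have "((\<lambda>t. F (a + t *\<^sub>R v)) has_derivative (\<lambda>t. G' (t *\<^sub>R v))) (at 0)"
  proof (rule has_derivative_transform_eventually)
    show "\<forall>\<^sub>F t in at 0. G (a + t *\<^sub>R v) = F (a + t *\<^sub>R v)"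
      using eq by (auto simp: eventually_at_filter elim: eventually_mono)
  qed (use eventually_nhds_x_imp_x [OF eq] in auto)
  from has_derivative_unique [OF 1 this] have "F' (1 *\<^sub>R v) = G' (1 *\<^sub>R v)"
    by metis
  then show ?thesis
    by simp
qed

text \<open>On each side of the hyperplane \<open>q\<close> has no zero, hence a constant sign by
  connectedness; the normal derivative at \<open>a\<close> tells which sign belongs to which
  side.\<close>

lemma half_space_side:
  fixes q :: "real ^ 'n::{finite,wellorder} \<Rightarrow> real"
  assumes cont: "continuous_on (ball a e) q"
    and zero: "\<And>y. y \<in> ball a e \<Longrightarrow> q y = 0 \<longleftrightarrow> y $ first = 0"
    and der: "(q has_derivative q') (at a)" and pos: "0 < q' (axis first 1)"
    and a: "a $ first = 0" and y: "y \<in> ball a e"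
  shows "q y \<le> 0 \<longleftrightarrow> y $ first \<le> 0"
proof -
  have e: "0 < e"
    using y by (metis ball_eq_empty empty_iff not_le)
  then have qa: "q a = 0"
    using zero [of a] a by simp
  have line: "((\<lambda>t. a + t *\<^sub>R axis first 1) has_derivative (\<lambda>t. t *\<^sub>R axis first 1)) (at (0::real))"
    by (auto intro!: derivative_eq_intros)
  have "((\<lambda>t. q (a + t *\<^sub>R axis first 1)) has_derivative (\<lambda>t. q' (t *\<^sub>R axis first 1))) (at 0)"
    by (rule has_derivative_compose [OF line]) (use der in simp)
  moreover have "q' (t *\<^sub>R axis first 1) = q' (axis first 1) * t" for t
    using linear_scale [OF has_derivative_linear [OF der]] by simp
  ultimately have D: "DERIV (\<lambda>t. q (a + t *\<^sub>R axis first 1)) 0 :> q' (axis first 1)"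
    by (simp add: has_field_derivative_def)
  obtain d1 where d1: "d1 > 0" "\<And>h. 0 < h \<Longrightarrow> h < d1 \<Longrightarrow> q (a + h *\<^sub>R axis first 1) > 0"
    using DERIV_pos_inc_right [OF D pos] qa by auto
  obtain d2 where d2: "d2 > 0" "\<And>h. 0 < h \<Longrightarrow> h < d2 \<Longrightarrow> q (a - h *\<^sub>R axis first 1) < 0"
    using DERIV_pos_inc_left [OF D pos] qa by auto
  define h where "h = min (e / 2) (min (d1 / 2) (d2 / 2))"
  have h: "0 < h" "h < e" "h < d1" "h < d2"
    using e d1(1) d2(1) by (auto simp: h_def min_def)
  \<comment> \<open>The first coordinate on the segment is a convex combination of two numbers of
    the same strict sign, so the segment avoids the zeros of \<open>q\<close>.\<close>
  have same: "0 \<notin> q ` closed_segment p y" if p: "p \<in> ball a e" "p $ first * y $ first > 0" for p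
  proof
    assume "0 \<in> q ` closed_segment p y"
    then obtain z where z: "z \<in> closed_segment p y" "q z = 0"
      by auto
    then have "z \<in> ball a e"
      using closed_segment_subset [OF p(1) y] by auto
    then have "z $ first = 0"
      using zero z(2) by simp
    moreover obtain u where u: "0 \<le> u" "u \<le> 1" "z = (1 - u) *\<^sub>R p + u *\<^sub>R y"
      using z(1) by (auto simp: in_segment)
    ultimately have *: "(1 - u) * p $ first + u * y $ first = 0"
      by simp
    show False
    proof (cases "p $ first > 0")
      case True
      then have "y $ first > 0"
        using p(2) by (simp add: zero_less_mult_iff)
      with True * u show False
        by (smt (verit) mult_nonneg_nonneg mult_pos_pos)
    next
      case False
      then have "p $ first < 0" "y $ first < 0"
        using p(2) by (auto simp: zero_less_mult_iff)
      with * u show False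
        by (smt (verit) mult_nonneg_nonpos mult_pos_neg)
    qed
  qed
  have conn: "connected (q ` closed_segment p y)" if "p \<in> ball a e" for p
    using cont closed_segment_subset [OF that y]
    by (intro connected_continuous_image) (auto intro: continuous_on_subset)
  consider "y $ first = 0" | "y $ first < 0" | "y $ first > 0"
    by linarith
  then show ?thesis
  proof cases
    case 1
    then show ?thesis
      using zero [OF y] by simp
  next
    case 2
    let ?p = "a - h *\<^sub>R axis first 1 :: real ^ 'n::_"
    have p: "?p \<in> ball a e" "?p $ first * y $ first > 0"
      using h a 2 by (simp_all add: dist_norm mult_pos_neg)
    have "q ?p < 0"
      using d2(2) h by simp
    then have "\<not> 0 < q y"
      using same [OF p] connectedD_interval [OF conn [OF p(1)], of "q ?p" "q y" 0] by auto
    then show ?thesis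
      using 2 by simp
  next
    case 3
    let ?p = "a + h *\<^sub>R axis first 1 :: real ^ 'n::_"
    have p: "?p \<in> ball a e" "?p $ first * y $ first > 0"
      using h a 3 by (simp_all add: dist_norm)
    have "q ?p > 0"
      using d1(2) h by simp
    then have "\<not> q y < 0"
      using same [OF p] connectedD_interval [OF conn [OF p(1)], of "q y" "q ?p" 0] by auto
    then show ?thesis
      using 3 zero [OF y] by auto
  qed
qed

text \<open>Two parametrizations at a common boundary point. Only the boundary sets are assumed
  equal; their orientations come in later as a separate hypothesis. The case of two parametrizations
  of the same submanifold is used as well.\<close>

locale chart_pair =
  M: oriented_immersion L s M oM + N: oriented_immersion L s N oN
  for L :: "double ^ 'n::{finite,wellorder} \<Rightarrow> real ^ 'n::_" and s M oM N oN +
  fixes \<phi> V a g \<psi> V' b g'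
  assumes boundary: "boundary M = boundary N"
    and \<phi>: "parametrization M \<phi> V" "a \<in> V" "a $ first = 0" "M.local_chart \<phi> V a g"
    and \<psi>: "parametrization N \<psi> V'" "b \<in> V'" "b $ first = 0" "N.local_chart \<psi> V' b g'"
    and eq: "\<phi> a = \<psi> b"
begin

text \<open>Off the boundary, \<open>\<phi> y\<close> has no reason to lie in \<open>N\<close>;
  passing through \<open>L\<close> still produces coordinates on the side of
  \<open>N\<close>.\<close>

definition transition where "transition y = g' (L (\<phi> y))"

definition tangent_map where "tangent_map v = inv (\<lambda>v. L (\<partial> \<psi> b v)) (L (\<partial> \<phi> a v))"

lemma swap: "chart_pair L s N oN M oM \<psi> V' b g' \<phi> V a g"
  by unfold_locales (use boundary \<phi> \<psi> eq in auto)

lemma transition_at: "transition a = b"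
  using N.local_chartD(1) [OF \<psi>(4)] by (simp add: transition_def eq)

lemma transition_derivative: "(transition has_derivative tangent_map) (at a)"
  unfolding transition_def tangent_map_def
  by (rule has_derivative_compose [OF M.has_derivative_L [OF parametrizationD(2) [OF \<phi>(1,2)]]])
    (use N.local_chartD(2) [OF \<psi>(4)] in \<open>simp add: eq\<close>)

lemma transition_tendsto: "(transition \<longlongrightarrow> b) (nhds a)"
  using has_derivative_continuous [OF transition_derivative]
  by (simp add: continuous_at tendsto_nhds_iff transition_at)

lemma bij_tangents: "bij (\<lambda>v. L (\<partial> \<phi> a v))" "bij (\<lambda>v. L (\<partial> \<psi> b v))"
  using M.bij_tangent [OF \<phi>(1,2)] N.bij_tangent [OF \<psi>(1,2)] \<phi>(3) \<psi>(3) by simp_all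

lemma L_tangent_map: "L (\<partial> \<psi> b (tangent_map v)) = L (\<partial> \<phi> a v)"
  unfolding tangent_map_def using bij_tangents(2) by (metis (mono_tags) bij_inv_eq_iff)

text \<open>Points on the hyperplane are sent by \<open>\<phi>\<close> to the common boundary, hence
  into \<open>N\<close>, where the local inverse is genuine; boundary points of \<open>N\<close>
  have first coordinate 0 in every parametrization.\<close>

lemma transition_boundary: "\<forall>\<^sub>F y in nhds a. y $ first = 0 \<longrightarrow> transition y $ first = 0 \<and> \<psi> (transition y) = \<phi> y"
proof -
  have "\<forall>\<^sub>F y in nhds a. y \<in> V"
    using parametrizationD(1) [OF \<phi>(1)] \<phi>(2) by (rule eventually_nhds_in_open)
  moreover have "\<forall>\<^sub>F y in nhds a. transition y \<in> V'"
    using transition_tendsto by (rule topological_tendstoD) (use parametrizationD(1) [OF \<psi>(1)] \<psi>(2) in auto)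
  moreover have "\<forall>\<^sub>F y in nhds a. \<phi> y \<in> N \<longrightarrow> g' (L (\<phi> y)) $ first \<le> 0 \<and> \<psi> (g' (L (\<phi> y))) = \<phi> y"
    by (rule eventually_compose_filterlim [OF N.local_chartD(5) [OF \<psi>(4), folded eq]
          M.parametrization_tendsto(1) [OF \<phi>(1,2)]])
  ultimately show ?thesis
  proof eventually_elim
    case (elim y)
    show ?case
    proof
      assume y: "y $ first = 0"
      then have "\<phi> y \<in> boundary M"
        using \<phi>(1) elim(1) unfolding boundary_def by blast
      then have bN: "\<phi> y \<in> boundary N"
        by (simp add: boundary)
      then obtain \<phi>2 V2 y2 where "parametrization N \<phi>2 V2" "y2 \<in> V2" "y2 $ first = 0" "\<phi>2 y2 = \<phi> y"
        unfolding boundary_def by auto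
      then have "\<phi> y \<in> N"
        using parametrizationD(5) by (metis order_refl)
      with elim have 1: "transition y $ first \<le> 0" "\<psi> (transition y) = \<phi> y"
        by (auto simp: transition_def)
      then have "transition y $ first = 0"
        using N.boundary_first_eq_0 [OF \<psi>(1)] elim(2) bN by simp
      with 1 show "transition y $ first = 0 \<and> \<psi> (transition y) = \<phi> y"
        by simp
    qed
  qed
qed

lemma eventually_hyperplane:
  assumes "\<forall>\<^sub>F y in nhds a. y $ first = 0 \<longrightarrow> Q y" and "v $ first = 0"
  shows "\<forall>\<^sub>F t in nhds (0::real). Q (a + t *\<^sub>R v)"
proof -
  have "((\<lambda>t. a + t *\<^sub>R v) \<longlongrightarrow> a + 0 *\<^sub>R v) (nhds (0::real))"
    by (intro tendsto_intros filterlim_ident)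
  then have "((\<lambda>t. a + t *\<^sub>R v) \<longlongrightarrow> a) (nhds (0::real))"
    by simp
  from eventually_compose_filterlim [OF assms(1) this] show ?thesis
    by eventually_elim (use assms(2) \<phi>(3) in simp)
qed

text \<open>Both facts are \<open>transition_boundary\<close> differentiated along the
  hyperplane.\<close>

lemma tangent_map_hyperplane:
  assumes v: "v $ first = 0"
  shows "tangent_map v $ first = 0" "\<partial> \<psi> b (tangent_map v) = \<partial> \<phi> a v"
proof -
  have "((\<lambda>y. transition y $ first) has_derivative (\<lambda>v. tangent_map v $ first)) (at a)"
    by (rule bounded_linear.has_derivative [OF bounded_linear_vec_nth transition_derivative])
  moreover have "((\<lambda>_. 0 :: real) has_derivative (\<lambda>_. 0)) (at a)"
    by simp
  ultimately show "tangent_map v $ first = 0"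
    by (rule has_derivative_directional_unique)
      (use eventually_hyperplane [OF transition_boundary v] in \<open>auto elim: eventually_mono\<close>)
  have "((\<lambda>y. \<psi> (transition y)) has_derivative (\<lambda>v. \<partial> \<psi> b (tangent_map v))) (at a)"
    by (rule has_derivative_compose [OF transition_derivative])
      (use parametrizationD(2) [OF \<psi>(1,2)] in \<open>simp add: transition_at\<close>)
  then show "\<partial> \<psi> b (tangent_map v) = \<partial> \<phi> a v"
    by (rule has_derivative_directional_unique [OF _ parametrizationD(2) [OF \<phi>(1,2)]])
      (use eventually_hyperplane [OF transition_boundary v] in \<open>auto elim: eventually_mono\<close>)
qed

text \<open>The hyperplane is invariant, so the matrix of the derivative is block triangular. Its
  corner entry is the number whose sign decides between the two sides; it is nonzero because the
  derivative is invertible.\<close>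

lemma tangent_map_first: "tangent_map v $ first = v $ first * tangent_map (axis first 1) $ first"
proof -
  note lin = has_derivative_linear [OF transition_derivative]
  let ?w = "v - (v $ first) *\<^sub>R axis first 1"
  have "tangent_map v = tangent_map ((v $ first) *\<^sub>R axis first 1 + ?w)"
    by simp
  also have "\<dots> = (v $ first) *\<^sub>R tangent_map (axis first 1) + tangent_map ?w"
    by (simp only: linear_add [OF lin] linear_scale [OF lin])
  finally show ?thesis
    using tangent_map_hyperplane(1) [of ?w] by simp
qed

lemma tangent_map_first_nonzero: "tangent_map (axis first 1) $ first \<noteq> 0"
proof
  assume "tangent_map (axis first 1) $ first = 0"
  then have *: "tangent_map v $ first = 0" for v
    by (subst tangent_map_first) simp
  obtain v where v: "L (\<partial> \<phi> a v) = L (\<partial> \<psi> b (axis first 1))"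
    using bij_tangents(1) by (metis (mono_tags) bij_inv_eq_iff)
  then have "tangent_map v = axis first 1"
    using bij_tangents(2) unfolding tangent_map_def by (metis (mono_tags, lifting) bij_inv_eq_iff)
  then show False
    using * [of v] by simp
qed

text \<open>The missing implication is \<open>transition_boundary\<close> with the roles of
  \<open>M\<close> and \<open>N\<close> exchanged, because the two transitions are mutually inverse
  near the point.\<close>

lemma transition_first_eq_0: "\<forall>\<^sub>F y in nhds a. transition y $ first = 0 \<longleftrightarrow> y $ first = 0"
proof -
  interpret sw: chart_pair L s N oN M oM \<psi> V' b g' \<phi> V a g
    by (rule swap)
  have 1: "\<forall>\<^sub>F y in nhds a. transition y $ first = 0 \<longrightarrow> sw.transition (transition y) $ first = 0"
    using eventually_compose_filterlim [OF sw.transition_boundary transition_tendsto]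
    by eventually_elim blast
  have "\<forall>\<^sub>F y in nhds a. L (\<psi> (g' (L (\<phi> y)))) = L (\<phi> y)"
    using eventually_compose_filterlim [OF N.local_chartD(3) [OF \<psi>(4), folded eq]
        M.parametrization_tendsto(2) [OF \<phi>(1,2)]]
    by eventually_elim blast
  with M.local_chartD(4) [OF \<phi>(4)] have 2: "\<forall>\<^sub>F y in nhds a. sw.transition (transition y) = y"
    by eventually_elim (simp add: transition_def sw.transition_def)
  from 1 2 transition_boundary show ?thesis
    by eventually_elim auto
qed

lemma transition_side:
  assumes pos: "0 < tangent_map (axis first 1) $ first"
  shows "\<forall>\<^sub>F y in nhds a. transition y $ first \<le> 0 \<longleftrightarrow> y $ first \<le> 0"
proof -
  obtain W where W: "open W" "L (\<phi> a) \<in> W" "continuous_on W g'"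
    using \<psi>(4) eq unfolding N.local_chart_def by auto
  have "\<forall>\<^sub>F y in nhds a. L (\<phi> y) \<in> W"
    using M.parametrization_tendsto(2) [OF \<phi>(1,2)] W(1,2) by (rule topological_tendstoD)
  moreover have "\<forall>\<^sub>F y in nhds a. y \<in> V"
    using parametrizationD(1) [OF \<phi>(1)] \<phi>(2) by (rule eventually_nhds_in_open)
  ultimately have "\<forall>\<^sub>F y in nhds a. L (\<phi> y) \<in> W \<and> y \<in> V \<and> (transition y $ first = 0 \<longleftrightarrow> y $ first = 0)"
    using transition_first_eq_0 by eventually_elim simp
  then obtain e where e: "e > 0"
    "\<And>y. y \<in> ball a e \<Longrightarrow> L (\<phi> y) \<in> W \<and> y \<in> V \<and> (transition y $ first = 0 \<longleftrightarrow> y $ first = 0)"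
    unfolding eventually_nhds_metric by (auto simp: dist_commute)
  have "continuous_on (ball a e) (\<lambda>y. g' (L (\<phi> y)))"
  proof (rule continuous_on_compose2 [OF W(3)])
    show "continuous_on (ball a e) (\<lambda>y. L (\<phi> y))"
      by (intro M.continuous_on_L continuous_on_subset [OF parametrizationD(6) [OF \<phi>(1)]])
        (use e(2) in blast)
  qed (use e(2) in blast)
  then have cont: "continuous_on (ball a e) (\<lambda>y. transition y $ first)"
    unfolding transition_def by (intro continuous_intros)
  have der: "((\<lambda>y. transition y $ first) has_derivative (\<lambda>v. tangent_map v $ first)) (at a)"
    by (rule bounded_linear.has_derivative [OF bounded_linear_vec_nth transition_derivative])
  have "transition y $ first \<le> 0 \<longleftrightarrow> y $ first \<le> 0" if "y \<in> ball a e" for y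
    by (rule half_space_side [OF cont _ der pos \<phi>(3) that]) (use e(2) in blast)
  then show ?thesis
    using e(1) unfolding eventually_nhds_metric by (auto simp: dist_commute)
qed

lemma chart_side:
  assumes pos: "0 < tangent_map (axis first 1) $ first"
  shows "\<forall>\<^sub>F z in nhds (L (\<phi> a)). g z $ first \<le> 0 \<longleftrightarrow> g' z $ first \<le> 0"
  using eventually_compose_filterlim [OF transition_side [OF pos] M.local_chartD(6) [OF \<phi>(4)]]
    M.local_chartD(3) [OF \<phi>(4)]
  by eventually_elim (simp add: transition_def)

end

section \<open>The induced orientation of the boundary\<close>

context oriented_immersion
begin

text \<open>Two parametrizations of the same \<open>M\<close>: the transition maps the half space
  into itself near \<open>a\<close>, whereas a negative corner entry would send the points
  \<open>a - h *\<^sub>R axis first 1\<close> to its outside.\<close>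

lemma tangent_map_first_pos:
  assumes "chart_pair L s M ori M ori \<phi> V a g \<psi> V' b g'"
  shows "0 < chart_pair.tangent_map L \<phi> a \<psi> b (axis first 1) $ first"
proof -
  interpret chart_pair L s M ori M ori \<phi> V a g \<psi> V' b g'
    by (rule assms)
  let ?k = "tangent_map (axis first 1) $ first"
  have "\<not> ?k < 0"
  proof
    assume k: "?k < 0"
    have line: "((\<lambda>t. a + t *\<^sub>R axis first 1) has_derivative (\<lambda>t. t *\<^sub>R axis first 1)) (at (0::real))"
      by (auto intro!: derivative_eq_intros)
    have "((\<lambda>y. transition y $ first) has_derivative (\<lambda>v. tangent_map v $ first)) (at (a + 0 *\<^sub>R axis first 1))"
      using bounded_linear.has_derivative [OF bounded_linear_vec_nth transition_derivative] by simp
    from has_derivative_compose [OF line this]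
    have "((\<lambda>t. transition (a + t *\<^sub>R axis first 1) $ first) has_derivative
        (\<lambda>t. tangent_map (t *\<^sub>R axis first 1) $ first)) (at 0)" .
    moreover have "tangent_map (t *\<^sub>R axis first 1) $ first = ?k * t" for t
      by (subst tangent_map_first) simp
    ultimately have D: "DERIV (\<lambda>t. transition (a + t *\<^sub>R axis first 1) $ first) 0 :> ?k"
      by (simp add: has_field_derivative_def)
    obtain d where d: "d > 0" "\<And>h. 0 < h \<Longrightarrow> h < d \<Longrightarrow> 0 < transition (a - h *\<^sub>R axis first 1) $ first"
      using DERIV_neg_dec_left [OF D k] transition_at \<psi>(3) by auto
    have 1: "\<forall>\<^sub>F y in nhds a. y \<in> V"
      using parametrizationD(1) [OF \<phi>(1)] \<phi>(2) by (rule eventually_nhds_in_open)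
    have 2: "\<forall>\<^sub>F y in nhds a. \<phi> y \<in> M \<longrightarrow> g' (L (\<phi> y)) $ first \<le> 0 \<and> \<psi> (g' (L (\<phi> y))) = \<phi> y"
      by (rule eventually_compose_filterlim [OF local_chartD(5) [OF \<psi>(4), folded eq]
            parametrization_tendsto(1) [OF \<phi>(1,2)]])
    have "\<forall>\<^sub>F y in nhds a. y $ first \<le> 0 \<longrightarrow> transition y $ first \<le> 0"
      using 1 2 by eventually_elim (use parametrizationD(5) [OF \<phi>(1)] in \<open>auto simp: transition_def\<close>)
    then obtain e where e: "e > 0"
      "\<And>y. dist y a < e \<Longrightarrow> y $ first \<le> 0 \<Longrightarrow> transition y $ first \<le> 0"
      unfolding eventually_nhds_metric by blast
    define h where "h = min (d / 2) (e / 2)"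
    have h: "0 < h" "h < d" "h < e"
      using d(1) e(1) by (auto simp: h_def min_def)
    have "transition (a - h *\<^sub>R axis first 1) $ first \<le> 0"
      using h \<phi>(3) by (intro e(2)) (simp_all add: dist_norm)
    then show False
      using d(2) [OF h(1,2)] by simp
  qed
  then show ?thesis
    using tangent_map_first_nonzero by linarith
qed

text \<open>An outward vector may come from any parametrization; in the coordinates of
  \<open>\<phi>\<close> its first coordinate is positive, and only that coordinate affects the
  determinant. The value \<open>undefined\<close> at \<open>first\<close> makes \<open>w\<close> a
  family indexed by the remaining indices; for n = 1 this family is empty and the sign is that of
  the boundary point.\<close>

lemma mem_oriented_boundary_iff:
  assumes \<phi>: "parametrization M \<phi> V" "a \<in> V" "a $ first = 0"
    and w: "w first = undefined" "\<And>i. i \<noteq> first \<Longrightarrow> w i = \<partial> \<phi> a (c i) \<and> c i $ first = 0"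
  shows "w \<in> snd (oriented_boundary M ori) (\<phi> a) \<longleftrightarrow>
    0 < s * coord_det L (w(first := \<partial> \<phi> a (axis first 1)))" (is "_ \<longleftrightarrow> 0 < s * ?D")
proof -
  have x: "\<phi> a \<in> boundary M" "\<phi> a \<in> M"
    using \<phi> parametrizationD(5) [OF \<phi>(1)] unfolding boundary_def by auto
  have wbt: "w \<in> (- {first}) \<rightarrow>\<^sub>E boundary_tangent M (\<phi> a)"
  proof (rule PiE_I)
    fix i :: 'n assume "i \<in> - {first}"
    then show "w i \<in> boundary_tangent M (\<phi> a)"
      using \<phi> w(2) [of i] unfolding boundary_tangent_def by auto
  qed (use w(1) in auto)
  then have iff: "w \<in> snd (oriented_boundary M ori) (\<phi> a) \<longleftrightarrow>
      (\<exists>\<nu>\<in>outward M (\<phi> a). w(first := \<nu>) \<in> ori (\<phi> a))"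
    using x(1) by (simp add: oriented_boundary_def)
  obtain g where g: "local_chart \<phi> V a g"
    using local_chart_exists [OF \<phi>(1,2)] \<phi>(3) by auto
  show ?thesis
    unfolding iff
  proof
    assume "\<exists>\<nu>\<in>outward M (\<phi> a). w(first := \<nu>) \<in> ori (\<phi> a)"
    then obtain \<nu> where \<nu>: "\<nu> \<in> outward M (\<phi> a)" "w(first := \<nu>) \<in> ori (\<phi> a)"
      by blast
    obtain \<phi>1 V1 y u where 1: "parametrization M \<phi>1 V1" "y \<in> V1" "y $ first = 0" "\<phi>1 y = \<phi> a"
      "u $ first > 0" "\<nu> = \<partial> \<phi>1 y u"
      using \<nu>(1) unfolding outward_def by blast
    obtain g1 where g1: "local_chart \<phi>1 V1 y g1"
      using local_chart_exists [OF 1(1,2)] 1(3) by auto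
    interpret p: chart_pair L s M ori M ori \<phi>1 V1 y g1 \<phi> V a g
      by unfold_locales (use \<phi> g 1 g1 in auto)
    have "0 < p.tangent_map (axis first 1) $ first"
      using tangent_map_first_pos [OF p.chart_pair_axioms] .
    then have pos': "0 < p.tangent_map u $ first"
      by (subst p.tangent_map_first) (use 1(5) in simp)
    have "coord_det L (w(first := \<nu>)) = p.tangent_map u $ first * ?D"
      by (rule coord_det_update_first [OF \<phi>(1,2), of _ c]) (use w 1(6) p.L_tangent_map in auto)
    moreover have "0 < s * coord_det L (w(first := \<nu>))"
      using pos [OF x(2) \<nu>(2)] .
    ultimately have "0 < p.tangent_map u $ first * (s * ?D)"
      by (simp add: ac_simps)
    then show "0 < s * ?D"
      using pos' zero_less_mult_pos by blast
  next
    assume "0 < s * ?D"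
    moreover have "range (w(first := \<partial> \<phi> a (axis first 1))) \<subseteq> plane (ori (\<phi> a))"
      using range_tangent [OF \<phi>(1,2)] \<phi>(3) w(2) by auto
    ultimately have "w(first := \<partial> \<phi> a (axis first 1)) \<in> ori (\<phi> a)"
      using pos_iff_mem_orientation [OF x(2)] by blast
    moreover have "\<partial> \<phi> a (axis first 1) \<in> outward M (\<phi> a)"
      using \<phi> unfolding outward_def by force
    ultimately show "\<exists>\<nu>\<in>outward M (\<phi> a). w(first := \<nu>) \<in> ori (\<phi> a)"
      by blast
  qed
qed

end

context chart_pair
begin

text \<open>One boundary frame is completed by the normal vector of either parametrization. The two
  determinants differ by the corner entry and are nonzero, and the common boundary orientation
  forces them to have the same sign.\<close>

lemma tangent_map_first_pos:
  assumes ob: "oriented_boundary M oM = oriented_boundary N oN"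
  shows "0 < tangent_map (axis first 1) $ first"
proof -
  define w where "w i = (if i = first then undefined else \<partial> \<phi> a (axis i 1))" for i
  have ax: "i \<noteq> first \<Longrightarrow> axis i (1::real) $ first = 0" for i :: 'n
    by (simp add: axis_def)
  let ?D = "coord_det L (w(first := \<partial> \<phi> a (axis first 1)))"
  let ?E = "coord_det L (w(first := \<partial> \<psi> b (axis first 1)))"
  have 1: "w \<in> snd (oriented_boundary M oM) (\<phi> a) \<longleftrightarrow> 0 < s * ?D"
    by (rule M.mem_oriented_boundary_iff [OF \<phi>(1-3), of _ "\<lambda>i. axis i 1"]) (auto simp: w_def ax)
  have w': "i \<noteq> first \<Longrightarrow> w i = \<partial> \<psi> b (tangent_map (axis i 1)) \<and> tangent_map (axis i 1) $ first = 0" for i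
    using tangent_map_hyperplane [OF ax, of i] by (simp add: w_def)
  have 2: "w \<in> snd (oriented_boundary N oN) (\<psi> b) \<longleftrightarrow> 0 < s * ?E"
    by (rule N.mem_oriented_boundary_iff [OF \<psi>(1-3), of _ "\<lambda>i. tangent_map (axis i 1)"])
      (use w' in \<open>auto simp: w_def\<close>)
  have iff: "0 < s * ?D \<longleftrightarrow> 0 < s * ?E"
    using 1 2 ob eq by simp
  have DE: "?D = tangent_map (axis first 1) $ first * ?E"
    by (rule N.coord_det_update_first [OF \<psi>(1,2), of _ "\<lambda>i. tangent_map (axis i 1)"])
      (use w' L_tangent_map in auto)
  have "w(first := \<partial> \<phi> a (axis first 1)) = (\<lambda>i. \<partial> \<phi> a (axis i 1))"
    by (auto simp: w_def)
  then have "?D = coord_det (\<lambda>v. L (\<partial> \<phi> a v)) (\<lambda>i. axis i 1)"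
    by (simp add: coord_det_def)
  moreover have "span (range (\<lambda>i. axis i 1)) = (UNIV :: (real ^ 'n::_) set)"
  proof -
    have "Basis \<subseteq> range (\<lambda>i. axis i 1 :: real ^ 'n::_)"
      by (auto simp: Basis_vec_def)
    then show ?thesis
      using span_Basis span_mono by blast
  qed
  ultimately have D0: "?D \<noteq> 0"
    using coord_det_frame_nonzero [of "\<lambda>v. L (\<partial> \<phi> a v)" "\<lambda>i. axis i 1"]
      M.bij_tangent [OF \<phi>(1,2)] \<phi>(3) by (simp add: bij_def)
  have xM: "\<phi> a \<in> M"
    using parametrizationD(5) [OF \<phi>(1,2)] \<phi>(3) by simp
  have s: "s \<noteq> 0"
  proof -
    obtain \<phi>2 V2 and d :: "'n \<Rightarrow> real ^ 'n::_" where
      "\<phi> a \<in> \<phi>2 ` (V2 \<inter> half_space)"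
      "\<And>y. y \<in> V2 \<inter> half_space \<Longrightarrow> oM (\<phi>2 y) = oriented_by (\<lambda>i. \<partial> \<phi>2 y (d i))"
      using M.orientation xM unfolding orientation_def by meson
    then have "\<exists>c. c \<in> oM (\<phi> a)"
      using plane_oriented_by(2) by (metis imageE)
    then show ?thesis
      using M.pos [OF xM] by force
  qed
  have "s * ?E \<noteq> 0"
    using D0 s unfolding DE by auto
  moreover have "s * ?D = tangent_map (axis first 1) $ first * (s * ?E)"
    unfolding DE by simp
  ultimately have "\<not> tangent_map (axis first 1) $ first < 0"
    using iff by (metis mult_neg_neg mult_neg_pos not_less_iff_gr_or_eq)
  then show ?thesis
    using tangent_map_first_nonzero by linarith
qed

end

section \<open>Counting preimages\<close>

context oriented_immersion
begin

lemma obtain_parametrization: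
  assumes "x \<in> M"
  obtains \<phi> V a where "parametrization M \<phi> V" "a \<in> V" "a $ first \<le> 0" "\<phi> a = x"
proof -
  obtain \<phi> V and b :: "'n \<Rightarrow> real ^ 'n::_" where
    "parametrization M \<phi> V" "x \<in> \<phi> ` (V \<inter> half_space)"
    using orientation assms unfolding orientation_def by meson
  then show thesis
    using that by auto
qed

lemma locally_inj:
  assumes "x \<in> M"
  obtains r where "r > 0" "inj_on L (M \<inter> ball x r)"
proof -
  obtain \<phi> V a where \<phi>: "parametrization M \<phi> V" "a \<in> V" "a $ first \<le> 0" "\<phi> a = x"
    using obtain_parametrization [OF assms] .
  obtain g where "local_chart \<phi> V a g"
    using local_chart_exists [OF \<phi>(1-3)] .
  then show thesis
    using chart_image [OF \<phi>(1,2)] that \<phi>(4) by metis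
qed

text \<open>An infinite fibre would accumulate at a point of \<open>M\<close>, against local
  injectivity.\<close>

lemma finite_fibre:
  assumes "compact M"
  shows "finite {x \<in> M. L x = z}"
proof (rule ccontr)
  assume "infinite {x \<in> M. L x = z}"
  then obtain x where x: "x \<in> M" "x islimpt {x \<in> M. L x = z}"
    using assms unfolding compact_eq_Bolzano_Weierstrass by (metis (no_types, lifting) mem_Collect_eq subsetI)
  obtain r where r: "r > 0" "inj_on L (M \<inter> ball x r)"
    using locally_inj [OF x(1)] .
  have "infinite ({x \<in> M. L x = z} \<inter> ball x r)"
    using x(2) r(1) unfolding islimpt_eq_infinite_ball by blast
  moreover have "inj_on L ({x \<in> M. L x = z} \<inter> ball x r)"
    using r(2) by (rule inj_on_subset) auto
  moreover have "L ` ({x \<in> M. L x = z} \<inter> ball x r) \<subseteq> {z}"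
    by auto
  ultimately show False
    using finite_imageD [of L] finite_subset [of _ "{z}"] by blast
qed

text \<open>Interior points and points outside \<open>M\<close> are covered together, since a point
  in the union of two submanifolds may belong to only one of them. Near \<open>L x\<close> the local
  image is then everything or nothing.\<close>

lemma local_image_off_boundary:
  assumes M: "compact M" and x: "x \<notin> boundary M"
  obtains r0 where "r0 > 0" "inj_on L (M \<inter> ball x r0)"
    "\<And>r. 0 < r \<Longrightarrow> r \<le> r0 \<Longrightarrow> \<forall>\<^sub>F z in nhds (L x). (\<exists>x'\<in>M \<inter> ball x r. L x' = z) \<longleftrightarrow> x \<in> M"
proof (cases "x \<in> M")
  case True
  obtain \<phi> V a where \<phi>: "parametrization M \<phi> V" "a \<in> V" "a $ first \<le> 0" "\<phi> a = x"
    using obtain_parametrization [OF True] .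
  obtain g where g: "local_chart \<phi> V a g"
    using local_chart_exists [OF \<phi>(1-3)] .
  obtain r0 where r0: "r0 > 0" "inj_on L (M \<inter> ball x r0)"
    "\<And>r. 0 < r \<Longrightarrow> r \<le> r0 \<Longrightarrow>
      \<forall>\<^sub>F z in nhds (L x). (\<exists>x'\<in>M \<inter> ball x r. L x' = z) \<longleftrightarrow> g z $ first \<le> 0"
    using chart_image [OF \<phi>(1,2) g] unfolding \<phi>(4) by blast
  have "a $ first \<noteq> 0"
    using x \<phi> unfolding boundary_def by auto
  then have neg: "a $ first < 0"
    using \<phi>(3) by simp
  have "((\<lambda>z. g z $ first) \<longlongrightarrow> a $ first) (nhds (L x))"
    using local_chartD(6) [OF g] unfolding \<phi>(4) by (intro tendsto_intros)
  then have *: "\<forall>\<^sub>F z in nhds (L x). g z $ first < 0"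
    using neg by (rule order_tendstoD)
  show thesis
  proof (rule that [OF r0(1,2)])
    fix r assume "0 < r" "r \<le> r0"
    from r0(3) [OF this] * show "\<forall>\<^sub>F z in nhds (L x). (\<exists>x'\<in>M \<inter> ball x r. L x' = z) \<longleftrightarrow> x \<in> M"
      by eventually_elim (use True in auto)
  qed
next
  case False
  have "open (- M)"
    using M by (simp add: compact_imp_closed open_Compl)
  then obtain r0 where r0: "r0 > 0" "ball x r0 \<subseteq> - M"
    using False open_contains_ball by blast
  then have *: "M \<inter> ball x r0 = {}"
    by auto
  show thesis
  proof (rule that [OF r0(1)])
    fix r assume "0 < r" "r \<le> r0"
    then have "M \<inter> ball x r = {}"
      using * by auto
    then show "\<forall>\<^sub>F z in nhds (L x). (\<exists>x'\<in>M \<inter> ball x r. L x' = z) \<longleftrightarrow> x \<in> M"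
      using False by simp
  qed (simp add: *)
qed

end

lemma card_fibre_inj:
  assumes "inj_on L S"
  shows "card {x \<in> S. L x = z} = of_bool (\<exists>x\<in>S. L x = z)"
proof (cases "\<exists>x\<in>S. L x = z")
  case True
  then obtain x where "x \<in> S" "L x = z"
    by blast
  then have "{x \<in> S. L x = z} = {x}"
    using assms by (auto simp: inj_on_def)
  with True show ?thesis
    by simp
next
  case False
  then have "{x \<in> S. L x = z} = {}"
    by blast
  with False show ?thesis
    by (simp only: card.empty) simp
qed

text \<open>In a small ball each count is 0 or 1. At a common boundary point both jump across a
  hypersurface, but they jump together, because the two local images fill the same side.\<close>

lemma local_card_difference:
  assumes I: "oriented_immersion L s M oM" "oriented_immersion L s N oN"
    and comp: "compact M" "compact N"
    and ob: "oriented_boundary M oM = oriented_boundary N oN"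
  obtains r0 where "r0 > 0"
    "\<And>r. 0 < r \<Longrightarrow> r \<le> r0 \<Longrightarrow> \<forall>\<^sub>F z in nhds (L x).
      int (card {y \<in> M \<inter> ball x r. L y = z}) - int (card {y \<in> N \<inter> ball x r. L y = z})
      = of_bool (x \<in> M) - of_bool (x \<in> N)"
proof -
  interpret M: oriented_immersion L s M oM by (rule I)
  interpret N: oriented_immersion L s N oN by (rule I)
  have bd: "boundary M = boundary N"
    using ob by (simp add: oriented_boundary_def)
  have "\<exists>r0>0. inj_on L (M \<inter> ball x r0) \<and> inj_on L (N \<inter> ball x r0) \<and>
    (\<forall>r. 0 < r \<longrightarrow> r \<le> r0 \<longrightarrow> (\<forall>\<^sub>F z in nhds (L x).
      (of_bool (\<exists>y\<in>M \<inter> ball x r. L y = z) :: int) - of_bool (\<exists>y\<in>N \<inter> ball x r. L y = z)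
      = of_bool (x \<in> M) - of_bool (x \<in> N)))"
  proof (cases "x \<in> boundary M")
    case False
    obtain r1 where 1: "r1 > 0" "inj_on L (M \<inter> ball x r1)"
      "\<And>r. 0 < r \<Longrightarrow> r \<le> r1 \<Longrightarrow> \<forall>\<^sub>F z in nhds (L x). (\<exists>x'\<in>M \<inter> ball x r. L x' = z) \<longleftrightarrow> x \<in> M"
      using M.local_image_off_boundary [OF comp(1) False] by blast
    obtain r2 where 2: "r2 > 0" "inj_on L (N \<inter> ball x r2)"
      "\<And>r. 0 < r \<Longrightarrow> r \<le> r2 \<Longrightarrow> \<forall>\<^sub>F z in nhds (L x). (\<exists>x'\<in>N \<inter> ball x r. L x' = z) \<longleftrightarrow> x \<in> N"
      using N.local_image_off_boundary [OF comp(2) False [unfolded bd]] by blast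
    show ?thesis
    proof (intro exI [of _ "min r1 r2"] conjI allI impI)
      show "inj_on L (M \<inter> ball x (min r1 r2))"
        by (rule inj_on_subset [OF 1(2)]) auto
      show "inj_on L (N \<inter> ball x (min r1 r2))"
        by (rule inj_on_subset [OF 2(2)]) auto
      fix r assume "0 < r" "r \<le> min r1 r2"
      then have "0 < r" "r \<le> r1" "r \<le> r2"
        by auto
      from 1(3) [OF this(1,2)] 2(3) [OF this(1,3)]
      show "\<forall>\<^sub>F z in nhds (L x).
          (of_bool (\<exists>y\<in>M \<inter> ball x r. L y = z) :: int) - of_bool (\<exists>y\<in>N \<inter> ball x r. L y = z)
          = of_bool (x \<in> M) - of_bool (x \<in> N)"
        by eventually_elim simp
    qed (use 1(1) 2(1) in auto)
  next
    case True
    obtain \<phi> V a where \<phi>: "parametrization M \<phi> V" "a \<in> V" "a $ first = 0" "\<phi> a = x"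
      using True unfolding boundary_def by auto
    obtain \<psi> V' b where \<psi>: "parametrization N \<psi> V'" "b \<in> V'" "b $ first = 0" "\<psi> b = x"
    proof -
      have "x \<in> boundary N"
        using True by (simp add: bd)
      then show ?thesis
        using that unfolding boundary_def by auto
    qed
    have x: "x \<in> M" "x \<in> N"
      using parametrizationD(5) [OF \<phi>(1,2)] parametrizationD(5) [OF \<psi>(1,2)] \<phi> \<psi> by auto
    obtain g where g: "M.local_chart \<phi> V a g"
      using M.local_chart_exists [OF \<phi>(1,2)] \<phi>(3) by auto
    obtain g' where g': "N.local_chart \<psi> V' b g'"
      using N.local_chart_exists [OF \<psi>(1,2)] \<psi>(3) by auto
    interpret p: chart_pair L s M oM N oN \<phi> V a g \<psi> V' b g'
      by unfold_locales (use \<phi> \<psi> g g' bd in auto)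
    obtain r1 where 1: "r1 > 0" "inj_on L (M \<inter> ball x r1)"
      "\<And>r. 0 < r \<Longrightarrow> r \<le> r1 \<Longrightarrow> \<forall>\<^sub>F z in nhds (L x). (\<exists>x'\<in>M \<inter> ball x r. L x' = z) \<longleftrightarrow> g z $ first \<le> 0"
      using M.chart_image [OF \<phi>(1,2) g] unfolding \<phi>(4) by blast
    obtain r2 where 2: "r2 > 0" "inj_on L (N \<inter> ball x r2)"
      "\<And>r. 0 < r \<Longrightarrow> r \<le> r2 \<Longrightarrow> \<forall>\<^sub>F z in nhds (L x). (\<exists>x'\<in>N \<inter> ball x r. L x' = z) \<longleftrightarrow> g' z $ first \<le> 0"
      using N.chart_image [OF \<psi>(1,2) g'] unfolding \<psi>(4) by blast
    have 3: "\<forall>\<^sub>F z in nhds (L x). g z $ first \<le> 0 \<longleftrightarrow> g' z $ first \<le> 0"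
      using p.chart_side [OF p.tangent_map_first_pos [OF ob]] unfolding \<phi>(4) .
    show ?thesis
    proof (intro exI [of _ "min r1 r2"] conjI allI impI)
      show "inj_on L (M \<inter> ball x (min r1 r2))"
        by (rule inj_on_subset [OF 1(2)]) auto
      show "inj_on L (N \<inter> ball x (min r1 r2))"
        by (rule inj_on_subset [OF 2(2)]) auto
      fix r assume "0 < r" "r \<le> min r1 r2"
      then have "0 < r" "r \<le> r1" "r \<le> r2"
        by auto
      from 1(3) [OF this(1,2)] 2(3) [OF this(1,3)] 3
      show "\<forall>\<^sub>F z in nhds (L x).
          (of_bool (\<exists>y\<in>M \<inter> ball x r. L y = z) :: int) - of_bool (\<exists>y\<in>N \<inter> ball x r. L y = z)
          = of_bool (x \<in> M) - of_bool (x \<in> N)"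
        by eventually_elim (use x in simp)
    qed (use 1(1) 2(1) in auto)
  qed
  then obtain r0 where r0: "r0 > 0" "inj_on L (M \<inter> ball x r0)" "inj_on L (N \<inter> ball x r0)"
    "\<And>r. 0 < r \<Longrightarrow> r \<le> r0 \<Longrightarrow> \<forall>\<^sub>F z in nhds (L x).
      (of_bool (\<exists>y\<in>M \<inter> ball x r. L y = z) :: int) - of_bool (\<exists>y\<in>N \<inter> ball x r. L y = z)
      = of_bool (x \<in> M) - of_bool (x \<in> N)"
    by blast
  show thesis
  proof (rule that [OF r0(1)])
    fix r assume r: "0 < r" "r \<le> r0"
    have "inj_on L (M \<inter> ball x r)" "inj_on L (N \<inter> ball x r)"
      using r by (auto intro: inj_on_subset [OF r0(2)] inj_on_subset [OF r0(3)])
    from this [THEN card_fibre_inj] r0(4) [OF r]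
    show "\<forall>\<^sub>F z in nhds (L x).
      int (card {y \<in> M \<inter> ball x r. L y = z}) - int (card {y \<in> N \<inter> ball x r. L y = z})
      = of_bool (x \<in> M) - of_bool (x \<in> N)"
      by (simp only: of_nat_of_bool)
  qed
qed

lemma finite_separation:
  fixes X :: "'a::metric_space set"
  assumes "finite X" and "\<And>x. x \<in> X \<Longrightarrow> r0 x > 0"
  shows "\<exists>r>0. (\<forall>x\<in>X. r \<le> r0 x) \<and> (\<forall>x\<in>X. \<forall>y\<in>X. x \<noteq> y \<longrightarrow> ball x r \<inter> ball y r = {})"
proof -
  \<comment> \<open>The 1 keeps the minimum meaningful for empty \<open>X\<close>; the halved
    distances make the balls disjoint.\<close>
  define E where "E = insert 1 (r0 ` X \<union> (\<lambda>(x, y). dist x y / 2) ` {p \<in> X \<times> X. fst p \<noteq> snd p})"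
  have fin: "finite E"
    unfolding E_def using assms(1) by (intro finite.insertI finite_UnI finite_imageI) auto
  have ne: "E \<noteq> {}" and pos: "\<forall>e\<in>E. 0 < e"
    using assms(2) by (auto simp: E_def)
  show ?thesis
  proof (intro exI [of _ "Min E"] conjI ballI impI)
    show "0 < Min E"
      using fin ne pos by simp
    show "Min E \<le> r0 x" if "x \<in> X" for x
      using fin that by (intro Min_le) (auto simp: E_def)
    fix x y assume "x \<in> X" "y \<in> X" "x \<noteq> y"
    then have "Min E \<le> dist x y / 2"
      using fin by (intro Min_le) (force simp: E_def)+
    moreover have "dist x y < 2 * Min E" if "w \<in> ball x (Min E) \<inter> ball y (Min E)" for w
      using that dist_triangle [of x y w] by (simp add: dist_commute)
    ultimately show "ball x (Min E) \<inter> ball y (Min E) = {}"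
      by fastforce
  qed
qed

theorem card_fibre_eq:
  fixes L :: "double ^ 'n::{finite,wellorder} \<Rightarrow> real ^ 'n::_"
  assumes I: "oriented_immersion L s M oM" "oriented_immersion L s N oN"
    and comp: "compact M" "compact N"
    and ob: "oriented_boundary M oM = oriented_boundary N oN"
  shows "card {x \<in> M. L x = z} = card {x \<in> N. L x = z}"
proof -
  interpret M: oriented_immersion L s M oM by (rule I)
  interpret N: oriented_immersion L s N oN by (rule I)
  define d where "d z = int (card {x \<in> M. L x = z}) - int (card {x \<in> N. L x = z})" for z
  have local: "\<forall>\<^sub>F z in nhds z0. d z = d z0" for z0
  proof -
    define X where "X = {x \<in> M \<union> N. L x = z0}"
    have "X = {x \<in> M. L x = z0} \<union> {x \<in> N. L x = z0}"
      by (auto simp: X_def)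
    then have X: "finite X"
      using M.finite_fibre N.finite_fibre comp by simp
    let ?m = "\<lambda>r x z. {y \<in> M \<inter> ball x r. L y = z}" and ?n = "\<lambda>r x z. {y \<in> N \<inter> ball x r. L y = z}"
    define Q where "Q r x \<longleftrightarrow> (\<forall>\<^sub>F z in nhds (L x).
        int (card (?m r x z)) - int (card (?n r x z)) = of_bool (x \<in> M) - of_bool (x \<in> N))" for r x
    have "\<exists>r0>0. \<forall>r. 0 < r \<longrightarrow> r \<le> r0 \<longrightarrow> Q r x" for x
      unfolding Q_def by (rule local_card_difference [OF I comp ob, of x]) blast
    then obtain r0 where r0: "\<And>x. r0 x > 0" "\<And>x r. 0 < r \<Longrightarrow> r \<le> r0 x \<Longrightarrow> Q r x"
      by metis
    obtain r where r: "r > 0" "\<And>x. x \<in> X \<Longrightarrow> r \<le> r0 x"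
      "\<And>x y. x \<in> X \<Longrightarrow> y \<in> X \<Longrightarrow> x \<noteq> y \<Longrightarrow> ball x r \<inter> ball y r = {}"
      using finite_separation [of X r0, OF X r0(1)] by blast
    have 1: "\<forall>\<^sub>F z in nhds z0. \<forall>x\<in>X. int (card (?m r x z)) - int (card (?n r x z))
        = of_bool (x \<in> M) - of_bool (x \<in> N)"
    proof (intro eventually_ball_finite [OF X] ballI)
      fix x assume "x \<in> X"
      then show "\<forall>\<^sub>F z in nhds z0. int (card (?m r x z)) - int (card (?n r x z))
        = of_bool (x \<in> M) - of_bool (x \<in> N)"
        using r0(2) [OF r(1) r(2)] by (simp add: X_def Q_def)
    qed
    \<comment> \<open>Outside the balls the image is compact and misses \<open>z0\<close>, so for
      \<open>z\<close> near \<open>z0\<close> all preimages lie in the balls.\<close>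
    define K where "K = (M \<union> N) - (\<Union>x\<in>X. ball x r)"
    have "compact K"
      unfolding K_def using comp by (intro compact_diff compact_Un) auto
    then have "compact (L ` K)"
      by (intro compact_continuous_image M.continuous_on_L continuous_on_id)
    then have "open (- (L ` K))"
      by (simp add: compact_imp_closed open_Compl)
    moreover have "z0 \<in> - (L ` K)"
      using r(1) by (auto simp: K_def X_def)
    ultimately have 2: "\<forall>\<^sub>F z in nhds z0. z \<in> - (L ` K)"
      by (rule eventually_nhds_in_open)
    from 1 2 show ?thesis
    proof eventually_elim
      case (elim z)
      have split: "card {x \<in> S. L x = z} = (\<Sum>x\<in>X. card {y \<in> S \<inter> ball x r. L y = z})"
        if S: "S \<subseteq> M \<union> N" "finite {x \<in> S. L x = z}" for S
      proof -
        have "{x \<in> S. L x = z} = (\<Union>x\<in>X. {y \<in> S \<inter> ball x r. L y = z})"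
          using elim(2) S(1) by (auto simp: K_def)
        also have "card \<dots> = (\<Sum>x\<in>X. card {y \<in> S \<inter> ball x r. L y = z})"
        proof (rule card_UN_disjoint [OF X])
          show "\<forall>x\<in>X. finite {y \<in> S \<inter> ball x r. L y = z}"
            using S(2) by (auto elim: finite_subset [rotated])
          show "\<forall>x\<in>X. \<forall>y\<in>X. x \<noteq> y \<longrightarrow>
              {y \<in> S \<inter> ball x r. L y = z} \<inter> {x \<in> S \<inter> ball y r. L x = z} = {}"
            using r(3) by blast
        qed
        finally show ?thesis .
      qed
      have "d z = (\<Sum>x\<in>X. int (card (?m r x z)) - int (card (?n r x z)))"
        unfolding d_def using split [of M] split [of N] M.finite_fibre N.finite_fibre comp
        by (simp add: sum_subtractf)
      also have "\<dots> = (\<Sum>x\<in>X. of_bool (x \<in> M) - of_bool (x \<in> N))"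
        using elim(1) by (intro sum.cong) auto
      \<comment> \<open>\<open>X\<close> is the union of the two fibres over \<open>z0\<close>, so
        the local differences add up to the difference of their cardinalities.\<close>
      also have "\<dots> = d z0"
      proof -
        have "X \<inter> M = {x \<in> M. L x = z0}" "X \<inter> N = {x \<in> N. L x = z0}"
          by (auto simp: X_def)
        then show ?thesis
          by (simp add: d_def sum_subtractf X)
      qed
      finally show ?case .
    qed
  qed
  have "d constant_on UNIV"
  proof (rule locally_constant_imp_constant)
    fix z0
    obtain T where "open T" "z0 \<in> T" "\<forall>z\<in>T. d z = d z0"
      using local [of z0, unfolded eventually_nhds] by (elim exE conjE)
    moreover from \<open>open T\<close> have "openin (top_of_set UNIV) T"
      by simp
    ultimately show "\<exists>T. openin (top_of_set UNIV) T \<and> z0 \<in> T \<and> (\<forall>z\<in>T. d z = d z0)"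
      by (intro exI conjI)
  qed (rule connected_UNIV)
  then obtain c where c: "\<And>z. d z = c"
    unfolding constant_on_def by auto
  have "compact (L ` (M \<union> N))"
    using comp by (intro compact_continuous_image M.continuous_on_L continuous_on_id compact_Un)
  then have "bounded (L ` (M \<union> N))"
    by (rule compact_imp_bounded)
  then have "L ` (M \<union> N) \<noteq> UNIV"
    using not_bounded_UNIV [where 'a = "real ^ 'n::_"] by auto
  then obtain z1 where "z1 \<notin> L ` (M \<union> N)"
    by blast
  then have "{x \<in> M. L x = z1} = {}" "{x \<in> N. L x = z1} = {}"
    by auto
  then have "d z1 = 0"
    unfolding d_def by (simp only: card.empty)
  then show ?thesis
    using c [of z] c [of z1] by (simp add: d_def)
qed

section \<open>The area formula\<close>

text \<open>Pieces cut out by open sets need not be compact; boundedness is inherited from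
  \<open>C\<close>, and the piece itself only has to be measurable.\<close>

lemma absolutely_integrable_on_subset_of_compact:
  fixes f :: "'a::euclidean_space \<Rightarrow> 'b::euclidean_space"
  assumes C: "compact C" "continuous_on C f" and S: "S \<in> sets lebesgue" "S \<subseteq> C"
  shows "f absolutely_integrable_on S"
proof -
  obtain B where B: "\<And>x. x \<in> C \<Longrightarrow> norm (f x) \<le> B"
    using compact_imp_bounded [OF compact_continuous_image [OF C(2,1)]] unfolding bounded_iff by auto
  have "S \<in> lmeasurable"
    using bounded_set_imp_lmeasurable [OF bounded_subset [OF compact_imp_bounded [OF C(1)] S(2)] S(1)] .
  then have "(\<lambda>x. B) integrable_on S"
    by (rule integrable_on_const)
  moreover have "f \<in> borel_measurable (lebesgue_on S)"
    using S continuous_on_subset [OF C(2) S(2)] by (intro continuous_imp_measurable_on_sets_lebesgue)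
  ultimately show ?thesis
    using B S by (intro measurable_bounded_by_integrable_imp_absolutely_integrable [where g = "\<lambda>_. B"]) auto
qed

lemma fibre_sum_integral_inj:
  fixes f :: "real ^ 'n::{finite,wellorder} \<Rightarrow> real ^ 'n::_" and F :: "real ^ 'n::_ \<Rightarrow> real"
  assumes S: "S \<in> sets lebesgue" and der: "\<And>x. x \<in> S \<Longrightarrow> (f has_derivative f' x) (at x within S)"
    and inj: "inj_on f S" and int: "(\<lambda>x. \<bar>det (matrix (f' x))\<bar> * F x) absolutely_integrable_on S"
  shows "((\<lambda>z. \<Sum>y\<in>{y \<in> S. f y = z}. F y) has_integral integral S (\<lambda>x. \<bar>det (matrix (f' x))\<bar> * F x)) UNIV"
proof -
  let ?G = "\<lambda>x. \<bar>det (matrix (f' x))\<bar> * F x"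
  \<comment> \<open>The change of variables theorem concerns vector-valued functions;
    \<open>F\<close> is carried into \<open>real ^ 1\<close> by \<open>e\<close> and read off again
    as a coordinate.\<close>
  define e :: "real ^ 1" where "e = 1"
  have bl: "bounded_linear (\<lambda>r. r *\<^sub>R e)"
    by (rule bounded_linear_scaleR_left)
  define h where "h z = F (inv_into S f z) *\<^sub>R e" for z
  have h: "h (f x) = F x *\<^sub>R e" if "x \<in> S" for x
    using inj that by (simp add: h_def)
  have "(\<lambda>x. ?G x *\<^sub>R e) absolutely_integrable_on S"
    using absolutely_integrable_linear [OF int bl] by (simp add: o_def)
  moreover have "integral S (\<lambda>x. ?G x *\<^sub>R e) = integral S ?G *\<^sub>R e"
    using integral_linear [OF set_lebesgue_integral_eq_integral(1) [OF int] bl] by (simp add: o_def)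
  moreover have "(\<lambda>x. \<bar>det (matrix (f' x))\<bar> *\<^sub>R h (f x)) absolutely_integrable_on S
      \<longleftrightarrow> (\<lambda>x. ?G x *\<^sub>R e) absolutely_integrable_on S"
    by (rule set_integrable_cong) (simp_all add: h)
  moreover have "integral S (\<lambda>x. \<bar>det (matrix (f' x))\<bar> *\<^sub>R h (f x)) = integral S (\<lambda>x. ?G x *\<^sub>R e)"
    by (rule integral_cong) (simp add: h)
  ultimately have "h absolutely_integrable_on f ` S \<and> integral (f ` S) h = integral S ?G *\<^sub>R e"
    using has_absolute_integral_change_of_variables [OF S der inj, of h "integral S ?G *\<^sub>R e"] by simp
  then have "(h has_integral integral S ?G *\<^sub>R e) (f ` S)"
    using set_lebesgue_integral_eq_integral(1) by (auto simp: has_integral_iff)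
  from has_integral_linear [OF this bounded_linear_vec_nth [of 1]]
  have "((\<lambda>z. F (inv_into S f z)) has_integral integral S ?G) (f ` S)"
    by (simp add: o_def h_def e_def)
  then have "((\<lambda>z. if z \<in> f ` S then F (inv_into S f z) else 0) has_integral integral S ?G) UNIV"
    by (simp add: has_integral_restrict_UNIV)
  moreover have "(\<Sum>y\<in>{y \<in> S. f y = z}. F y) = (if z \<in> f ` S then F (inv_into S f z) else 0)" for z
  proof (cases "z \<in> f ` S")
    case True
    then have "{y \<in> S. f y = z} = {inv_into S f z}"
      using inj by (auto simp: inv_into_f_f inj_on_def f_inv_into_f inv_into_into)
    with True show ?thesis
      by simp
  next
    case False
    then have "{y \<in> S. f y = z} = {}"
      by auto
    then show ?thesis
      using False by (simp only: sum.empty if_False)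
  qed
  ultimately show ?thesis
    by simp
qed

text \<open>Local injectivity and compactness give a finite cover by open sets on which
  \<open>f\<close> is injective. These are split off one at a time, which is why the induction runs
  over measurable subsets; finiteness of the fibres is carried along so that the fibre sums can be
  split.\<close>

theorem area_formula:
  fixes f :: "real ^ 'n::{finite,wellorder} \<Rightarrow> real ^ 'n::_" and F :: "real ^ 'n::_ \<Rightarrow> real"
  assumes C: "compact C" and der: "\<And>x. x \<in> C \<Longrightarrow> (f has_derivative f' x) (at x)"
    and inj: "\<And>a. a \<in> C \<Longrightarrow> \<exists>U. open U \<and> a \<in> U \<and> inj_on f (C \<inter> U)"
    and F: "continuous_on C F" and f': "continuous_on C (\<lambda>x. det (matrix (f' x)))"
  shows "((\<lambda>z. \<Sum>y\<in>{y \<in> C. f y = z}. F y) has_integral integral C (\<lambda>x. \<bar>det (matrix (f' x))\<bar> * F x)) UNIV"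
proof -
  let ?G = "\<lambda>x. \<bar>det (matrix (f' x))\<bar> * F x"
  have G: "continuous_on C ?G"
    by (intro continuous_intros F f')
  have int: "?G absolutely_integrable_on S" if "S \<in> sets lebesgue" "S \<subseteq> C" for S
    using absolutely_integrable_on_subset_of_compact [OF C G that] .
  have main: "(\<forall>z. finite {y \<in> S. f y = z}) \<and>
      ((\<lambda>z. \<Sum>y\<in>{y \<in> S. f y = z}. F y) has_integral integral S ?G) UNIV"
    if "finite \<U>" "\<forall>U\<in>\<U>. open U \<and> inj_on f (C \<inter> U)" "S \<in> sets lebesgue" "S \<subseteq> C" "S \<subseteq> \<Union>\<U>"
    for \<U> S
    using that
  proof (induction \<U> arbitrary: S rule: finite_induct)
    case empty
    then have "S = {}"
      by blast
    then show ?case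
      by simp
  next
    case (insert U \<U>)
    let ?A = "S \<inter> U" and ?B = "S - U"
    have U: "open U" "inj_on f (C \<inter> U)"
      using insert.prems(1) by auto
    have mA: "?A \<in> sets lebesgue" and mB: "?B \<in> sets lebesgue"
      using insert.prems(2) U(1) by auto
    have injA: "inj_on f ?A"
      using U(2) by (rule inj_on_subset) (use insert.prems(3) in auto)
    have A: "((\<lambda>z. \<Sum>y\<in>{y \<in> ?A. f y = z}. F y) has_integral integral ?A ?G) UNIV"
    proof (rule fibre_sum_integral_inj [where f = f and f' = f' and F = F and S = ?A])
      show "?A \<in> sets lebesgue"
        by (rule mA)
      show "inj_on f ?A"
        by (rule injA)
      show "?G absolutely_integrable_on ?A"
        by (rule int [OF mA]) (use insert.prems(3) in auto)
      show "(f has_derivative f' x) (at x within ?A)" if "x \<in> ?A" for x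
        by (rule has_derivative_at_withinI, rule der) (use that insert.prems(3) in auto)
    qed
    have B: "(\<forall>z. finite {y \<in> ?B. f y = z}) \<and>
      ((\<lambda>z. \<Sum>y\<in>{y \<in> ?B. f y = z}. F y) has_integral integral ?B ?G) UNIV"
      by (rule insert.IH) (use insert.prems mB in auto)
    have finA: "finite {y \<in> ?A. f y = z}" for z
    proof -
      have "inj_on f {y \<in> ?A. f y = z}"
        using injA by (rule inj_on_subset) auto
      moreover have "f ` {y \<in> ?A. f y = z} \<subseteq> {z}"
        by auto
      ultimately show ?thesis
        using finite_imageD [of f] finite_subset [of _ "{z}"] by blast
    qed
    have eq: "{y \<in> S. f y = z} = {y \<in> ?A. f y = z} \<union> {y \<in> ?B. f y = z}" for z
      by auto
    have "(\<Sum>y\<in>{y \<in> S. f y = z}. F y) = (\<Sum>y\<in>{y \<in> ?A. f y = z}. F y) + (\<Sum>y\<in>{y \<in> ?B. f y = z}. F y)" for z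
      by (subst eq, rule sum.union_disjoint) (use finA B in auto)
    moreover have "integral S ?G = integral ?A ?G + integral ?B ?G"
    proof -
      have "(?G has_integral integral ?A ?G + integral ?B ?G) (?A \<union> ?B)"
        using int [OF mA] int [OF mB] insert.prems(3)
        by (intro has_integral_Un integrable_integral set_lebesgue_integral_eq_integral(1))
          (auto intro: negligible_subset [OF negligible_empty])
      moreover have "?A \<union> ?B = S"
        by auto
      ultimately show ?thesis
        by (simp add: integral_unique)
    qed
    ultimately have "((\<lambda>z. \<Sum>y\<in>{y \<in> S. f y = z}. F y) has_integral integral S ?G) UNIV"
      using has_integral_add [OF A conjunct2 [OF B]] by simp
    moreover have "finite {y \<in> S. f y = z}" for z
      by (subst eq) (use finA B in simp)
    ultimately show ?case
      by blast
  qed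
  obtain U where U: "\<And>a. a \<in> C \<Longrightarrow> open (U a) \<and> a \<in> U a \<and> inj_on f (C \<inter> U a)"
    using inj by metis
  have "C \<subseteq> (\<Union>a\<in>C. U a)"
    using U by blast
  then obtain D where D: "D \<subseteq> C" "finite D" "C \<subseteq> (\<Union>a\<in>D. U a)"
    using compactE_image [OF C, of C U] U by metis
  have "C \<in> sets lebesgue"
    using C by (simp add: borel_compact)
  then show ?thesis
    using main [of "U ` D" C] D U by blast
qed

section \<open>Partitions of unity and fibre sums\<close>

definition subordinate_partition ::
    "(double ^ 'n::{finite,wellorder}) set \<Rightarrow> nat \<Rightarrow> (nat \<Rightarrow> real ^ 'n::_ \<Rightarrow> double ^ 'n::_) \<Rightarrow>
     (nat \<Rightarrow> (real ^ 'n::_) set) \<Rightarrow> (nat \<Rightarrow> double ^ 'n::_ \<Rightarrow> real) \<Rightarrow> bool"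
  where "subordinate_partition M K \<phi> V \<rho> \<longleftrightarrow>
    (\<forall>k<K. parametrization M (\<phi> k) (V k) \<and> continuous_on M (\<rho> k) \<and> (\<forall>x\<in>M. 0 \<le> \<rho> k x) \<and>
       closure {x \<in> M. \<rho> k x \<noteq> 0} \<subseteq> \<phi> k ` (V k \<inter> half_space)) \<and>
    (\<forall>x\<in>M. (\<Sum>k<K. \<rho> k x) = 1)"

lemma subordinate_partitionD:
  assumes "subordinate_partition M K \<phi> V \<rho>"
  shows "k < K \<Longrightarrow> parametrization M (\<phi> k) (V k)" "k < K \<Longrightarrow> continuous_on M (\<rho> k)"
    "k < K \<Longrightarrow> x \<in> M \<Longrightarrow> 0 \<le> \<rho> k x"
    "k < K \<Longrightarrow> closure {x \<in> M. \<rho> k x \<noteq> 0} \<subseteq> \<phi> k ` (V k \<inter> half_space)"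
    "x \<in> M \<Longrightarrow> (\<Sum>k<K. \<rho> k x) = 1"
  using assms unfolding subordinate_partition_def by auto

text \<open>The domain of a parametrization is not compact; the integrand lives on the preimage of
  the support, which is closed in the compact \<open>M\<close> and is pulled back by a continuous
  inverse.\<close>

lemma partition_support:
  assumes M: "compact M" and \<phi>: "parametrization M \<phi> V"
    and \<rho>: "closure {x \<in> M. \<rho> x \<noteq> 0} \<subseteq> \<phi> ` (V \<inter> half_space)"
  obtains C where "compact C" "C \<subseteq> V \<inter> half_space"
    "\<And>y. y \<in> V \<Longrightarrow> y $ first \<le> 0 \<Longrightarrow> \<rho> (\<phi> y) \<noteq> 0 \<Longrightarrow> y \<in> C"
proof -
  let ?S = "closure {x \<in> M. \<rho> x \<noteq> 0}"
  have "closed M"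
    using M by (rule compact_imp_closed)
  then have "?S \<subseteq> M"
    by (rule closure_minimal [rotated]) auto
  then have S: "compact ?S"
    using compact_Int_closed [OF M closed_closure, of "{x \<in> M. \<rho> x \<noteq> 0}"] by (simp add: Int_absorb1)
  obtain \<psi> where \<psi>: "homeomorphism (V \<inter> half_space) (\<phi> ` (V \<inter> half_space)) \<phi> \<psi>"
    using \<phi> unfolding parametrization_def by blast
  then have \<psi>1: "continuous_on (\<phi> ` (V \<inter> half_space)) \<psi>"
    and \<psi>2: "\<And>y. y \<in> V \<inter> half_space \<Longrightarrow> \<psi> (\<phi> y) = y"
    by (simp_all add: homeomorphism_def)
  show thesis
  proof (rule that [of "\<psi> ` ?S"])
    show "compact (\<psi> ` ?S)"
      using S continuous_on_subset [OF \<psi>1 \<rho>] by (rule compact_continuous_image [rotated])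
    show "\<psi> ` ?S \<subseteq> V \<inter> half_space"
    proof
      fix y assume "y \<in> \<psi> ` ?S"
      then obtain x where x: "x \<in> ?S" "y = \<psi> x"
        by blast
      then obtain y' where "y' \<in> V \<inter> half_space" "x = \<phi> y'"
        using \<rho> by blast
      then show "y \<in> V \<inter> half_space"
        using x(2) \<psi>2 by simp
    qed
    fix y assume y: "y \<in> V" "y $ first \<le> 0" "\<rho> (\<phi> y) \<noteq> 0"
    then have "\<phi> y \<in> M"
      using parametrizationD(5) [OF \<phi>, of y] by simp
    then have "\<phi> y \<in> ?S"
      using y(3) closure_subset [of "{x \<in> M. \<rho> x \<noteq> 0}"] by auto
    moreover have "\<psi> (\<phi> y) = y"
      using \<psi>2 y(1,2) by simp
    ultimately show "y \<in> \<psi> ` ?S"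
      using image_eqI [of y \<psi> "\<phi> y" ?S] by simp
  qed
qed

lemma coord_det_coordinate_frame:
  "coord_det L (coordinate_frame \<phi> y) = det (matrix (\<lambda>v. L (\<partial> \<phi> y v)))"
  unfolding coord_det_def matrix_def coordinate_frame_def
  by (subst det_transpose [symmetric]) (simp add: transpose_def)

context oriented_immersion
begin

lemma continuous_on_coord_det:
  assumes \<phi>: "parametrization M \<phi> V"
  shows "continuous_on V (\<lambda>y. coord_det L (coordinate_frame \<phi> y))"
  unfolding coord_det_def det_def coordinate_frame_def vec_lambda_beta
  by (intro continuous_intros continuous_on_L parametrizationD(3) [OF \<phi>])

lemma locally_inj_parametrization:
  assumes \<phi>: "parametrization M \<phi> V" "a \<in> V" "a $ first \<le> 0"
  obtains U where "open U" "a \<in> U" "inj_on (\<lambda>y. L (\<phi> y)) U"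
proof -
  obtain g where g: "local_chart \<phi> V a g"
    using local_chart_exists [OF \<phi>] .
  obtain U where "open U" "a \<in> U" "\<forall>y\<in>U. g (L (\<phi> y)) = y"
    using local_chartD(4) [OF g, unfolded eventually_nhds] by (elim exE conjE)
  then show thesis
    using inj_on_inverseI [of U g "\<lambda>y. L (\<phi> y)"] that by simp
qed

text \<open>The weight \<open>c\<close> will be 1 for projected areas and
  \<open>exp (- angle)\<close> for the volume. Fibre points outside the image of
  \<open>\<phi>\<close> drop out because \<open>\<rho>\<close> vanishes there.\<close>

lemma has_integral_chart:
  assumes M: "compact M" and \<phi>: "parametrization M \<phi> V"
    and \<rho>: "closure {x \<in> M. \<rho> x \<noteq> 0} \<subseteq> \<phi> ` (V \<inter> half_space)" "continuous_on M \<rho>"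
    and c: "continuous_on (V \<inter> half_space) (\<lambda>y. c (\<phi> y))"
  shows "((\<lambda>z. \<Sum>x\<in>{x \<in> M. L x = z}. \<rho> x * c x) has_integral
      integral (V \<inter> half_space) (\<lambda>y. \<rho> (\<phi> y) * c (\<phi> y) * \<bar>coord_det L (coordinate_frame \<phi> y)\<bar>)) UNIV"
    and "(\<lambda>y. \<rho> (\<phi> y) * c (\<phi> y) * \<bar>coord_det L (coordinate_frame \<phi> y)\<bar>) integrable_on V \<inter> half_space"
proof -
  let ?D = "\<lambda>y. coord_det L (coordinate_frame \<phi> y)"
  let ?G = "\<lambda>y. \<rho> (\<phi> y) * c (\<phi> y) * \<bar>?D y\<bar>"
  obtain C where C: "compact C" "C \<subseteq> V \<inter> half_space"
    "\<And>y. y \<in> V \<Longrightarrow> y $ first \<le> 0 \<Longrightarrow> \<rho> (\<phi> y) \<noteq> 0 \<Longrightarrow> y \<in> C"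
    using partition_support [OF M \<phi> \<rho>(1)] by blast
  have \<rho>cont: "continuous_on (V \<inter> half_space) (\<lambda>y. \<rho> (\<phi> y))"
    by (rule continuous_on_compose2 [OF \<rho>(2) continuous_on_subset [OF parametrizationD(6) [OF \<phi>]]])
      (use parametrizationD(5) [OF \<phi>] in auto)
  have F: "continuous_on C (\<lambda>y. \<rho> (\<phi> y) * c (\<phi> y))"
    by (rule continuous_on_subset [OF continuous_on_mult [OF \<rho>cont c] C(2)])
  have D: "continuous_on C ?D"
    using continuous_on_subset [OF continuous_on_coord_det [OF \<phi>]] C(2) by blast
  have "((\<lambda>z. \<Sum>y\<in>{y \<in> C. L (\<phi> y) = z}. \<rho> (\<phi> y) * c (\<phi> y)) has_integral
      integral C (\<lambda>y. \<bar>det (matrix (\<lambda>v. L (\<partial> \<phi> y v)))\<bar> * (\<rho> (\<phi> y) * c (\<phi> y)))) UNIV"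
  proof (rule area_formula [where f = "\<lambda>y. L (\<phi> y)" and f' = "\<lambda>y v. L (\<partial> \<phi> y v)"
        and F = "\<lambda>y. \<rho> (\<phi> y) * c (\<phi> y)", OF C(1) _ _ F])
    show "((\<lambda>y. L (\<phi> y)) has_derivative (\<lambda>v. L (\<partial> \<phi> y v))) (at y)" if "y \<in> C" for y
      using that C(2) by (intro has_derivative_L parametrizationD(2) [OF \<phi>]) auto
    show "\<exists>U. open U \<and> a \<in> U \<and> inj_on (\<lambda>y. L (\<phi> y)) (C \<inter> U)" if "a \<in> C" for a
    proof -
      have "a \<in> V" "a $ first \<le> 0"
        using that C(2) by auto
      then obtain U where "open U" "a \<in> U" "inj_on (\<lambda>y. L (\<phi> y)) U"
        by (rule locally_inj_parametrization [OF \<phi>])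
      then show ?thesis
        by (intro exI [of _ U]) (auto intro: inj_on_subset)
    qed
    show "continuous_on C (\<lambda>y. det (matrix (\<lambda>v. L (\<partial> \<phi> y v))))"
      using D by (simp add: coord_det_coordinate_frame)
  qed
  moreover have "(\<Sum>y\<in>{y \<in> C. L (\<phi> y) = z}. \<rho> (\<phi> y) * c (\<phi> y)) = (\<Sum>x\<in>{x \<in> M. L x = z}. \<rho> x * c x)" for z
  proof -
    have "inj_on \<phi> {y \<in> C. L (\<phi> y) = z}"
      by (rule inj_on_subset [OF parametrizationD(7) [OF \<phi>]]) (use C(2) in auto)
    then have "(\<Sum>y\<in>{y \<in> C. L (\<phi> y) = z}. \<rho> (\<phi> y) * c (\<phi> y)) = (\<Sum>x\<in>\<phi> ` {y \<in> C. L (\<phi> y) = z}. \<rho> x * c x)"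
      by (simp add: sum.reindex)
    also have "\<dots> = (\<Sum>x\<in>{x \<in> M. L x = z}. \<rho> x * c x)"
    proof (rule sum.mono_neutral_left)
      show "finite {x \<in> M. L x = z}"
        by (rule finite_fibre [OF M])
      show "\<phi> ` {y \<in> C. L (\<phi> y) = z} \<subseteq> {x \<in> M. L x = z}"
      proof
        fix x assume "x \<in> \<phi> ` {y \<in> C. L (\<phi> y) = z}"
        then obtain y where y: "y \<in> C" "L (\<phi> y) = z" "x = \<phi> y"
          by blast
        then have "y \<in> V \<inter> half_space"
          using C(2) by blast
        then show "x \<in> {x \<in> M. L x = z}"
          using parametrizationD(5) [OF \<phi>, of y] y by simp
      qed
      show "\<forall>x\<in>{x \<in> M. L x = z} - \<phi> ` {y \<in> C. L (\<phi> y) = z}. \<rho> x * c x = 0"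
      proof
        fix x assume x: "x \<in> {x \<in> M. L x = z} - \<phi> ` {y \<in> C. L (\<phi> y) = z}"
        have "\<rho> x = 0"
        proof (rule ccontr)
          assume nz: "\<rho> x \<noteq> 0"
          then have "x \<in> \<phi> ` (V \<inter> half_space)"
            using x \<rho>(1) closure_subset [of "{x \<in> M. \<rho> x \<noteq> 0}"] by blast
          then obtain y where "y \<in> V" "y $ first \<le> 0" "x = \<phi> y"
            by auto
          with nz C(3) [of y] x show False
            by auto
        qed
        then show "\<rho> x * c x = 0"
          by simp
      qed
    qed
    finally show ?thesis .
  qed
  moreover have G: "\<bar>det (matrix (\<lambda>v. L (\<partial> \<phi> y v)))\<bar> * (\<rho> (\<phi> y) * c (\<phi> y)) = ?G y" for y
    by (simp add: coord_det_coordinate_frame)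
  moreover have "integral C ?G = integral (V \<inter> half_space) ?G"
  proof (rule integral_spike_set)
    show "negligible {x \<in> C - V \<inter> half_space. ?G x \<noteq> 0}"
      using C(2) by (intro negligible_subset [OF negligible_empty]) auto
    show "negligible {x \<in> V \<inter> half_space - C. ?G x \<noteq> 0}"
      using C(3) by (intro negligible_subset [OF negligible_empty]) auto
  qed
  ultimately show "((\<lambda>z. \<Sum>x\<in>{x \<in> M. L x = z}. \<rho> x * c x) has_integral
      integral (V \<inter> half_space) ?G) UNIV"
    by simp
  have "continuous_on C ?G"
    by (rule continuous_on_mult [OF F continuous_on_rabs [OF D]])
  then have "?G absolutely_integrable_on C"
    using C(1) by (intro absolutely_integrable_on_subset_of_compact [OF C(1)]) (auto simp: borel_compact)
  then have "?G integrable_on C"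
    by (rule set_lebesgue_integral_eq_integral)
  then show "?G integrable_on V \<inter> half_space"
    by (rule integrable_spike_set) (use C(2,3) in \<open>auto intro!: negligible_subset [OF negligible_empty]\<close>)
qed

text \<open>The function on the left contains no trace of the partition, because the weights add up
  to 1; this is the source of the independence of all choices.\<close>

lemma has_integral_partition:
  assumes M: "compact M" and P: "subordinate_partition M K \<phi> V \<rho>"
    and c: "\<And>k. k < K \<Longrightarrow> continuous_on (V k \<inter> half_space) (\<lambda>y. c (\<phi> k y))"
  shows "((\<lambda>z. \<Sum>x\<in>{x \<in> M. L x = z}. c x) has_integral
      (\<Sum>k<K. integral (V k \<inter> half_space)
        (\<lambda>y. \<rho> k (\<phi> k y) * c (\<phi> k y) * \<bar>coord_det L (coordinate_frame (\<phi> k) y)\<bar>))) UNIV"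
proof -
  note PD = subordinate_partitionD [OF P]
  have "((\<lambda>z. \<Sum>k<K. \<Sum>x\<in>{x \<in> M. L x = z}. \<rho> k x * c x) has_integral
      (\<Sum>k<K. integral (V k \<inter> half_space)
        (\<lambda>y. \<rho> k (\<phi> k y) * c (\<phi> k y) * \<bar>coord_det L (coordinate_frame (\<phi> k) y)\<bar>))) UNIV"
  proof (rule has_integral_sum)
    fix k assume "k \<in> {..<K}"
    then have k: "k < K"
      by simp
    show "((\<lambda>z. \<Sum>x\<in>{x \<in> M. L x = z}. \<rho> k x * c x) has_integral
      integral (V k \<inter> half_space)
        (\<lambda>y. \<rho> k (\<phi> k y) * c (\<phi> k y) * \<bar>coord_det L (coordinate_frame (\<phi> k) y)\<bar>)) UNIV"
      by (rule has_integral_chart(1) [OF M PD(1) [OF k] PD(4) [OF k] PD(2) [OF k] c [OF k]])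
  qed simp
  moreover have "(\<Sum>k<K. \<Sum>x\<in>{x \<in> M. L x = z}. \<rho> k x * c x) = (\<Sum>x\<in>{x \<in> M. L x = z}. c x)" for z
    by (subst sum.swap) (simp add: sum_distrib_right [symmetric] PD(5))
  ultimately show ?thesis
    by simp
qed

end

lemma subordinate_partition_exists:
  assumes "compact M" and M: "submanifold M"
  obtains K \<phi> V \<rho> where "subordinate_partition M K \<phi> V \<rho>"
proof -
  have "\<exists>\<phi> V r. parametrization M \<phi> V \<and> r > 0 \<and> M \<inter> ball x r \<subseteq> \<phi> ` (V \<inter> half_space)" if x: "x \<in> M" for x
  proof -
    obtain \<phi> V y where \<phi>: "parametrization M \<phi> V" "y \<in> V" "y $ first \<le> 0" "\<phi> y = x"
      using M x unfolding submanifold_def by fastforce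
    then show ?thesis
      using parametrization_ball [OF \<phi>(1) parametrizationD(1) [OF \<phi>(1)] order_refl \<phi>(2,3)] by metis
  qed
  then obtain \<phi> V r where \<phi>: "\<And>x. x \<in> M \<Longrightarrow> parametrization M (\<phi> x) (V x) \<and> r x > 0 \<and>
      M \<inter> ball x (r x) \<subseteq> \<phi> x ` (V x \<inter> half_space)"
    by metis
  have "M \<subseteq> (\<Union>x\<in>M. ball x (r x / 2))"
    using \<phi> by force
  then obtain D where D: "D \<subseteq> M" "finite D" "M \<subseteq> (\<Union>x\<in>D. ball x (r x / 2))"
    using compactE_image [OF \<open>compact M\<close>, of M "\<lambda>x. ball x (r x / 2)"] by auto
  obtain d where d: "bij_betw d {0..<card D} D"
    using ex_bij_betw_nat_finite [OF D(2)] by blast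
  let ?K = "card D"
  have dD: "d k \<in> D" "d k \<in> M" if "k < ?K" for k
    using d that D(1) by (auto simp: bij_betw_def)
  \<comment> \<open>Continuous tent functions on half of each radius: the closed half balls still
    lie in the balls covered by the parametrizations, and the open half balls cover
    \<open>M\<close>, so that the sum is positive there.\<close>
  define \<beta> where "\<beta> k x = max 0 (r (d k) / 2 - dist (d k) x)" for k x
  define \<sigma> where "\<sigma> x = (\<Sum>k<?K. \<beta> k x)" for x
  have \<beta>: "0 \<le> \<beta> k x" for k x
    by (simp add: \<beta>_def)
  have \<sigma>: "\<sigma> x > 0" if x: "x \<in> M" for x
  proof -
    obtain y where "y \<in> D" "x \<in> ball y (r y / 2)"
      using D(3) x by auto
    moreover obtain k where "k < ?K" "d k = y"
      using bij_betw_imp_surj_on [OF d] \<open>y \<in> D\<close> by (metis atLeastLessThan_iff imageE)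
    ultimately have "\<beta> k x > 0" "k \<in> {..<?K}"
      by (auto simp: \<beta>_def)
    then show ?thesis
      unfolding \<sigma>_def using \<beta> by (intro sum_pos2 [of _ k]) auto
  qed
  have cont: "continuous_on M (\<beta> k)" for k
    unfolding \<beta>_def by (intro continuous_intros)
  have "subordinate_partition M ?K (\<lambda>k. \<phi> (d k)) (\<lambda>k. V (d k)) (\<lambda>k x. \<beta> k x / \<sigma> x)"
    unfolding subordinate_partition_def
  proof (intro conjI allI impI ballI)
    fix k assume k: "k < ?K"
    show "parametrization M (\<phi> (d k)) (V (d k))"
      using \<phi> dD(2) [OF k] by blast
    show "continuous_on M (\<lambda>x. \<beta> k x / \<sigma> x)"
      unfolding \<sigma>_def using \<sigma> by (intro continuous_intros cont) (auto simp: \<sigma>_def less_imp_neq [symmetric])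
    show "0 \<le> \<beta> k x / \<sigma> x" if "x \<in> M" for x
      using \<beta> \<sigma> [OF that] by simp
    have "closure {x \<in> M. \<beta> k x / \<sigma> x \<noteq> 0} \<subseteq> M \<inter> cball (d k) (r (d k) / 2)"
      using compact_imp_closed [OF \<open>compact M\<close>]
      by (intro closure_minimal closed_Int closed_cball) (auto simp: \<beta>_def max_def split: if_splits)
    also have "\<dots> \<subseteq> M \<inter> ball (d k) (r (d k))"
      using \<phi> [OF dD(2) [OF k]] by auto
    also have "\<dots> \<subseteq> \<phi> (d k) ` (V (d k) \<inter> half_space)"
      using \<phi> [OF dD(2) [OF k]] by blast
    finally show "closure {x \<in> M. \<beta> k x / \<sigma> x \<noteq> 0} \<subseteq> \<phi> (d k) ` (V (d k) \<inter> half_space)" .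
  next
    fix x assume "x \<in> M"
    then show "(\<Sum>k<?K. \<beta> k x / \<sigma> x) = 1"
      using \<sigma> [of x] by (simp add: \<sigma>_def flip: sum_divide_distrib)
  qed
  then show thesis
    by (rule that)
qed

section \<open>Volume and phase\<close>

text \<open>\<open>y\<close> may lie on the bounding hyperplane, so no neighbourhood of it need be
  available. A box with \<open>y\<close> as its upper corner stays in the half space and has
  nonempty interior.\<close>

lemma continuous_nonneg_integral_0_imp_0:
  fixes h :: "real ^ 'n::{finite,wellorder} \<Rightarrow> real"
  assumes V: "open V" and cont: "continuous_on (V \<inter> half_space) h"
    and nonneg: "\<And>y. y \<in> V \<inter> half_space \<Longrightarrow> 0 \<le> h y"
    and int: "h integrable_on V \<inter> half_space" "integral (V \<inter> half_space) h = 0"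
    and y: "y \<in> V \<inter> half_space"
  shows "h y = 0"
proof -
  have "y \<in> V"
    using y by blast
  then obtain a b where ab: "cbox a b \<subseteq> V" "y \<in> box a b" "\<forall>i\<in>Basis. a \<bullet> i < b \<bullet> i"
    by (rule open_contains_cbox [OF V])
  have "cbox a y \<subseteq> cbox a b"
    using ab(2) by (auto simp: subset_box mem_box less_imp_le)
  moreover have "cbox a y \<subseteq> half_space"
  proof
    fix z assume "z \<in> cbox a y"
    then have "z \<bullet> axis first 1 \<le> y \<bullet> axis first 1"
      by (auto simp: mem_box)
    then show "z \<in> half_space"
      using y by (simp add: inner_axis)
  qed
  ultimately have sub: "cbox a y \<subseteq> V \<inter> half_space"
    using ab(1) by blast
  have cont': "continuous_on (cbox a y) h"
    using cont sub by (rule continuous_on_subset)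
  then have int': "h integrable_on cbox a y"
    by (rule integrable_continuous)
  have "integral (cbox a y) h \<le> integral (V \<inter> half_space) h"
    by (rule integral_subset_le [OF sub int' int(1)]) (use nonneg in blast)
  moreover have "0 \<le> integral (cbox a y) h"
    by (rule integral_nonneg [OF int']) (use nonneg sub in blast)
  ultimately have "(h has_integral 0) (cbox a y)"
    using int' int(2) by (simp add: has_integral_iff)
  moreover have "box a y \<noteq> {}" "y \<in> cbox a y"
    using ab(2) by (auto simp: mem_box box_ne_empty less_imp_le)
  moreover have "0 \<le> h x" if "x \<in> box a y" for x
    using nonneg sub box_subset_cbox that by blast
  ultimately show ?thesis
    by (intro has_integral_0_cbox_imp_0 [OF cont'])
qed

section \<open>Lagrangian submanifolds of a fixed type\<close>

locale LAG_submanifold =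
  fixes s :: real and p q :: nat and M :: "(double ^ 'n::{finite,wellorder}) set"
    and ori :: "double ^ 'n::_ \<Rightarrow> ('n \<Rightarrow> double ^ 'n::_) set"
  assumes s: "s = 1 \<or> s = - 1" and type: "of_type_LAG s p q M ori" and compact: "compact M"
begin

lemma LAG: "x \<in> M \<Longrightarrow> ori x \<in> LAG s p q"
  using type by (simp add: of_type_LAG_def)

sublocale u: oriented_immersion "null_coord 1" s M ori
proof (rule oriented_immersion.intro)
  show "orientation M ori"
    using type by (simp add: of_type_LAG_def)
  fix x b assume "x \<in> M" "b \<in> ori x"
  then show "0 < s * coord_det (null_coord 1) b"
    by (simp add: LAG_phase(1) [OF LAG range_subset_plane] LAG_phase(3) [OF LAG])
qed (rule linear_null_coord)

text \<open>The factor \<open>(- 1) ^ q\<close> is the image of the q-th power of \<tau> under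
  \<tau> \<mapsto> -1.\<close>

sublocale v: oriented_immersion "null_coord (- 1)" "s * (- 1) ^ q" M ori
proof (rule oriented_immersion.intro)
  show "orientation M ori"
    using type by (simp add: of_type_LAG_def)
  fix x b assume "x \<in> M" "b \<in> ori x"
  then show "0 < s * (- 1) ^ q * coord_det (null_coord (- 1)) b"
    by (simp add: LAG_phase(2) [OF LAG range_subset_plane] LAG_phase(3) [OF LAG])
qed (rule linear_null_coord)

abbreviation "du \<phi> y \<equiv> coord_det (null_coord 1) (coordinate_frame \<phi> y)"
abbreviation "dv \<phi> y \<equiv> coord_det (null_coord (- 1)) (coordinate_frame \<phi> y)"
abbreviation "angle x \<equiv> phase s q (ori x)"

text \<open>The orientation sign in the integral turns \<open>dvol\<close> into its absolute value.
  From here on only absolute values of determinants occur, as in the area formula.\<close>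

lemma coordinate_frame_volume:
  assumes \<phi>: "parametrization M \<phi> V" "y \<in> V" "y $ first \<le> 0"
  defines "D \<equiv> dvol (ori (\<phi> y)) (coordinate_frame \<phi> y)"
  shows "(if coordinate_frame \<phi> y \<in> ori (\<phi> y) then 1 else - 1) * D = \<bar>D\<bar>"
    and "\<bar>du \<phi> y\<bar> = exp (angle (\<phi> y)) * \<bar>D\<bar>"
    and "\<bar>dv \<phi> y\<bar> = exp (- angle (\<phi> y)) * \<bar>D\<bar>"
    and "D \<noteq> 0"
proof -
  have x: "\<phi> y \<in> M"
    by (rule parametrizationD(5) [OF \<phi>])
  have rng: "range (coordinate_frame \<phi> y) \<subseteq> plane (ori (\<phi> y))"
    using u.range_tangent [OF \<phi>] by (auto simp: coordinate_frame_def)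
  have du: "s * du \<phi> y = exp (angle (\<phi> y)) * D"
    and dv: "s * (- 1) ^ q * dv \<phi> y = exp (- angle (\<phi> y)) * D"
    unfolding D_def by (rule LAG_phase(1,2) [OF LAG [OF x] rng])+
  have "coordinate_frame \<phi> y \<in> ori (\<phi> y) \<longleftrightarrow> 0 < D"
    using u.pos_iff_mem_orientation [OF x rng] by (simp add: du zero_less_mult_iff)
  then show "(if coordinate_frame \<phi> y \<in> ori (\<phi> y) then 1 else - 1) * D = \<bar>D\<bar>"
    by auto
  have "\<bar>s\<bar> = 1"
    using s by auto
  then show 1: "\<bar>du \<phi> y\<bar> = exp (angle (\<phi> y)) * \<bar>D\<bar>"
    using arg_cong [OF du, of abs] by (simp add: abs_mult)
  show "\<bar>dv \<phi> y\<bar> = exp (- angle (\<phi> y)) * \<bar>D\<bar>"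
    using arg_cong [OF dv, of abs] \<open>\<bar>s\<bar> = 1\<close> by (simp add: abs_mult power_abs)
  have "du \<phi> y \<noteq> 0"
    using u.bij_tangent [OF \<phi>] by (simp add: coord_det_coordinate_frame det_nz_iff_inj bij_def)
  then show "D \<noteq> 0"
    using 1 by auto
qed

text \<open>The phase is given by a description, so its continuity is not visible; but the quotient
  of the absolute values of dv and du is \<open>exp (- 2 * angle)\<close>, and both determinants are
  continuous.\<close>

lemma continuous_on_angle:
  assumes \<phi>: "parametrization M \<phi> V"
  shows "continuous_on (V \<inter> half_space) (\<lambda>y. exp (- angle (\<phi> y)))"
proof -
  have "continuous_on (V \<inter> half_space) (\<lambda>y. sqrt (\<bar>dv \<phi> y\<bar> / \<bar>du \<phi> y\<bar>))"
  proof (intro continuous_intros)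
    show "continuous_on (V \<inter> half_space) (dv \<phi>)" "continuous_on (V \<inter> half_space) (du \<phi>)"
      by (rule continuous_on_subset [OF v.continuous_on_coord_det [OF \<phi>]], simp)
        (rule continuous_on_subset [OF u.continuous_on_coord_det [OF \<phi>]], simp)
    show "\<forall>y\<in>V \<inter> half_space. \<bar>du \<phi> y\<bar> \<noteq> 0"
      using coordinate_frame_volume [OF \<phi>] by auto
  qed
  moreover have "sqrt (\<bar>dv \<phi> y\<bar> / \<bar>du \<phi> y\<bar>) = exp (- angle (\<phi> y))" if y: "y \<in> V \<inter> half_space" for y
  proof (rule real_sqrt_unique)
    have "(exp (- angle (\<phi> y)))\<^sup>2 * exp (angle (\<phi> y)) = exp (- angle (\<phi> y))"
      by (simp add: power2_eq_square flip: exp_add)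
    then show "(exp (- angle (\<phi> y)))\<^sup>2 = \<bar>dv \<phi> y\<bar> / \<bar>du \<phi> y\<bar>"
      using coordinate_frame_volume [OF \<phi>, of y] y by (simp add: field_simps)
  qed simp
  ultimately show ?thesis
    by (rule continuous_on_eq)
qed

text \<open>Here the description defining the volume is justified: each admissible value is the
  integral of one function on the target space, namely the fibre sum of \<open>exp (- angle)\<close>
  under the first projection.\<close>

lemma vol_partition:
  assumes P: "subordinate_partition M K \<phi> V \<rho>"
  shows "vol M ori = (\<Sum>k<K. integral (V k \<inter> half_space)
    (\<lambda>y. \<rho> k (\<phi> k y) * exp (- angle (\<phi> k y)) * \<bar>du (\<phi> k) y\<bar>))" (is "_ = ?I K \<phi> V \<rho>")
proof -
  have int: "((\<lambda>z. \<Sum>x\<in>{x \<in> M. null_coord 1 x = z}. exp (- angle x)) has_integral ?I K \<phi> V \<rho>) UNIV"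
    if "subordinate_partition M K \<phi> V \<rho>" for K \<phi> V \<rho>
    by (rule u.has_integral_partition [OF compact that])
      (rule continuous_on_angle [OF subordinate_partitionD(1) [OF that]])
  have eq: "(\<Sum>k<K. integral (V k \<inter> half_space) (\<lambda>y. \<rho> k (\<phi> k y) *
      (if coordinate_frame (\<phi> k) y \<in> ori (\<phi> k y) then 1 else - 1) *
      dvol (ori (\<phi> k y)) (coordinate_frame (\<phi> k) y))) = ?I K \<phi> V \<rho>"
    if P: "subordinate_partition M K \<phi> V \<rho>" for K \<phi> V \<rho>
  proof (intro sum.cong refl integral_cong)
    fix k y assume "k \<in> {..<K}" "y \<in> V k \<inter> half_space"
    then have *: "parametrization M (\<phi> k) (V k)" "y \<in> V k" "y $ first \<le> 0"
      using subordinate_partitionD(1) [OF P] by auto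
    have "\<bar>dvol (ori (\<phi> k y)) (coordinate_frame (\<phi> k) y)\<bar> = exp (- angle (\<phi> k y)) * \<bar>du (\<phi> k) y\<bar>"
      by (simp add: coordinate_frame_volume(2) [OF *] flip: mult.assoc exp_add)
    then show "\<rho> k (\<phi> k y) * (if coordinate_frame (\<phi> k) y \<in> ori (\<phi> k y) then 1 else - 1) *
        dvol (ori (\<phi> k y)) (coordinate_frame (\<phi> k) y) =
        \<rho> k (\<phi> k y) * exp (- angle (\<phi> k y)) * \<bar>du (\<phi> k) y\<bar>"
      using coordinate_frame_volume(1) [OF *] by (simp only: mult.assoc)
  qed
  have iff: "has_form_integral M ori (\<lambda>x. dvol (ori x)) I \<longleftrightarrow>
      (\<exists>K \<phi> V \<rho>. subordinate_partition M K \<phi> V \<rho> \<and> I = ?I K \<phi> V \<rho>)" for I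
  proof -
    have "has_form_integral M ori (\<lambda>x. dvol (ori x)) I \<longleftrightarrow>
      (\<exists>K \<phi> V \<rho>. subordinate_partition M K \<phi> V \<rho> \<and>
         I = (\<Sum>k<K. integral (V k \<inter> half_space) (\<lambda>y. \<rho> k (\<phi> k y) *
            (if coordinate_frame (\<phi> k) y \<in> ori (\<phi> k y) then 1 else - 1) *
            dvol (ori (\<phi> k y)) (coordinate_frame (\<phi> k) y))))"
      unfolding has_form_integral_def subordinate_partition_def by (simp only: conj_assoc)
    then show ?thesis
      by (simp add: eq cong: conj_cong)
  qed
  show ?thesis
    unfolding vol_def form_integral_def
  proof (rule the_equality)
    show "has_form_integral M ori (\<lambda>x. dvol (ori x)) (?I K \<phi> V \<rho>)"
      using iff P by blast
    fix I assume "has_form_integral M ori (\<lambda>x. dvol (ori x)) I"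
    then obtain K' \<phi>' V' \<rho>' where P': "subordinate_partition M K' \<phi>' V' \<rho>'" "I = ?I K' \<phi>' V' \<rho>'"
      using iff by blast
    show "I = ?I K \<phi> V \<rho>"
      unfolding P'(2) by (rule has_integral_unique [OF int [OF P'(1)] int [OF P]])
  qed
qed

definition projected_area :: "(double ^ 'n::_ \<Rightarrow> real ^ 'n::_) \<Rightarrow> real"
  where "projected_area L = integral UNIV (\<lambda>z. real (card {x \<in> M. L x = z}))"

text \<open>The inequality of arithmetic and geometric means, integrated:
  \<open>exp (- \<theta>) * \<bar>du\<bar>\<close> and \<open>exp \<theta> * \<bar>dv\<bar>\<close>
  have the squared volume density as their product. Bound minus volume is the integral of a
  continuous nonnegative defect, so equality forces it to vanish pointwise.\<close>

lemma vol_bound: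
  defines "bound \<theta> \<equiv> (exp (- \<theta>) * projected_area (null_coord 1) + exp \<theta> * projected_area (null_coord (- 1))) / 2"
  shows "vol M ori \<le> bound \<theta>" and "vol M ori = bound \<theta> \<longleftrightarrow> constant_phase s q M ori \<theta>"
proof -
  have "submanifold M"
    using type by (simp add: of_type_LAG_def)
  then obtain K \<phi> V \<rho> where P: "subordinate_partition M K \<phi> V \<rho>"
    using subordinate_partition_exists [OF compact] by blast
  note PD = subordinate_partitionD [OF P]
  let ?H = half_space
  \<comment> \<open>The density of bound minus volume, written in quantities whose continuity and
    integrability are already available; below it is rewritten in the form that shows its
    sign.\<close>
  let ?w = "\<lambda>k y. exp (- \<theta>) / 2 * \<bar>du (\<phi> k) y\<bar> + exp \<theta> / 2 * \<bar>dv (\<phi> k) y\<bar>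
    - exp (- angle (\<phi> k y)) * \<bar>du (\<phi> k) y\<bar>"
  let ?h = "\<lambda>k y. \<rho> k (\<phi> k y) * ?w k y"
  have c1: "continuous_on S (\<lambda>y. 1 :: real)" for S :: "(real ^ 'n::_) set"
    by (rule continuous_on_const)
  have areau: "projected_area (null_coord 1) =
      (\<Sum>k<K. integral (V k \<inter> ?H) (\<lambda>y. \<rho> k (\<phi> k y) * 1 * \<bar>du (\<phi> k) y\<bar>))"
    using u.has_integral_partition [OF compact P c1] unfolding projected_area_def
    by (intro integral_unique) simp
  have areav: "projected_area (null_coord (- 1)) =
      (\<Sum>k<K. integral (V k \<inter> ?H) (\<lambda>y. \<rho> k (\<phi> k y) * 1 * \<bar>dv (\<phi> k) y\<bar>))"
    using v.has_integral_partition [OF compact P c1] unfolding projected_area_def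
    by (intro integral_unique) simp
  have int: "(?h k has_integral exp (- \<theta>) / 2 * integral (V k \<inter> ?H) (\<lambda>y. \<rho> k (\<phi> k y) * 1 * \<bar>du (\<phi> k) y\<bar>)
      + exp \<theta> / 2 * integral (V k \<inter> ?H) (\<lambda>y. \<rho> k (\<phi> k y) * 1 * \<bar>dv (\<phi> k) y\<bar>)
      - integral (V k \<inter> ?H) (\<lambda>y. \<rho> k (\<phi> k y) * exp (- angle (\<phi> k y)) * \<bar>du (\<phi> k) y\<bar>)) (V k \<inter> ?H)"
    if k: "k < K" for k
  proof -
    note 1 = u.has_integral_chart(2) [OF compact PD(1) [OF k] PD(4) [OF k] PD(2) [OF k] c1]
    note 2 = v.has_integral_chart(2) [OF compact PD(1) [OF k] PD(4) [OF k] PD(2) [OF k] c1]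
    note 3 = u.has_integral_chart(2) [OF compact PD(1) [OF k] PD(4) [OF k] PD(2) [OF k]
        continuous_on_angle [OF PD(1) [OF k]]]
    have "((\<lambda>y. exp (- \<theta>) / 2 * (\<rho> k (\<phi> k y) * 1 * \<bar>du (\<phi> k) y\<bar>)
        + exp \<theta> / 2 * (\<rho> k (\<phi> k y) * 1 * \<bar>dv (\<phi> k) y\<bar>)
        - \<rho> k (\<phi> k y) * exp (- angle (\<phi> k y)) * \<bar>du (\<phi> k) y\<bar>) has_integral
      exp (- \<theta>) / 2 * integral (V k \<inter> ?H) (\<lambda>y. \<rho> k (\<phi> k y) * 1 * \<bar>du (\<phi> k) y\<bar>)
      + exp \<theta> / 2 * integral (V k \<inter> ?H) (\<lambda>y. \<rho> k (\<phi> k y) * 1 * \<bar>dv (\<phi> k) y\<bar>)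
      - integral (V k \<inter> ?H) (\<lambda>y. \<rho> k (\<phi> k y) * exp (- angle (\<phi> k y)) * \<bar>du (\<phi> k) y\<bar>)) (V k \<inter> ?H)"
      by (intro has_integral_diff has_integral_add has_integral_mult_right integrable_integral 1 2 3)
    then show ?thesis
      by (simp add: algebra_simps)
  qed
  have defect: "bound \<theta> - vol M ori = (\<Sum>k<K. integral (V k \<inter> ?H) (?h k))"
  proof -
    have "(\<Sum>k<K. integral (V k \<inter> ?H) (?h k)) =
      (\<Sum>k<K. exp (- \<theta>) / 2 * integral (V k \<inter> ?H) (\<lambda>y. \<rho> k (\<phi> k y) * 1 * \<bar>du (\<phi> k) y\<bar>)
      + exp \<theta> / 2 * integral (V k \<inter> ?H) (\<lambda>y. \<rho> k (\<phi> k y) * 1 * \<bar>dv (\<phi> k) y\<bar>)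
      - integral (V k \<inter> ?H) (\<lambda>y. \<rho> k (\<phi> k y) * exp (- angle (\<phi> k y)) * \<bar>du (\<phi> k) y\<bar>))"
      by (intro sum.cong refl integral_unique int) simp
    also have "\<dots> = exp (- \<theta>) / 2 * projected_area (null_coord 1)
        + exp \<theta> / 2 * projected_area (null_coord (- 1)) - vol M ori"
      unfolding sum_subtractf sum.distrib areau areav vol_partition [OF P] sum_distrib_left ..
    finally show ?thesis
      by (simp add: bound_def add_divide_distrib)
  qed
  have w: "?w k y = \<bar>dvol (ori (\<phi> k y)) (coordinate_frame (\<phi> k) y)\<bar> * (cosh (angle (\<phi> k y) - \<theta>) - 1)"
    if "k < K" "y \<in> V k \<inter> ?H" for k y
  proof -
    have *: "parametrization M (\<phi> k) (V k)" "y \<in> V k" "y $ first \<le> 0"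
      using PD(1) that by auto
    have "exp (- \<theta>) / 2 * (exp t * D) + exp \<theta> / 2 * (exp (- t) * D) - exp (- t) * (exp t * D)
        = D * (cosh (t - \<theta>) - 1)" for t D
    proof -
      have e: "exp (- \<theta>) * exp t = exp (t - \<theta>)" "exp \<theta> * exp (- t) = exp (- (t - \<theta>))"
          "exp (- t) * exp t = 1"
        by (simp_all flip: exp_add)
      have "exp (- \<theta>) / 2 * (exp t * D) + exp \<theta> / 2 * (exp (- t) * D) - exp (- t) * (exp t * D)
          = (exp (- \<theta>) * exp t) * D / 2 + (exp \<theta> * exp (- t)) * D / 2 - (exp (- t) * exp t) * D"
        by simp
      then show ?thesis
        unfolding e cosh_field_def by (simp add: algebra_simps)
    qed
    then show ?thesis
      unfolding coordinate_frame_volume(2,3) [OF *] .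
  qed
  have cosh1: "1 \<le> cosh t" for t :: real
    by (rule cosh_real_ge_1)
  have h_nonneg: "0 \<le> ?h k y" if "k < K" "y \<in> V k \<inter> ?H" for k y
  proof -
    have "0 \<le> \<rho> k (\<phi> k y)"
      using that parametrizationD(5) [OF PD(1)] by (intro PD(3)) auto
    then show ?thesis
      unfolding w [OF that] using cosh1 by simp
  qed
  have int_nonneg: "0 \<le> integral (V k \<inter> ?H) (?h k)" if "k < K" for k
    using int [OF that] h_nonneg [OF that] by (intro integral_nonneg) (auto simp: has_integral_iff)
  then have "0 \<le> (\<Sum>k<K. integral (V k \<inter> ?H) (?h k))"
    by (intro sum_nonneg) simp
  then show "vol M ori \<le> bound \<theta>"
    using defect by linarith
  show "vol M ori = bound \<theta> \<longleftrightarrow> constant_phase s q M ori \<theta>"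
  proof
    assume cp: "constant_phase s q M ori \<theta>"
    have "integral (V k \<inter> ?H) (?h k) = 0" if k: "k < K" for k
    proof -
      have "?h k y = 0" if y: "y \<in> V k \<inter> ?H" for y
      proof -
        have "\<phi> k y \<in> M"
          using parametrizationD(5) [OF PD(1) [OF k]] y by auto
        then show ?thesis
          unfolding w [OF k y] using cp by (simp add: constant_phase_def)
      qed
      then show ?thesis
        by (metis (mono_tags, lifting) integral_0 integral_cong)
    qed
    then show "vol M ori = bound \<theta>"
      using defect by simp
  next
    assume "vol M ori = bound \<theta>"
    then have "(\<Sum>k<K. integral (V k \<inter> ?H) (?h k)) = 0"
      using defect by simp
    then have int0: "integral (V k \<inter> ?H) (?h k) = 0" if "k < K" for k
      using that int_nonneg by (subst (asm) sum_nonneg_eq_0_iff) auto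
    show "constant_phase s q M ori \<theta>"
      unfolding constant_phase_def
    proof
      fix x assume x: "x \<in> M"
      \<comment> \<open>The weights add up to 1 at \<open>x\<close>, so one is nonzero there; for
        this one the vanishing of the weighted defect gives the vanishing of the defect
        itself.\<close>
      obtain k where k: "k < K" "\<rho> k x \<noteq> 0"
        using PD(5) [OF x] by (metis (no_types, lifting) lessThan_iff sum.neutral zero_neq_one)
      then have "x \<in> \<phi> k ` (V k \<inter> ?H)"
        using PD(4) [OF k(1)] closure_subset [of "{x \<in> M. \<rho> k x \<noteq> 0}"] x by blast
      then obtain y where y: "y \<in> V k \<inter> ?H" "x = \<phi> k y"
        by blast
      note \<phi> = PD(1) [OF k(1)]
      have "?h k y = 0"
      proof (rule continuous_nonneg_integral_0_imp_0 [OF parametrizationD(1) [OF \<phi>] _ h_nonneg [OF k(1)] _ int0 [OF k(1)] y(1)])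
        have \<rho>: "continuous_on (V k \<inter> ?H) (\<lambda>y. \<rho> k (\<phi> k y))"
          by (rule continuous_on_compose2 [OF PD(2) [OF k(1)] continuous_on_subset [OF parametrizationD(6) [OF \<phi>]]])
            (use parametrizationD(5) [OF \<phi>] in auto)
        have "continuous_on (V k \<inter> ?H) (dv (\<phi> k))" "continuous_on (V k \<inter> ?H) (du (\<phi> k))"
          by (rule continuous_on_subset [OF v.continuous_on_coord_det [OF \<phi>]], simp)
            (rule continuous_on_subset [OF u.continuous_on_coord_det [OF \<phi>]], simp)
        then show "continuous_on (V k \<inter> ?H) (?h k)"
          by (intro continuous_on_mult continuous_on_diff continuous_on_add continuous_on_const
              continuous_on_rabs \<rho> continuous_on_angle [OF \<phi>])
        show "?h k integrable_on V k \<inter> ?H"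
          using int [OF k(1)] by blast
      qed
      then have "?w k y = 0"
        using k(2) y(2) by simp
      then have "cosh (angle x - \<theta>) = 1"
        using coordinate_frame_volume(4) [OF \<phi>, of y] y unfolding w [OF k(1) y(1)] by simp
      then show "angle x = \<theta>"
        by (simp add: cosh_real_one_iff)
    qed
  qed
qed

end

theorem theorem16p5:
  fixes M N :: "(double ^ 'n::{finite,wellorder}) set"
    and oM oN :: "double ^ 'n::_ \<Rightarrow> ('n \<Rightarrow> double ^ 'n::_) set"
    and p q :: nat and s \<theta> :: real
  assumes "p + q = CARD('n)" and "s = 1 \<or> s = - 1"
    and "compact M" and "of_type_LAG s p q M oM" and "constant_phase s q M oM \<theta>"
    and "compact N" and "of_type_LAG s p q N oN"
    and "oriented_boundary N oN = oriented_boundary M oM"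
  shows "vol M oM \<ge> vol N oN \<and> (vol M oM = vol N oN \<longleftrightarrow> constant_phase s q N oN \<theta>)"
proof -
  interpret M: LAG_submanifold s p q M oM
    by unfold_locales (fact assms)+
  interpret N: LAG_submanifold s p q N oN
    by unfold_locales (fact assms)+
  have "M.projected_area (null_coord 1) = N.projected_area (null_coord 1)"
    unfolding M.projected_area_def N.projected_area_def
    by (subst card_fibre_eq [OF M.u.oriented_immersion_axioms N.u.oriented_immersion_axioms
          assms(3,6) assms(8) [symmetric]]) simp
  moreover have "M.projected_area (null_coord (- 1)) = N.projected_area (null_coord (- 1))"
    unfolding M.projected_area_def N.projected_area_def
    by (subst card_fibre_eq [OF M.v.oriented_immersion_axioms N.v.oriented_immersion_axioms
          assms(3,6) assms(8) [symmetric]]) simp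
  \<comment> \<open>With equal projected areas both volumes are compared to the same bound, which
    \<open>M\<close> attains by its constant phase.\<close>
  ultimately show ?thesis
    using M.vol_bound(2) [of \<theta>] N.vol_bound [of \<theta>] assms(5) by auto
qed

end
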